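(* Let $\nu\in\mathbb N_0$, $h',k\in\mathbb Z$ with $k>0$, and $z\in\mathbb C$ with $\mathrm{Re}(z)>0$. Then $$\mathcal E_{2,\nu,-\frac{h'}{k}}\!\left(\frac{h'}{k}+iz\right)=-\frac{2\pi^2}{27\sqrt3\,k^2}\sum_{\substack{r_1,r_2\bmod 3k\\ r_1\equiv r_2+\nu\bmod 3}}\zeta_{3k}^{-h'Q(\boldsymbol r)}\int_{\mathbb R^2}g_{k,\boldsymbol r}(\boldsymbol w)\,e^{-\frac23\pi zQ(\boldsymbol w)}\,dw_1\,dw_2.$$
   Context: $\vartheta_\ell(\tau):=\sum_{m\in\ell+\mathbb Z}e^{2\pi i m^2\tau}$ for $\tau\in\mathbb H$; principal branches of fractional powers. For $\varrho\in\mathbb Q$, $\mathcal E_{2,\nu,\varrho}(\tau):=\sum_{\alpha\bmod2}\int_\varrho^{i\infty}\int_{w_1}^{i\infty}\frac{\vartheta_{\alpha/2}(w_2)\vartheta_{(2\nu+3\alpha)/6}(3w_1)}{(-i(w_2+\tau))^{3/2}(-i(w_1+\tau))^{3/2}}dw_2\,dw_1$. $\zeta_m:=e^{2\pi i/m}$, $\boldsymbol r=(r_1,r_2)$, $\boldsymbol w=(w_1,w_2)$, $Q(x_1,x_2):=x_1^2+x_2^2+x_1x_2$. For $c\in\mathbb Q$, $w\in\mathbb R$: $g_c(w):=\frac{\sinh(2\pi w/3)}{\cosh(2\pi w/3)-\cos(2\pi c)}$, $f_c(w):=\frac{\sin(2\pi c)}{\cosh(2\pi w/3)-\cos(2\pi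 c)}$. For $r_1,r_2$ modulo $3k$ (representatives $0\le r_j<3k$) define $g_{k,\boldsymbol r}:\mathbb R^2\to\mathbb R$: if $r_1,r_2\not\equiv0\pmod{3k}$, $g_{k,\boldsymbol r}(\boldsymbol w)=(w_1^2+w_2^2+4w_1w_2)\big(g_{\frac{r_1}{3k}}(\frac{w_1}k)g_{\frac{r_2}{3k}}(\frac{w_2}k)-f_{\frac{r_1}{3k}}(\frac{w_1}k)f_{\frac{r_2}{3k}}(\frac{w_2}k)\big)$; if $r_1\equiv0\not\equiv r_2$, $g_{k,(0,r_2)}(\boldsymbol w)=(w_1^2+w_2^2+4w_1w_2)g_0(\frac{w_1}k)g_{\frac{r_2}{3k}}(\frac{w_2}k)-\frac{3k}{\pi w_1}(w_2+\frac{w_1}2)^2g_{\frac{r_2}{3k}}(\frac{w_2+w_1/2}{k})$; if $r_1\not\equiv0\equiv r_2$, $g_{k,(r_1,0)}:=g_{k,(0,r_1)}$; if $r_1\equiv r_2\equiv0$, $g_{k,\boldsymbol0}(\boldsymbol w)=(w_1^2+w_2^2+4w_1w_2)g_0(\frac{w_1}k)g_0(\frac{w_2}k)-\frac{3k}{\pi w_1}(w_2+\frac{w_1}2)^2g_0(\frac{w_2+w_1/2}{k})-\frac{3k}{\pi w_2}(w_1+\frac{w_2}2)^2g_0(\frac{w_1+w_2/2}{k})$ (removable singularities understood). *)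

theory Defs
  imports "HOL-Analysis.Analysis" "HOL-Number_Theory.Cong"
begin

definition jtheta :: "real \<Rightarrow> complex \<Rightarrow> complex" where
  "jtheta l \<tau> =
     (\<Sum>\<^sub>\<infinity>m\<in>{l + of_int n |n::int. True}. exp (2 * of_real pi * \<i> * (of_real m)\<^sup>2 * \<tau>))"

text \<open>
  The integral from \<open>a\<close> to \<open>\<i>\<infinity>\<close> is taken along the vertical half-line \<open>w = a + \<i>t\<close>,
  \<open>t > 0\<close>, on which \<open>dw = \<i> dt\<close>.
\<close>

definition integral_to_i_infinity :: "complex \<Rightarrow> (complex \<Rightarrow> complex) \<Rightarrow> complex" where
  "integral_to_i_infinity a F =
     \<i> * (LINT t:{0<..}|lborel. F (a + \<i> * complex_of_real t))"

text \<open>The complex power \<open>powr\<close> uses the principal branch of the logarithm.\<close>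

definition Eichler2 :: "nat \<Rightarrow> rat \<Rightarrow> complex \<Rightarrow> complex" where
  "Eichler2 \<nu> \<rho> \<tau> =
     (\<Sum>\<alpha>\<in>{0, 1::nat}.
        integral_to_i_infinity (of_rat \<rho>) (\<lambda>w1.
          integral_to_i_infinity w1 (\<lambda>w2.
            jtheta (real \<alpha> / 2) w2 * jtheta ((2 * real \<nu> + 3 * real \<alpha>) / 6) (3 * w1)
            / ((- \<i> * (w2 + \<tau>)) powr (3/2) * (- \<i> * (w1 + \<tau>)) powr (3/2)))))"

definition root_unity :: "int \<Rightarrow> complex" where
  "root_unity m = exp (2 * of_real pi * \<i> / of_int m)"

fun Qform :: "'a::comm_ring_1 \<times> 'a \<Rightarrow> 'a" where
  "Qform (x1, x2) = x1\<^sup>2 + x2\<^sup>2 + x1 * x2"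

definition g1 :: "rat \<Rightarrow> real \<Rightarrow> real" where
  "g1 c w = sinh (2 * pi * w / 3) / (cosh (2 * pi * w / 3) - cos (2 * pi * of_rat c))"

definition f1 :: "rat \<Rightarrow> real \<Rightarrow> real" where
  "f1 c w = sin (2 * pi * of_rat c) / (cosh (2 * pi * w / 3) - cos (2 * pi * of_rat c))"

text \<open>
  The case formulas for \<open>g\<^bsub>k,r\<^esub>\<close>, for representatives \<open>0 \<le> r\<^sub>1, r\<^sub>2 < 3k\<close>. The second case,
  \<open>g\<^bsub>k,(0,r)\<^esub>\<close> with \<open>r \<noteq> 0\<close>, is split off because \<open>g\<^bsub>k,(r,0)\<^esub>\<close> is by convention the same
  function, with the arguments \<open>w\<^sub>1, w\<^sub>2\<close> not interchanged.
\<close>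

fun g2_formula_0r :: "int \<Rightarrow> int \<Rightarrow> real \<times> real \<Rightarrow> real" where
  "g2_formula_0r k r (w1, w2) =
     (w1\<^sup>2 + w2\<^sup>2 + 4 * w1 * w2)
       * g1 0 (w1 / of_int k) * g1 (of_int r / of_int (3 * k)) (w2 / of_int k)
     - 3 * of_int k / (pi * w1) * (w2 + w1 / 2)\<^sup>2
       * g1 (of_int r / of_int (3 * k)) ((w2 + w1 / 2) / of_int k)"

fun g2_formula :: "int \<Rightarrow> int \<times> int \<Rightarrow> real \<times> real \<Rightarrow> real" where
  "g2_formula k (r1, r2) (w1, w2) =
    (if r1 \<noteq> 0 \<and> r2 \<noteq> 0 then
       (w1\<^sup>2 + w2\<^sup>2 + 4 * w1 * w2)
         * (g1 (of_int r1 / of_int (3 * k)) (w1 / of_int k)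
              * g1 (of_int r2 / of_int (3 * k)) (w2 / of_int k)
            - f1 (of_int r1 / of_int (3 * k)) (w1 / of_int k)
              * f1 (of_int r2 / of_int (3 * k)) (w2 / of_int k))
     else if r1 = 0 \<and> r2 \<noteq> 0 then g2_formula_0r k r2 (w1, w2)
     else if r1 \<noteq> 0 \<and> r2 = 0 then g2_formula_0r k r1 (w1, w2)
     else
       (w1\<^sup>2 + w2\<^sup>2 + 4 * w1 * w2) * g1 0 (w1 / of_int k) * g1 0 (w2 / of_int k)
       - 3 * of_int k / (pi * w1) * (w2 + w1 / 2)\<^sup>2 * g1 0 ((w2 + w1 / 2) / of_int k)
       - 3 * of_int k / (pi * w2) * (w1 + w2 / 2)\<^sup>2 * g1 0 ((w1 + w2 / 2) / of_int k))"

text \<open>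
  The formulas can only have vanishing denominators off the set \<open>g2_regular\<close>. There the singularity
  is removable, and the value of \<open>g\<^bsub>k,r\<^esub>\<close> is the limit from the regular points (the literal
  formula would give a junk value because of \<open>x / 0 = 0\<close>).
\<close>

definition g2_regular :: "(real \<times> real) set" where
  "g2_regular = {(w1, w2). w1 \<noteq> 0 \<and> w2 \<noteq> 0 \<and> w2 + w1 / 2 \<noteq> 0 \<and> w1 + w2 / 2 \<noteq> 0}"

definition g2 :: "int \<Rightarrow> int \<times> int \<Rightarrow> real \<times> real \<Rightarrow> real" where
  "g2 k r w =
    (let F = g2_formula k (fst r mod (3 * k), snd r mod (3 * k)) in
     if w \<in> g2_regular then F w else Lim (at w within g2_regular) F)"

end

(*
Unfold each theta product into a sum over the lattice r1 = r2 + nu mod 3. Writing both factors s^(-3/2)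
as second moments of complex Gaussians and integrating out the two half-line variables turns the
summand of r into (4 / sqrt 3) J(r), where J(r) is the integral over R^2 of
v^2 w2^2 exp(-2/3 pi z Q(w)) / ((w2^2 + r2^2) (Q(r) + Q(w))) with v = w1 + w2/2.

On the other side, the partial fractions of the cotangent express g_(k,r) as a limit of box sums over a
residue class modulo 3k of rational functions C_r(w), and a partial fraction decomposition (Q(w) + Q(r)
lies in the ideal generated by w1 - i r1 and w2 - i r2) gives that the Gaussian integral of C_r is 3 J(r) + X(r)
plus the same with r1, r2 exchanged. The sums of J(r) agree by the symmetry r -> (-r2, -r1), and the
sums of X(r) over boxes tend to 0 since X is odd under (r1, r2) -> (r1 + r2, -r2).
Both limits are taken by dominated convergence.
*)
theory Submission
  imports Defs "HOL-Complex_Analysis.Complex_Analysis" "HOL-Probability.Sinc_Integral"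
begin

subsection \<open>Partial fractions of the cotangent over residue classes\<close>

text \<open>Neither the cotangent series nor the sum of the X(r) converges absolutely. All sums
  therefore run over the same boxes of half-width 3kN: a multiple of the modulus cuts each residue
  class into a cotangent window, symmetric up to one end point, and the windows of all classes fill
  one box of the lattice. The function g_(k,r) fits because (sinh 2y + i sin 2x) / (cosh 2y - cos
  2x) is i cot(x + iy): g g - f f is the real part of a product of two cotangents, and the terms
  subtracted for r1 = 0 or r2 = 0 remove the pole of the summand with index 0. With v and w2 as
  coordinates Q is diagonal and w1^2 + w2^2 + 4 w1 w2 equals v^2 + 3 v w2 - (3/4) w2^2. The middle
  term, multiplied by v w2, is the source of 3 J(r); all other products are odd in v or enter X(r).
  After the exchange symmetry 6 J(r) faces (4 / sqrt 3) J(r), and each class sum carries (pi /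
  (3k))^2; hence the constant (4 / (6 sqrt 3)) (pi / (3k))^2 = 2 pi^2 / (27 sqrt 3 k^2). The minus
  sign is that of dw1 dw2 = i^2 ds dt.\<close>

lemma cot_partial_fractions:
  fixes z :: complex
  assumes z: "z \<notin> \<int>"
  shows "(\<lambda>N. \<Sum>j\<in>{- int N..<int N}. 1 / (z + of_int j)) \<longlonglongrightarrow> of_real pi * cot (of_real pi * z)"
proof -
  have z0: "z \<notin> \<int>\<^sub>\<le>\<^sub>0" "1 - z \<notin> \<int>\<^sub>\<le>\<^sub>0" "z \<noteq> 0" "1 - z \<noteq> 0"
    using z minus_in_Ints_iff[of z] Ints_diff[of 1 "1 - z"] by (auto dest: nonpos_Ints_Int)
  have sin0: "sin (of_real pi * z) \<noteq> 0"
  proof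
    assume "sin (of_real pi * z) = 0"
    then obtain n where "of_real pi * z = of_real (of_int n * pi)"
      using sin_eq_0 by (metis mult.commute of_real_mult)
    hence "z = of_int n" by (simp add: mult.commute)
    thus False using z by simp
  qed
  \<comment> \<open>By the reflection formula \<open>?h\<close> is the constant pi off the integers.
    Its vanishing derivative expresses the cotangent as a difference of two Digamma values.\<close>
  let ?h = "\<lambda>u. Gamma u * Gamma (1 - u) * sin (of_real pi * u)"
  have "(?h has_field_derivative
      Gamma z * Gamma (1 - z) * ((Digamma z - Digamma (1 - z)) * sin (of_real pi * z) + of_real pi * cos (of_real pi * z)))
      (at z)"
    using z0 by (auto intro!: derivative_eq_intros simp: algebra_simps)
  moreover have "(?h has_field_derivative 0) (at z)"
  proof (rule has_field_derivative_transform_within_open[where f = "\<lambda>_. of_real pi" and S = "- \<int>"])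
    fix u :: complex assume "u \<in> - \<int>"
    hence "sin (of_real pi * u) \<noteq> 0"
      using sin_eq_0[of "of_real pi * u"]
      by (auto simp: mult.commute)
    thus "of_real pi = ?h u" by (simp add: Gamma_reflection_complex)
  qed (use z in \<open>auto intro: open_Compl closed_Ints\<close>)
  ultimately have "Gamma z * Gamma (1 - z) * ((Digamma z - Digamma (1 - z)) * sin (of_real pi * z) + of_real pi * cos (of_real pi * z)) = 0"
    by (rule DERIV_unique)
  hence "(Digamma z - Digamma (1 - z)) * sin (of_real pi * z) + of_real pi * cos (of_real pi * z) = 0"
    using z0 by (simp add: Gamma_eq_zero_iff)
  hence refl: "Digamma (1 - z) - Digamma z = of_real pi * cot (of_real pi * z)"
    using sin0 by (simp add: cot_def field_simps)
  \<comment> \<open>The logarithms of the two Digamma limits cancel. Both sums have \<open>m\<close>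
    terms, and the second accounts for the negative indices shifted by one, so the resulting window
    is half-open.\<close>
  have "(\<lambda>m. (of_real (ln (real m)) - (\<Sum>n<m. inverse ((1 - z) + of_nat n)))
     - (of_real (ln (real m)) - (\<Sum>n<m. inverse (z + of_nat n)))) \<longlonglongrightarrow> Digamma (1 - z) - Digamma z"
    by (intro tendsto_diff Digamma_LIMSEQ z0)
  also have "(\<lambda>m. (of_real (ln (real m)) - (\<Sum>n<m. inverse ((1 - z) + of_nat n)))
     - (of_real (ln (real m)) - (\<Sum>n<m. inverse (z + of_nat n)))) =
     (\<lambda>N. \<Sum>j\<in>{- int N..<int N}. 1 / (z + of_int j))"
  proof
    fix m :: nat
    have "{- int m..<int m} = int ` {..<m} \<union> (\<lambda>n. - int (Suc n)) ` {..<m}"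
    proof (intro equalityI subsetI)
      fix j assume j: "j \<in> {- int m..<int m}"
      show "j \<in> int ` {..<m} \<union> (\<lambda>n. - int (Suc n)) ` {..<m}"
      proof (cases "j \<ge> 0")
        case True
        hence "j = int (nat j)" "nat j < m" using j by auto
        thus ?thesis by blast
      next
        case False
        hence "j = - int (Suc (nat (- j - 1)))" "nat (- j - 1) < m" using j by auto
        thus ?thesis by blast
      qed
    qed auto
    hence "(\<Sum>j\<in>{- int m..<int m}. 1 / (z + of_int j)) =
       (\<Sum>j\<in>int ` {..<m}. 1 / (z + of_int j)) + (\<Sum>j\<in>(\<lambda>n. - int (Suc n)) ` {..<m}. 1 / (z + of_int j))"
      by (simp only:) (rule sum.union_disjoint, auto)
    also have "(\<Sum>j\<in>int ` {..<m}. 1 / (z + of_int j)) = (\<Sum>n<m. inverse (z + of_nat n))"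
      by (subst sum.reindex) (auto simp: inj_on_def inverse_eq_divide)
    also have "(\<Sum>j\<in>(\<lambda>n. - int (Suc n)) ` {..<m}. 1 / (z + of_int j)) = (\<Sum>n<m. - inverse ((1 - z) + of_nat n))"
    proof -
      have "1 / (z + of_int (- int (Suc n))) = - inverse ((1 - z) + of_nat n)" for n
      proof -
        have "z + of_int (- int (Suc n)) = - ((1 - z) + of_nat n)" by simp
        thus ?thesis by (simp only: inverse_eq_divide minus_divide_right)
      qed
      moreover have "inj_on (\<lambda>n. - int (Suc n)) {..<m}" by (auto simp: inj_on_def)
      ultimately show ?thesis by (simp only: sum.reindex o_def)
    qed
    finally show "(of_real (ln (real m)) - (\<Sum>n<m. inverse ((1 - z) + of_nat n)))
     - (of_real (ln (real m)) - (\<Sum>n<m. inverse (z + of_nat n))) = (\<Sum>j\<in>{- int m..<int m}. 1 / (z + of_int j))"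
      by (simp add: sum_negf)
  qed
  finally show ?thesis by (simp add: refl)
qed

text \<open>The added end term tends to 0. A box cuts the closed window out of residue class 0 and
  the half-open one out of every other class.\<close>

lemma cot_partial_fractions_symmetric:
  fixes z :: complex
  assumes z: "z \<notin> \<int>"
  shows "(\<lambda>N. \<Sum>j\<in>{- int N..int N}. 1 / (z + of_int j)) \<longlonglongrightarrow> of_real pi * cot (of_real pi * z)"
proof -
  have "filterlim (\<lambda>N::nat. z + of_nat N) at_infinity sequentially"
    by (intro tendsto_add_filterlim_at_infinity[OF tendsto_const] tendsto_of_nat)
  hence "(\<lambda>N::nat. 1 / (z + of_nat N)) \<longlonglongrightarrow> 0"
    by (intro tendsto_divide_0[OF tendsto_const])
  hence "(\<lambda>N. (\<Sum>j\<in>{- int N..<int N}. 1 / (z + of_int j)) + 1 / (z + of_nat N)) \<longlonglongrightarrow> of_real pi * cot (of_real pi * z) + 0"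
    by (intro tendsto_add cot_partial_fractions z)
  moreover have "(\<Sum>j\<in>{- int N..<int N}. 1 / (z + of_int j)) + 1 / (z + of_nat N) = (\<Sum>j\<in>{- int N..int N}. 1 / (z + of_int j))" for N
  proof -
    have "{- int N..int N} = insert (int N) {- int N..<int N}" by auto
    thus ?thesis by simp
  qed
  ultimately show ?thesis by simp
qed

text \<open>Both sides agree after multiplication by the sine. This identity is the origin of
  \<open>g1\<close> and \<open>f1\<close>: up to scaling of the arguments they are the real and the
  imaginary part of one cotangent.\<close>

lemma i_times_cot:
  fixes x y :: real
  assumes "sin (Complex x y) \<noteq> 0"
  shows "\<i> * cot (Complex x y) =
    Complex (sinh (2 * y) / (cosh (2 * y) - cos (2 * x))) (sin (2 * x) / (cosh (2 * y) - cos (2 * x)))"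
proof -
  have S: "sin (Complex x y) = Complex (sin x * cosh y) (cos x * sinh y)"
    and C: "cos (Complex x y) = Complex (cos x * cosh y) (- (sin x * sinh y))"
    by (simp_all add: complex_eq_iff Re_sin Im_sin Re_cos Im_cos cosh_def sinh_def field_simps)
  have h: "(cosh y)\<^sup>2 = 1 + (sinh y)\<^sup>2" by (simp add: cosh_square_eq)
  have d: "cosh (2 * y) - cos (2 * x) = 2 * ((sin x)\<^sup>2 + (sinh y)\<^sup>2)"
    by (simp add: cosh_double h cos_double_sin)
  have c2: "(cos x)\<^sup>2 = 1 - (sin x)\<^sup>2" by (simp add: cos_squared_eq)
  have d2: "(sin x * cosh y)\<^sup>2 + (cos x * sinh y)\<^sup>2 = (sin x)\<^sup>2 + (sinh y)\<^sup>2"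
    by (simp add: power_mult_distrib h c2 algebra_simps)
  have nz: "(sin x)\<^sup>2 + (sinh y)\<^sup>2 \<noteq> 0"
    using assms unfolding S d2[symmetric] by (auto simp: complex_eq_iff sum_power2_eq_zero_iff)
  have "\<i> * cot (Complex x y) * sin (Complex x y) = \<i> * cos (Complex x y)"
    using assms by (simp add: cot_def)
  moreover have "Complex (sinh (2 * y) / (cosh (2 * y) - cos (2 * x))) (sin (2 * x) / (cosh (2 * y) - cos (2 * x)))
      * sin (Complex x y) = \<i> * cos (Complex x y)"
  proof -
    have 1: "(sinh (2*y) * (sin x * cosh y) - sin (2*x) * (cos x * sinh y)) = (2 * ((sin x)\<^sup>2 + (sinh y)\<^sup>2)) * (sin x * sinh y)"
    proof -
      have "(sinh (2*y) * (sin x * cosh y) - sin (2*x) * (cos x * sinh y)) = 2 * (sin x * sinh y) * ((cosh y)\<^sup>2 - (cos x)\<^sup>2)"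
        unfolding sinh_double sin_double by (simp add: power2_eq_square algebra_simps)
      thus ?thesis by (simp add: h c2)
    qed
    have 2: "(sinh (2*y) * (cos x * sinh y) + sin (2*x) * (sin x * cosh y)) = (2 * ((sin x)\<^sup>2 + (sinh y)\<^sup>2)) * (cos x * cosh y)"
      unfolding sinh_double sin_double by (simp add: power2_eq_square algebra_simps)
    have "Complex (A / D) (B / D) * Complex X Y = \<i> * Complex U (- V)"
      if "D \<noteq> 0" "A * X - B * Y = D * V" "A * Y + B * X = D * U" for A B D X Y U V :: real
      using that by (simp add: complex_eq_iff field_simps)
    from this[OF _ 1 2] show ?thesis unfolding d S C using nz by simp
  qed
  ultimately show ?thesis using assms by (metis mult_right_cancel)
qed

text \<open>A bound that is a multiple of \<open>L\<close> lets the balls of all classes partition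
  one interval and still matches the windows of the cotangent series.\<close>

definition residue_ball :: "int \<Rightarrow> int \<Rightarrow> nat \<Rightarrow> int set" where
  "residue_ball L a N = {r \<in> {- (L * int N)..L * int N}. r mod L = a}"

lemma finite_residue_ball [simp]: "finite (residue_ball L a N)"
  by (rule finite_subset[of _ "{- (L * int N)..L * int N}"]) (auto simp: residue_ball_def)

lemma residue_ball_image:
  assumes "0 \<le> a" "a < L"
  shows "residue_ball L a N = (\<lambda>n. a + L * n) ` (if a = 0 then {- int N..int N} else {- int N..<int N})"
proof (intro equalityI subsetI)
  fix r assume r: "r \<in> residue_ball L a N"
  have "r mod L = a" using r by (simp add: residue_ball_def)
  hence eq: "r = a + L * (r div L)" using mod_mult_div_eq[of r L] by simp
  have 1: "L * (r div L) \<ge> L * (- int N) - a" "L * (r div L) \<le> L * int N - a"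
    using r eq by (auto simp: residue_ball_def)
  have "L * (r div L) > L * (- int N - 1)" using 1 assms by (simp add: algebra_simps)
  hence 2: "r div L \<ge> - int N" using assms by (auto simp: mult_less_cancel_left)
  have "L * (r div L) \<le> L * int N" "L > 0" using 1 assms by linarith+
  hence 3: "r div L \<le> int N" by (simp add: mult_le_cancel_left_pos)
  have "r div L < int N" if "a \<noteq> 0"
  proof -
    have "L * (r div L) < L * int N" using 1 assms that by linarith
    thus ?thesis using assms by (auto simp: mult_less_cancel_left)
  qed
  with 2 3 eq show "r \<in> (\<lambda>n. a + L * n) ` (if a = 0 then {- int N..int N} else {- int N..<int N})"
    by (intro image_eqI[where x = "r div L"]) auto
next
  fix r assume "r \<in> (\<lambda>n. a + L * n) ` (if a = 0 then {- int N..int N} else {- int N..<int N})"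
  then obtain n where n: "n \<in> (if a = 0 then {- int N..int N} else {- int N..<int N})" "r = a + L * n" by auto
  have m: "r mod L = a" using n assms by simp
  have "L * n \<ge> L * (- int N)" using n assms by (intro mult_left_mono) (auto split: if_splits)
  hence lo: "r \<ge> - (L * int N)" using n assms by simp
  have "r \<le> L * int N"
  proof (cases "a = 0")
    case True
    thus ?thesis using n assms by (auto simp: mult_left_mono)
  next
    case False
    hence "L * (n + 1) \<le> L * int N" using n assms by (intro mult_left_mono) auto
    thus ?thesis using n assms by (simp add: algebra_simps)
  qed
  with lo m show "r \<in> residue_ball L a N" by (simp add: residue_ball_def)
qed

lemma residue_ball_sum_tendsto:
  fixes w :: real
  assumes k: "k > 0" and a: "0 \<le> a" "a < 3 * k" and nz: "w \<noteq> 0 \<or> a \<noteq> 0"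
  shows "(\<lambda>N. \<Sum>r\<in>residue_ball (3 * k) a N. 1 / (of_real w - \<i> * of_int r)) \<longlonglongrightarrow>
    of_real (pi / of_int (3 * k)) * Complex (g1 (of_int a / of_int (3 * k)) (w / of_int k)) (f1 (of_int a / of_int (3 * k)) (w / of_int k))"
proof -
  define L where "L = 3 * k"
  have L: "L > 0" using k by (simp add: L_def)
  define s where "s = Complex (of_int a / of_int L) (w / of_int L)"
  have s: "s \<notin> \<int>"
  proof
    assume "s \<in> \<int>"
    then obtain n where n: "s = of_int n" by (auto elim: Ints_cases)
    hence "w = 0" using L by (auto simp: s_def complex_eq_iff)
    hence "a \<noteq> 0" using nz by auto
    have "of_int a / of_int L = (of_int n :: real)" using n by (auto simp: s_def complex_eq_iff)
    hence "(of_int a :: real) = of_int (n * L)" using L by (simp add: field_simps)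
    hence an: "a = n * L" by (simp only: of_int_eq_iff)
    hence "n > 0" using \<open>a \<noteq> 0\<close> a L by (metis mult_le_0_iff not_le order_less_le zero_le_mult_iff)
    hence "n * L \<ge> 1 * L" using L by (intro mult_right_mono) auto
    thus False using a(2) unfolding an L_def[symmetric] by simp
  qed
  have sin0: "sin (of_real pi * s) \<noteq> 0"
  proof
    assume "sin (of_real pi * s) = 0"
    then obtain n where "of_real pi * s = of_real (of_int n * pi)"
      using sin_eq_0 by (metis mult.commute of_real_mult)
    hence "s = of_int n" by (simp add: mult.commute)
    thus False using s by simp
  qed
  \<comment> \<open>For \<open>r = a + L * n\<close> one has L (s + n) = i (w - i r), which moves
    the poles at w = i r to the integer poles of the cotangent.\<close>
  have tm: "1 / (of_real w - \<i> * of_int (a + L * n)) = (\<i> / of_int L) * (1 / (s + of_int n))" for n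
  proof -
    have "of_int L * (s + of_int n) = \<i> * (of_real w - \<i> * of_int (a + L * n))"
      using L by (simp add: s_def complex_eq_iff field_simps)
    moreover have "s + of_int n \<noteq> 0"
      using s by (metis Ints_minus Ints_of_int add_eq_0_iff2)
    moreover have "(of_int L :: complex) \<noteq> 0" using L by simp
    ultimately show ?thesis
      by (smt (verit, ccfv_threshold) divide_divide_eq_left divide_divide_eq_right mult.right_neutral
         mult_divide_mult_cancel_left times_divide_times_eq complex_i_not_zero mult_eq_0_iff)
  qed
  have L0: "L \<noteq> 0" using L by simp
  have inj: "inj_on (\<lambda>n. a + L * n) A" for A using L by (auto simp: inj_on_def)
  have "(\<lambda>N. (\<i> / of_int L) * (\<Sum>n\<in>(if a = 0 then {- int N..int N} else {- int N..<int N}). 1 / (s + of_int n)))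
    \<longlonglongrightarrow> (\<i> / of_int L) * (of_real pi * cot (of_real pi * s))"
    by (cases "a = 0") (auto intro!: tendsto_intros cot_partial_fractions cot_partial_fractions_symmetric s simp: L0)
  moreover have "(\<i> / of_int L) * (\<Sum>n\<in>(if a = 0 then {- int N..int N} else {- int N..<int N}). 1 / (s + of_int n))
     = (\<Sum>r\<in>residue_ball L a N. 1 / (of_real w - \<i> * of_int r))" for N
    using a L by (simp add: residue_ball_image L_def[symmetric] sum.reindex[OF inj] o_def tm sum_distrib_left L
       del: of_int_add of_int_mult)
  moreover have "(\<i> / of_int L) * (of_real pi * cot (of_real pi * s)) = of_real (pi / of_int L) * (\<i> * cot (of_real pi * s))"
    by simp
  moreover have "\<i> * cot (of_real pi * s) = Complex (g1 (of_int a / of_int L) (w / of_int k)) (f1 (of_int a / of_int L) (w / of_int k))"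
  proof -
    have ps: "of_real pi * s = Complex (pi * of_int a / of_int L) (pi * w / of_int L)"
      by (simp add: s_def complex_eq_iff)
    have e1: "2 * (pi * w / of_int L) = 2 * pi * (w / of_int k) / 3" by (simp add: L_def)
    have e2: "2 * (pi * of_int a / of_int L) = 2 * pi * of_rat (of_int a / of_int L)"
      by (simp add: of_rat_divide)
    show ?thesis using i_times_cot[of "pi * of_int a / of_int L" "pi * w / of_int L"] sin0
      unfolding ps e1 e2 g1_def f1_def by simp
  qed
  ultimately show ?thesis unfolding L_def by (simp only:)
qed

subsection \<open>Gaussian integrals over the plane\<close>

lemma integrable_lborel_pair_mult:
  fixes f g :: "real \<Rightarrow> 'a :: {real_normed_field, banach, second_countable_topology}"
  assumes f: "integrable lborel f" and g: "integrable lborel g"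
  shows "integrable lborel (\<lambda>w. f (fst w) * g (snd w))"
proof -
  have [measurable]: "f \<in> borel_measurable borel" "g \<in> borel_measurable borel"
    using f g by (auto dest: borel_measurable_integrable)
  have "integrable (lborel \<Otimes>\<^sub>M lborel) (\<lambda>w. f (fst w) * g (snd w))"
    by (rule lborel_pair.Fubini_integrable) (use f g in \<open>auto simp: norm_mult\<close>)
  thus ?thesis by (simp add: lborel_prod)
qed

section \<open>Measure-preserving linear maps of the plane\<close>

text \<open>Translation invariance on each horizontal line. The value c = - 1 / 2 is the one that
  completes the square in Q.\<close>

lemma lborel_distr_shear:
  fixes c :: real
  shows "distr lborel lborel (\<lambda>w. (fst w + c * snd w, snd w)) = (lborel :: (real \<times> real) measure)"
proof (rule measure_eqI)
  fix A :: "(real \<times> real) set" assume "A \<in> sets (distr lborel lborel (\<lambda>w. (fst w + c * snd w, snd w)))"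
  hence A[measurable]: "A \<in> sets borel" by simp
  have [measurable]: "(\<lambda>w. (fst w + c * snd w, snd w)) \<in> borel \<rightarrow>\<^sub>M (borel :: (real \<times> real) measure)"
    by (intro borel_measurable_continuous_onI continuous_intros)
  have m: "(\<lambda>w. indicator A (fst w + c * snd w, snd w) :: ennreal) \<in> borel_measurable (lborel \<Otimes>\<^sub>M lborel)"
    by (simp add: lborel_prod)
  have "emeasure (distr lborel lborel (\<lambda>w. (fst w + c * snd w, snd w))) A
    = (\<integral>\<^sup>+w. indicator A (fst w + c * snd w, snd w) \<partial>lborel)"
    using nn_integral_distr[of "\<lambda>w. (fst w + c * snd w, snd w)" lborel lborel "indicator A"] by simp
  also have "\<dots> = (\<integral>\<^sup>+y. \<integral>\<^sup>+x. indicator A (x + c * y, y) \<partial>lborel \<partial>lborel)"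
    using lborel_pair.nn_integral_snd[OF m[unfolded split_beta'[symmetric]], symmetric]
    by (simp add: lborel_prod split_beta')
  also have "\<dots> = (\<integral>\<^sup>+y. \<integral>\<^sup>+x. indicator A (x, y) \<partial>lborel \<partial>lborel)"
  proof (rule nn_integral_cong)
    fix y :: real
    have [measurable]: "(\<lambda>x. (x, y)) \<in> borel \<rightarrow>\<^sub>M (borel :: (real \<times> real) measure)"
      by (intro borel_measurable_continuous_onI continuous_intros)
    show "(\<integral>\<^sup>+x. indicator A (x + c * y, y) \<partial>lborel) = (\<integral>\<^sup>+x. indicator A (x, y) \<partial>lborel)"
      using nn_integral_real_affine[of "\<lambda>x. indicator A (x, y)" 1 "c * y"] by (simp add: add.commute)
  qed
  also have "\<dots> = (\<integral>\<^sup>+w. indicator A w \<partial>lborel)"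
    using lborel_pair.nn_integral_snd[of "indicator A"] by (simp add: lborel_prod)
  also have "\<dots> = emeasure lborel A" by simp
  finally show "emeasure (distr lborel lborel (\<lambda>w. (fst w + c * snd w, snd w))) A = emeasure lborel A" .
qed simp

lemma lborel_distr_swap:
  "distr lborel lborel (\<lambda>w. (snd w, fst w)) = (lborel :: (real \<times> real) measure)"
  using lborel_pair.distr_pair_swap[symmetric] by (simp add: lborel_prod split_beta')

text \<open>Used for (c, d) = (-1, 1), which gives parity in the first coordinate, and for (sqrt 3 /
  2, 2 / sqrt 3), which together with the swap exchanges the axes of an ellipse.\<close>

lemma lborel_distr_scale:
  fixes c d :: real
  assumes "\<bar>c * d\<bar> = 1"
  shows "distr lborel lborel (\<lambda>w. (c * fst w, d * snd w)) = (lborel :: (real \<times> real) measure)"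
proof (rule measure_eqI)
  have nz: "c \<noteq> 0" "d \<noteq> 0" using assms by auto
  fix A :: "(real \<times> real) set" assume "A \<in> sets (distr lborel lborel (\<lambda>w. (c * fst w, d * snd w)))"
  hence A[measurable]: "A \<in> sets borel" by simp
  have [measurable]: "(\<lambda>w. (c * fst w, d * snd w)) \<in> borel \<rightarrow>\<^sub>M (borel :: (real \<times> real) measure)"
    by (intro borel_measurable_continuous_onI continuous_intros)
  have [measurable]: "(\<lambda>p. (snd p, fst p)) \<in> borel \<rightarrow>\<^sub>M (borel :: (real \<times> real) measure)"
    "(\<lambda>p. (c * snd p, d * fst p)) \<in> borel \<rightarrow>\<^sub>M (borel :: (real \<times> real) measure)"
    by (intro borel_measurable_continuous_onI continuous_intros)+
  have [measurable]: "(\<lambda>x. (c * x, y)) \<in> borel \<rightarrow>\<^sub>M (borel :: (real \<times> real) measure)"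
     "(\<lambda>x. (x, y)) \<in> borel \<rightarrow>\<^sub>M (borel :: (real \<times> real) measure)" for y
    by (intro borel_measurable_continuous_onI continuous_intros)+
  have m: "(\<lambda>w. indicator A (c * fst w, d * snd w) :: ennreal) \<in> borel_measurable (lborel \<Otimes>\<^sub>M lborel)"
    by (simp add: lborel_prod)
  have m2: "indicator A \<in> borel_measurable (lborel \<Otimes>\<^sub>M lborel)"
    by (simp add: lborel_prod)
  have m3: "(\<lambda>y. \<integral>\<^sup>+x. indicator A (x, y) \<partial>lborel) \<in> borel_measurable borel"
    by (rule lborel.borel_measurable_nn_integral) (simp add: split_beta' borel_prod)
  have "emeasure (distr lborel lborel (\<lambda>w. (c * fst w, d * snd w))) A
    = (\<integral>\<^sup>+w. indicator A (c * fst w, d * snd w) \<partial>lborel)"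
    using nn_integral_distr[of "\<lambda>w. (c * fst w, d * snd w)" lborel lborel "indicator A"] by simp
  also have "\<dots> = (\<integral>\<^sup>+y. \<integral>\<^sup>+x. indicator A (c * x, d * y) \<partial>lborel \<partial>lborel)"
    using lborel_pair.nn_integral_snd[OF m[unfolded split_beta'[symmetric]], symmetric]
    by (simp add: lborel_prod split_beta')
  finally have 1: "emeasure (distr lborel lborel (\<lambda>w. (c * fst w, d * snd w))) A =
     (\<integral>\<^sup>+y. \<integral>\<^sup>+x. indicator A (c * x, d * y) \<partial>lborel \<partial>lborel)" .
  have "emeasure lborel A = (\<integral>\<^sup>+y. \<integral>\<^sup>+x. indicator A (x, y) \<partial>lborel \<partial>lborel)"
    using lborel_pair.nn_integral_snd[OF m2] by (simp add: lborel_prod)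
  also have "\<dots> = \<bar>d\<bar> * (\<integral>\<^sup>+y. \<integral>\<^sup>+x. indicator A (x, d * y) \<partial>lborel \<partial>lborel)"
    by (subst nn_integral_real_affine[OF m3 nz(2), of 0]) simp
  also have "\<dots> = \<bar>d\<bar> * (\<integral>\<^sup>+y. \<bar>c\<bar> * (\<integral>\<^sup>+x. indicator A (c * x, d * y) \<partial>lborel) \<partial>lborel)"
    by (subst nn_integral_real_affine[OF _ nz(1), of _ 0]) auto
  also have "\<dots> = \<bar>d\<bar> * (\<bar>c\<bar> * (\<integral>\<^sup>+y. \<integral>\<^sup>+x. indicator A (c * x, d * y) \<partial>lborel \<partial>lborel))"
    by (subst nn_integral_cmult) (auto intro!: lborel.borel_measurable_nn_integral simp: split_beta' borel_prod)
  also have "\<dots> = (\<integral>\<^sup>+y. \<integral>\<^sup>+x. indicator A (c * x, d * y) \<partial>lborel \<partial>lborel)"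
  proof -
    have "ennreal \<bar>d\<bar> * ennreal \<bar>c\<bar> = 1" using assms by (simp add: ennreal_mult'[symmetric] abs_mult mult.commute)
    thus ?thesis by (simp add: mult.assoc[symmetric])
  qed
  finally show "emeasure (distr lborel lborel (\<lambda>w. (c * fst w, d * snd w))) A = emeasure lborel A"
    using 1 by simp
qed simp

lemma integral_lborel_invariant:
  fixes f :: "real \<times> real \<Rightarrow> 'a :: {banach, second_countable_topology}"
  assumes "distr lborel lborel T = (lborel :: (real \<times> real) measure)"
    and "T \<in> borel_measurable borel" "f \<in> borel_measurable borel"
  shows "(LINT w|lborel. f (T w)) = (LINT w|lborel. f w)"
  using integral_distr[of T lborel lborel f] assms by simp

lemma integrable_lborel_invariant:
  fixes f :: "real \<times> real \<Rightarrow> 'a :: {banach, second_countable_topology}"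
  assumes "distr lborel lborel T = (lborel :: (real \<times> real) measure)"
    and "T \<in> borel_measurable borel" "f \<in> borel_measurable borel"
  shows "integrable lborel (\<lambda>w. f (T w)) \<longleftrightarrow> integrable lborel f"
  using integrable_distr_eq[of T lborel lborel f] assms by simp

section \<open>Gaussian moments with a complex parameter\<close>

text \<open>Mean value inequality on a convex half-plane. It gives the difference quotients of a
  Gaussian integral in its parameter a common majorant.\<close>

lemma complex_norm_exp_diff_le:
  fixes a b :: complex and x t :: real
  assumes "x \<le> Re a" "x \<le> Re b" "0 \<le> t"
  shows "norm (exp (- a * of_real t) - exp (- b * of_real t)) \<le> t * exp (- x * t) * norm (a - b)"
proof (rule field_differentiable_bound[where S = "{s. x \<le> Re s}" and f' = "\<lambda>s. - of_real t * exp (- s * of_real t)"])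
  show "convex {s. x \<le> Re s}" by (rule convex_halfspace_Re_ge)
  show "((\<lambda>s. exp (- s * of_real t)) has_field_derivative - of_real t * exp (- s * of_real t)) (at s within {s. x \<le> Re s})" for s
    by (auto intro!: derivative_eq_intros)
  show "norm (- of_real t * exp (- s * of_real t)) \<le> t * exp (- x * t)" if "s \<in> {s. x \<le> Re s}" for s
    using that assms by (auto simp: norm_mult intro!: mult_left_mono mult_right_mono)
qed (use assms in auto)

text \<open>The weight is a multiple of the normal density of variance 1 / (2 x), whose even moments
  are known.\<close>

lemma integrable_gaussian_moment:
  assumes x: "x > 0"
  shows "integrable lborel (\<lambda>w::real. w ^ (2 * n) * exp (- x * w\<^sup>2))"
    and "(LINT w|lborel. w\<^sup>2 * exp (- x * w\<^sup>2)) = sqrt pi / 2 / x powr (3/2)"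
proof -
  define s where "s = 1 / sqrt (2 * x)"
  have s: "s > 0" using x by (simp add: s_def)
  have s2: "s\<^sup>2 = 1 / (2 * x)" using x by (simp add: s_def power_divide)
  have e: "exp (- x * w\<^sup>2) = sqrt (2 * pi * s\<^sup>2) * normal_density 0 s w" for w
    using x s by (simp add: normal_density_def s2 field_simps)
  have m: "has_bochner_integral lborel (\<lambda>w. normal_density 0 s w * (w - 0) ^ (2 * n)) (fact (2 * n) / ((2 / s\<^sup>2)^n * fact n))" for n
    by (rule normal_moment_even[OF s])
  show "integrable lborel (\<lambda>w::real. w ^ (2 * n) * exp (- x * w\<^sup>2))"
    unfolding e using integrable_mult_right[of "sqrt (2 * pi * s\<^sup>2)"] m[of n]
    by (fastforce simp: has_bochner_integral_iff mult_ac)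
  have "(LINT w|lborel. normal_density 0 s w * w\<^sup>2) = s\<^sup>2"
    using m[of 1] by (simp add: has_bochner_integral_iff)
  moreover have "(LINT w|lborel. w\<^sup>2 * exp (- x * w\<^sup>2)) = (LINT w|lborel. sqrt (2 * pi * s\<^sup>2) * (normal_density 0 s w * w\<^sup>2))"
    unfolding e by (simp only: mult_ac)
  ultimately have "(LINT w|lborel. w\<^sup>2 * exp (- x * w\<^sup>2)) = sqrt (2 * pi * s\<^sup>2) * s\<^sup>2"
    by simp
  also have "\<dots> = sqrt pi / 2 / x powr (3/2)"
  proof -
    have "x powr (3/2) = x powr (1 + 1/2)" by simp
    also have "\<dots> = x * sqrt x" using x by (subst powr_add) (auto simp: powr_half_sqrt)
    finally show ?thesis using x by (simp add: s2 real_sqrt_divide field_simps)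
  qed
  finally show "(LINT w|lborel. w\<^sup>2 * exp (- x * w\<^sup>2)) = sqrt pi / 2 / x powr (3/2)" .
qed

lemma integrable_complex_gaussian_moment:
  assumes s: "Re s > 0"
  shows "integrable lborel (\<lambda>w::real. of_real (w ^ (2 * n)) * exp (- s * of_real (w\<^sup>2)))"
proof (rule Bochner_Integration.integrable_bound[OF integrable_gaussian_moment(1)[OF s, of n]])
  show "AE w in lborel. norm (of_real (w ^ (2 * n)) * exp (- s * of_real (w\<^sup>2))) \<le> norm (w ^ (2 * n) * exp (- Re s * w\<^sup>2))"
    by (intro always_eventually allI) (simp add: norm_mult norm_power del: of_real_power)
qed simp

text \<open>Both sides are holomorphic on Re s > 0, the right one because the principal branch is,
  and they agree on the positive reals; analytic continuation does the rest.\<close>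

lemma complex_gaussian_moment:
  assumes s: "Re s > 0"
  shows "(LINT w|lborel. of_real (w\<^sup>2) * exp (- s * of_real (w\<^sup>2))) = of_real (sqrt pi / 2) / s powr (3/2)"
proof -
  define G where "G = (\<lambda>s. LINT w|lborel. complex_of_real (w\<^sup>2) * exp (- s * of_real (w\<^sup>2)))"
  define S where "S = {s. Re s > 0}"
  have opS: "open S" unfolding S_def by (rule open_halfspace_Re_gt)
  have "(G has_field_derivative (LINT w|lborel. - complex_of_real (w ^ 4) * exp (- s * of_real (w\<^sup>2)))) (at s)"
    if "s \<in> S" for s
  proof -
    \<comment> \<open>Keeping the real part above half of \<open>Re s\<close> leaves a neighbourhood
      of \<open>s\<close> and yields the single majorant w^4 exp (- x w^2).\<close>
    define x where "x = Re s / 2"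
    have x: "x > 0" "x < Re s" using that by (auto simp: x_def S_def)
    have "((\<lambda>y. (G y - G s) / (y - s)) \<longlongrightarrow> (LINT w|lborel. - complex_of_real (w ^ 4) * exp (- s * of_real (w\<^sup>2))))
      (at s within {y. x < Re y})"
      unfolding tendsto_at_iff_sequentially
    proof (intro allI impI)
      fix X assume X: "\<forall>i. X i \<in> {y. x < Re y} - {s}" "X \<longlonglongrightarrow> s"
      have eq: "(G (X i) - G s) / (X i - s) = (LINT w|lborel. of_real (w\<^sup>2) *
         ((exp (- X i * of_real (w\<^sup>2)) - exp (- s * of_real (w\<^sup>2))) / (X i - s)))" for i
      proof -
        have "Re (X i) > 0" using X x by (smt (verit) DiffD1 mem_Collect_eq)
        hence "G (X i) - G s = (LINT w|lborel. complex_of_real (w\<^sup>2) * exp (- X i * of_real (w\<^sup>2)) -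
           complex_of_real (w\<^sup>2) * exp (- s * of_real (w\<^sup>2)))"
          using integrable_complex_gaussian_moment[of "X i" 1] integrable_complex_gaussian_moment[of s 1] x
          unfolding G_def mult_1_right by (intro Bochner_Integration.integral_diff[symmetric]) auto
        thus ?thesis
          by (simp only: right_diff_distrib times_divide_eq_right integral_divide_zero)
      qed
      show "((\<lambda>y. (G y - G s) / (y - s)) \<circ> X) \<longlonglongrightarrow> (LINT w|lborel. - complex_of_real (w ^ 4) * exp (- s * of_real (w\<^sup>2)))"
        unfolding o_def eq
      proof (rule integral_dominated_convergence[where w = "\<lambda>w. w ^ (2 * 2) * exp (- x * w\<^sup>2)"])
        show "integrable lborel (\<lambda>w. w ^ (2 * 2) * exp (- x * w\<^sup>2))"
          by (rule integrable_gaussian_moment(1)[OF x(1)])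
        show "AE w in lborel. (\<lambda>i. of_real (w\<^sup>2) * ((exp (- X i * of_real (w\<^sup>2)) - exp (- s * of_real (w\<^sup>2))) / (X i - s)))
           \<longlonglongrightarrow> - complex_of_real (w ^ 4) * exp (- s * of_real (w\<^sup>2))"
        proof (intro always_eventually allI)
          fix w :: real
          have "((\<lambda>u. exp (- u * of_real (w\<^sup>2))) has_field_derivative (- of_real (w\<^sup>2) * exp (- s * of_real (w\<^sup>2)))) (at s)"
            by (auto intro!: derivative_eq_intros)
          hence "((\<lambda>y. (exp (- y * of_real (w\<^sup>2)) - exp (- s * of_real (w\<^sup>2))) / (y - s)) \<longlongrightarrow>
             (- of_real (w\<^sup>2) * exp (- s * of_real (w\<^sup>2)))) (at s within UNIV)"
            by (simp add: has_field_derivative_iff)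
          hence "(\<lambda>i. (exp (- X i * of_real (w\<^sup>2)) - exp (- s * of_real (w\<^sup>2))) / (X i - s)) \<longlonglongrightarrow>
             (- of_real (w\<^sup>2) * exp (- s * of_real (w\<^sup>2)))"
            using X unfolding tendsto_at_iff_sequentially by (auto simp: o_def)
          from tendsto_mult[OF tendsto_const[of "of_real (w\<^sup>2)"] this]
          show "(\<lambda>i. of_real (w\<^sup>2) * ((exp (- X i * of_real (w\<^sup>2)) - exp (- s * of_real (w\<^sup>2))) / (X i - s)))
            \<longlonglongrightarrow> - complex_of_real (w ^ 4) * exp (- s * of_real (w\<^sup>2))"
            by (simp add: power4_eq_xxxx power2_eq_square mult.assoc)
        qed
        show "AE w in lborel. norm (of_real (w\<^sup>2) * ((exp (- X i * of_real (w\<^sup>2)) - exp (- s * of_real (w\<^sup>2))) / (X i - s)))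
            \<le> w ^ (2 * 2) * exp (- x * w\<^sup>2)" for i
        proof (intro always_eventually allI)
          fix w :: real
          have nz: "norm (X i - s) > 0" using X by auto
          have "norm (exp (- X i * of_real (w\<^sup>2)) - exp (- s * of_real (w\<^sup>2))) \<le> w\<^sup>2 * exp (- x * w\<^sup>2) * norm (X i - s)"
            using X x by (intro complex_norm_exp_diff_le) (auto intro: less_imp_le)
          hence "norm ((exp (- X i * of_real (w\<^sup>2)) - exp (- s * of_real (w\<^sup>2))) / (X i - s)) \<le> w\<^sup>2 * exp (- x * w\<^sup>2)"
            using nz by (simp add: norm_divide field_simps del: of_real_power)
          hence "w\<^sup>2 * norm ((exp (- X i * of_real (w\<^sup>2)) - exp (- s * of_real (w\<^sup>2))) / (X i - s)) \<le> w\<^sup>2 * (w\<^sup>2 * exp (- x * w\<^sup>2))"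
            by (intro mult_left_mono) auto
          moreover have "norm (of_real (w\<^sup>2) * c) = w\<^sup>2 * norm c" for c :: complex
            by (simp only: norm_mult norm_of_real abs_power2)
          moreover have "w\<^sup>2 * (w\<^sup>2 * exp (- x * w\<^sup>2)) = w ^ (2 * 2) * exp (- x * w\<^sup>2)"
            by (simp add: power4_eq_xxxx power2_eq_square)
          ultimately show "norm (of_real (w\<^sup>2) * ((exp (- X i * of_real (w\<^sup>2)) - exp (- s * of_real (w\<^sup>2))) / (X i - s)))
            \<le> w ^ (2 * 2) * exp (- x * w\<^sup>2)"
            by (simp only:)
        qed
      qed simp_all
    qed
    moreover have "at s within {y. x < Re y} = at s"
      using x by (intro at_within_open open_halfspace_Re_gt) auto
    ultimately show ?thesis by (simp add: has_field_derivative_iff)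
  qed
  hence "G holomorphic_on S"
    using opS by (auto simp: holomorphic_on_open)
  moreover have "(\<lambda>s. of_real (sqrt pi / 2) / s powr (3/2)) holomorphic_on S"
    by (intro holomorphic_intros) (auto simp: S_def complex_nonpos_Reals_iff)
  ultimately have hol: "(\<lambda>s. G s - of_real (sqrt pi / 2) / s powr (3/2)) holomorphic_on S"
    by (rule holomorphic_on_diff)
  have "G s - of_real (sqrt pi / 2) / s powr (3/2) = 0"
  proof (rule analytic_continuation[OF hol opS])
    show "connected S" unfolding S_def by (intro convex_connected convex_halfspace_Re_gt)
    show "of_real ` {0<..} \<subseteq> S" by (auto simp: S_def)
    show "(1::complex) \<in> S" "s \<in> S" using s by (auto simp: S_def)
    have "(1::real) islimpt {0<..}"
      by (rule interior_limit_point) (simp add: interior_open)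
    hence "of_real (1::real) islimpt (of_real ` {0<..} :: complex set)"
      by (rule islimpt_isCont_image) (auto simp: eventually_at_filter intro: always_eventually continuous_intros)
    thus "(1::complex) islimpt of_real ` {0<..}" by simp
    fix u :: complex assume "u \<in> of_real ` {0<..}"
    then obtain x :: real where x: "x > 0" "u = of_real x" by auto
    have "G u = of_real (LINT w|lborel. w\<^sup>2 * exp (- x * w\<^sup>2))"
      unfolding G_def x(2) integral_complex_of_real[symmetric]
      by (intro Bochner_Integration.integral_cong) (auto simp: exp_of_real[symmetric])
    also have "\<dots> = of_real (sqrt pi / 2) / u powr (3/2)"
      unfolding integrable_gaussian_moment(2)[OF x(1)] using x powr_of_real[of x "3/2"] by simp
    finally show "G u - of_real (sqrt pi / 2) / u powr (3/2) = 0" by simp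
  qed
  thus ?thesis by (simp add: G_def)
qed

text \<open>Half of the Gaussian absorbs the polynomial, by 1 + t <= exp t and n t <= n^2 / (2 c) +
  (c / 2) t^2. The other half is a product of two one-dimensional Gaussians.\<close>

lemma integrable_poly_gaussian:
  assumes c: "c > 0"
  shows "integrable lborel (\<lambda>w::real \<times> real. C * (1 + norm w) ^ n * exp (- c * (norm w)\<^sup>2))"
proof -
  let ?D = "exp ((real n)\<^sup>2 / (2 * c))"
  have "integrable lborel (\<lambda>w. exp (- (c/2) * (fst w)\<^sup>2) * exp (- (c/2) * (snd w)\<^sup>2))"
    using integrable_gaussian_moment(1)[of "c/2" 0] c by (intro integrable_lborel_pair_mult) auto
  hence "integrable lborel (\<lambda>w. \<bar>C\<bar> * ?D * (exp (- (c/2) * (fst w)\<^sup>2) * exp (- (c/2) * (snd w)\<^sup>2)))"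
    by (rule integrable_mult_right)
  thus ?thesis
  proof (rule Bochner_Integration.integrable_bound)
    show "AE w in lborel. norm (C * (1 + norm w) ^ n * exp (- c * (norm w)\<^sup>2))
      \<le> norm (\<bar>C\<bar> * ?D * (exp (- (c/2) * (fst w)\<^sup>2) * exp (- (c/2) * (snd w)\<^sup>2)))"
    proof (intro always_eventually allI)
      fix w :: "real \<times> real"
      define t where "t = norm w"
      have t0: "t \<ge> 0" by (simp add: t_def)
      have t2: "t\<^sup>2 = (fst w)\<^sup>2 + (snd w)\<^sup>2"
        by (simp add: t_def norm_prod_def)
      have "(1 + t) ^ n \<le> exp t ^ n"
        using t0 by (intro power_mono) auto
      also have "\<dots> = exp (real n * t)" by (simp add: exp_of_nat_mult)
      also have "\<dots> \<le> exp ((real n)\<^sup>2 / (2 * c) + (c/2) * t\<^sup>2)"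
      proof -
        have "0 \<le> (real n - c * t)\<^sup>2 / (2 * c)" using c by simp
        also have "\<dots> = (real n)\<^sup>2 / (2 * c) + (c/2) * t\<^sup>2 - real n * t"
          using c by (simp add: field_simps power2_eq_square)
        finally show ?thesis by simp
      qed
      also have "\<dots> = ?D * exp ((c/2) * t\<^sup>2)" by (rule exp_add)
      finally have 1: "(1 + t) ^ n \<le> ?D * exp ((c/2) * t\<^sup>2)" .
      have "(1 + t) ^ n * exp (- c * t\<^sup>2) \<le> ?D * exp ((c/2) * t\<^sup>2) * exp (- c * t\<^sup>2)"
        using 1 by (rule mult_right_mono) simp
      also have "\<dots> = ?D * exp (- (c/2) * t\<^sup>2)"
        by (simp add: mult.assoc flip: exp_add)
      also have "exp (- (c/2) * t\<^sup>2) = exp (- (c/2) * (fst w)\<^sup>2) * exp (- (c/2) * (snd w)\<^sup>2)"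
        by (simp add: t2 algebra_simps flip: exp_add)
      finally have "\<bar>C\<bar> * ((1 + t) ^ n * exp (- c * t\<^sup>2)) \<le> \<bar>C\<bar> * (?D * (exp (- (c/2) * (fst w)\<^sup>2) * exp (- (c/2) * (snd w)\<^sup>2)))"
        by (intro mult_left_mono) auto
      thus "norm (C * (1 + norm w) ^ n * exp (- c * (norm w)\<^sup>2))
        \<le> norm (\<bar>C\<bar> * ?D * (exp (- (c/2) * (fst w)\<^sup>2) * exp (- (c/2) * (snd w)\<^sup>2)))"
        using t0 by (simp add: t_def abs_mult mult.assoc)
    qed
  qed (auto simp: borel_measurable_continuous_onI continuous_intros)
qed

text \<open>The complement is a union of four lines through the origin.\<close>

lemma AE_g2_regular: "AE w in lborel. w \<in> g2_regular"
proof -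
  have ne: "AE w in lborel. a * fst w + b * snd w \<noteq> 0" if "a \<noteq> 0 \<or> b \<noteq> 0" for a b :: real
  proof -
    have "negligible {w. (a, b) \<bullet> w = 0}"
      using that by (intro negligible_hyperplane) (auto simp: zero_prod_def)
    moreover have "{w. (a, b) \<bullet> w = 0} \<in> sets borel"
      by (intro borel_closed closed_hyperplane)
    ultimately have "{w. (a, b) \<bullet> w = 0} \<in> null_sets lborel"
      by (auto simp: negligible_iff_null_sets null_sets_completion_iff)
    from AE_not_in[OF this] show ?thesis
      by eventually_elim (auto simp: inner_prod_def)
  qed
  have "AE w :: real \<times> real in lborel. fst w \<noteq> 0" "AE w :: real \<times> real in lborel. snd w \<noteq> 0"
    "AE w :: real \<times> real in lborel. snd w + fst w / 2 \<noteq> 0" "AE w :: real \<times> real in lborel. fst w + snd w / 2 \<noteq> 0"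
    using ne[of 1 0] ne[of 0 1] ne[of "1/2" 1] ne[of 1 "1/2"] by (simp_all add: add.commute)
  thus ?thesis
    by eventually_elim (auto simp: g2_regular_def)
qed

section \<open>The Gaussian weight in original and diagonal coordinates\<close>

lemma Qform_real_eq: "Qform w = (fst w)\<^sup>2 + (snd w)\<^sup>2 + fst w * snd (w :: real \<times> real)"
  by (cases w) simp

lemma continuous_on_Qform [continuous_intros]: "continuous_on A (Qform :: real \<times> real \<Rightarrow> real)"
  unfolding Qform_real_eq[abs_def] by (intro continuous_intros)

lemma Qform_nonneg: "Qform w \<ge> (norm w)\<^sup>2 / 2" for w :: "real \<times> real"
proof -
  have "2 * Qform w = (norm w)\<^sup>2 + (fst w + snd w)\<^sup>2"
    by (simp add: Qform_real_eq norm_prod_def power2_eq_square algebra_simps)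
  moreover have "0 \<le> (fst w + snd w)\<^sup>2" by simp
  ultimately show ?thesis by linarith
qed

definition qgauss :: "complex \<Rightarrow> real \<times> real \<Rightarrow> complex" where
  "qgauss z w = exp (- (2 / 3) * of_real pi * z * of_real (Qform w))"

text \<open>The weight \<open>qgauss\<close> in the coordinates v = w1 + w2 / 2 and w2, in which
  Q(w) = v^2 + (3/4) w2^2.\<close>

definition dgauss :: "complex \<Rightarrow> real \<times> real \<Rightarrow> complex" where
  "dgauss z w = exp (- (2 / 3) * of_real pi * z * of_real ((fst w)\<^sup>2 + 3 / 4 * (snd w)\<^sup>2))"

lemma qgauss_measurable [measurable]: "qgauss z \<in> borel_measurable borel"
  unfolding qgauss_def[abs_def] by (intro borel_measurable_continuous_onI continuous_intros)

lemma dgauss_measurable [measurable]: "dgauss z \<in> borel_measurable borel"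
  unfolding dgauss_def[abs_def] by (intro borel_measurable_continuous_onI continuous_intros)

lemma norm_qgauss: "norm (qgauss z w) = exp (- (2 / 3) * pi * Re z * Qform w)"
  by (simp add: qgauss_def)

lemma norm_dgauss: "norm (dgauss z w) = exp (- (2 / 3) * pi * Re z * ((fst w)\<^sup>2 + 3 / 4 * (snd w)\<^sup>2))"
  by (simp add: dgauss_def)

lemma norm_qgauss_le:
  assumes "Re z > 0"
  shows "norm (qgauss z w) \<le> exp (- (pi * Re z / 3) * (norm w)\<^sup>2)"
proof -
  have "(2 / 3) * pi * Re z * ((norm w)\<^sup>2 / 2) \<le> (2 / 3) * pi * Re z * Qform w"
    using assms by (intro mult_left_mono Qform_nonneg) auto
  thus ?thesis by (simp add: norm_qgauss)
qed

lemma norm_dgauss_le: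
  assumes "Re z > 0"
  shows "norm (dgauss z w) \<le> exp (- (pi * Re z / 3) * (norm w)\<^sup>2)"
proof -
  have "(norm w)\<^sup>2 = (fst w)\<^sup>2 + (snd w)\<^sup>2" by (simp add: norm_prod_def)
  hence "(norm w)\<^sup>2 / 2 \<le> (fst w)\<^sup>2 + 3 / 4 * (snd w)\<^sup>2"
    using zero_le_power2[of "fst w"] zero_le_power2[of "snd w"] by linarith
  hence "(2 / 3) * pi * Re z * ((norm w)\<^sup>2 / 2) \<le> (2 / 3) * pi * Re z * ((fst w)\<^sup>2 + 3 / 4 * (snd w)\<^sup>2)"
    using assms by (intro mult_left_mono) auto
  thus ?thesis by (simp add: norm_dgauss)
qed

lemma integrable_poly_bounded_mult:
  fixes f :: "real \<times> real \<Rightarrow> real"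
  assumes c: "c > 0"
    and E: "E \<in> borel_measurable borel" "\<And>w. norm (E w :: complex) \<le> exp (- c * (norm w)\<^sup>2)"
    and f: "f \<in> borel_measurable borel" "AE w in lborel. \<bar>f w\<bar> \<le> C * (1 + norm w) ^ n"
  shows "integrable lborel (\<lambda>w. of_real (f w) * E w)"
proof (rule Bochner_Integration.integrable_bound[OF integrable_poly_gaussian[OF c, of C n]])
  show "AE w in lborel. norm (of_real (f w) * E w) \<le> norm (C * (1 + norm w) ^ n * exp (- c * (norm w)\<^sup>2))"
    using f(2)
  proof eventually_elim
    case (elim w)
    have "norm (of_real (f w) * E w) \<le> (C * (1 + norm w) ^ n) * exp (- c * (norm w)\<^sup>2)"
      using elim E(2)[of w] by (simp add: norm_mult mult_mono')
    thus ?case by simp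
  qed
qed (use E(1) f(1) in measurable)

lemma integrable_dgauss:
  assumes "Re z > 0" "f \<in> borel_measurable borel" "AE w in lborel. \<bar>f w\<bar> \<le> C * (1 + norm w) ^ n"
  shows "integrable lborel (\<lambda>w. of_real (f w) * dgauss z w)"
  using integrable_poly_bounded_mult[of "pi * Re z / 3" "dgauss z"] norm_dgauss_le[OF assms(1)] assms by auto

lemma integrable_dgauss_bounded:
  assumes "Re z > 0" "f \<in> borel_measurable borel" "AE w in lborel. \<bar>f w\<bar> \<le> C"
  shows "integrable lborel (\<lambda>w. of_real (f w) * dgauss z w)"
  using integrable_dgauss[of z f C 0] assms by simp

lemma integral_dgauss_odd:
  fixes f :: "real \<times> real \<Rightarrow> real"
  assumes [measurable]: "f \<in> borel_measurable borel"
    and odd: "\<And>x y. f (- x, y) = - f (x, y)"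
  shows "(LINT w|lborel. of_real (f w) * dgauss z w) = 0"
proof -
  let ?T = "\<lambda>w :: real \<times> real. (- 1 * fst w, 1 * snd w)"
  have "(LINT w|lborel. (of_real (f (?T w)) * dgauss z (?T w))) = (LINT w|lborel. of_real (f w) * dgauss z w)"
  proof (rule integral_lborel_invariant[of ?T "\<lambda>w. of_real (f w) * dgauss z w"])
    show "distr lborel lborel ?T = lborel" by (rule lborel_distr_scale) simp
    show "?T \<in> borel_measurable borel" by (intro borel_measurable_continuous_onI continuous_intros)
  qed measurable
  moreover have "of_real (f (?T w)) * dgauss z (?T w) = - (of_real (f w) * dgauss z w)" for w
    using odd[of "fst w" "snd w"] by (simp add: dgauss_def)
  ultimately have "- (LINT w|lborel. of_real (f w) * dgauss z w) = (LINT w|lborel. of_real (f w) * dgauss z w)"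
    by simp
  thus ?thesis by (simp add: complex_eq_iff)
qed

text \<open>The map preserves area and exchanges the two summands x^2 and (3/4) y^2 of the exponent,
  so it preserves the weight and flips the sign of the integral.\<close>

lemma integral_dgauss_rotate:
  fixes f :: "real \<times> real \<Rightarrow> real"
  assumes [measurable]: "f \<in> borel_measurable borel"
    and odd: "\<And>x y. f (sqrt 3 / 2 * y, 2 / sqrt 3 * x) = - f (x, y)"
  shows "(LINT w|lborel. of_real (f w) * dgauss z w) = 0"
proof -
  let ?S = "\<lambda>w :: real \<times> real. (snd w, fst w)"
  let ?R = "\<lambda>w :: real \<times> real. (sqrt 3 / 2 * fst w, 2 / sqrt 3 * snd w)"
  let ?F = "\<lambda>w. of_real (f w) * dgauss z w"
  have [measurable]: "?R \<in> borel_measurable borel" "?S \<in> borel_measurable borel"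
    by (intro borel_measurable_continuous_onI continuous_intros)+
  have "(LINT w|lborel. ?F (?R (?S w))) = (LINT w|lborel. ?F (?R w))"
  proof (rule integral_lborel_invariant[of ?S "\<lambda>w. ?F (?R w)"])
    have [measurable]: "?F \<in> borel_measurable borel" by measurable
    show "(\<lambda>w. ?F (?R w)) \<in> borel_measurable borel"
      by (rule measurable_compose[of ?R borel borel ?F]) measurable
  qed (simp_all only: lborel_distr_swap, measurable)
  also have "\<dots> = (LINT w|lborel. ?F w)"
  proof (rule integral_lborel_invariant[of ?R ?F])
    show "distr lborel lborel ?R = lborel" by (rule lborel_distr_scale) simp
  qed measurable
  also have "(\<lambda>w. ?F (?R (?S w))) = (\<lambda>w. - ?F w)"
  proof
    fix w
    have "(sqrt 3 / 2 * snd w)\<^sup>2 + 3 / 4 * (2 / sqrt 3 * fst w)\<^sup>2 = (fst w)\<^sup>2 + 3 / 4 * (snd w)\<^sup>2"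
      by (simp add: power_mult_distrib power_divide)
    thus "?F (?R (?S w)) = - ?F w"
      using odd[of "snd w" "fst w"] by (simp add: dgauss_def)
  qed
  finally have "- (LINT w|lborel. ?F w) = (LINT w|lborel. ?F w)" by simp
  thus ?thesis by (simp add: complex_eq_iff)
qed

lemma integral_qgauss_dgauss:
  fixes f :: "real \<times> real \<Rightarrow> real"
  assumes [measurable]: "f \<in> borel_measurable borel"
  shows "(LINT w|lborel. of_real (f w) * qgauss z w) =
      (LINT w|lborel. of_real (f (fst w - snd w / 2, snd w)) * dgauss z w)"
    and "integrable lborel (\<lambda>w. of_real (f w) * qgauss z w) \<longleftrightarrow>
      integrable lborel (\<lambda>w. of_real (f (fst w - snd w / 2, snd w)) * dgauss z w)"
proof -
  let ?T = "\<lambda>w :: real \<times> real. (fst w + (- 1 / 2) * snd w, snd w)"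
  let ?F = "\<lambda>w. of_real (f w) * qgauss z w"
  have "Qform (?T w) = (fst w)\<^sup>2 + 3 / 4 * (snd w)\<^sup>2" for w
    by (simp add: Qform_real_eq power2_eq_square algebra_simps)
  hence eq: "?F (?T w) = of_real (f (fst w - snd w / 2, snd w)) * dgauss z w" for w
    by (simp add: qgauss_def dgauss_def)
  have T: "?T \<in> borel_measurable borel" by (intro borel_measurable_continuous_onI continuous_intros)
  have F: "?F \<in> borel_measurable borel" by measurable
  show "(LINT w|lborel. ?F w) = (LINT w|lborel. of_real (f (fst w - snd w / 2, snd w)) * dgauss z w)"
    using integral_lborel_invariant[OF lborel_distr_shear T F] unfolding eq by simp
  show "integrable lborel ?F \<longleftrightarrow> integrable lborel (\<lambda>w. of_real (f (fst w - snd w / 2, snd w)) * dgauss z w)"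
    using integrable_lborel_invariant[OF lborel_distr_shear T F] unfolding eq by simp
qed

lemma integral_qgauss_swap:
  fixes f :: "real \<times> real \<Rightarrow> real"
  assumes [measurable]: "f \<in> borel_measurable borel"
  shows "(LINT w|lborel. of_real (f (snd w, fst w)) * qgauss z w) = (LINT w|lborel. of_real (f w) * qgauss z w)"
    and "integrable lborel (\<lambda>w. of_real (f (snd w, fst w)) * qgauss z w) \<longleftrightarrow>
      integrable lborel (\<lambda>w. of_real (f w) * qgauss z w)"
proof -
  let ?S = "\<lambda>w :: real \<times> real. (snd w, fst w)"
  let ?F = "\<lambda>w. of_real (f w) * qgauss z w"
  have eq: "?F (?S w) = of_real (f (snd w, fst w)) * qgauss z w" for w
    by (simp add: qgauss_def Qform_real_eq algebra_simps)
  have S: "?S \<in> borel_measurable borel" by (intro borel_measurable_continuous_onI continuous_intros)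
  have F: "?F \<in> borel_measurable borel" by measurable
  show "(LINT w|lborel. of_real (f (snd w, fst w)) * qgauss z w) = (LINT w|lborel. ?F w)"
    using integral_lborel_invariant[OF lborel_distr_swap S F] unfolding eq .
  show "integrable lborel (\<lambda>w. of_real (f (snd w, fst w)) * qgauss z w) \<longleftrightarrow> integrable lborel ?F"
    using integrable_lborel_invariant[OF lborel_distr_swap S F] unfolding eq .
qed

lemma fst_snd_measurable [measurable]:
  "(fst :: 'a::topological_space \<times> 'b::topological_space \<Rightarrow> 'a) \<in> borel_measurable borel"
  "(snd :: 'a \<times> 'b \<Rightarrow> 'b) \<in> borel_measurable borel"
  by (intro borel_measurable_continuous_onI continuous_intros)+

subsection \<open>The rational kernels\<close>

text \<open>In all these kernels \<open>fst w\<close> stands for v = w1 + w2 / 2, \<open>A\<close>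
  for Q(r), \<open>l\<close> for r2 and \<open>b\<close> for r1 + r2 / 2. This one is the integrand
  of J(r) without its Gaussian.\<close>

definition kerJ :: "real \<Rightarrow> real \<Rightarrow> real \<times> real \<Rightarrow> real" where
  "kerJ A l w = (fst w)\<^sup>2 * (snd w)\<^sup>2 / (((snd w)\<^sup>2 + l\<^sup>2) * (A + ((fst w)\<^sup>2 + 3 / 4 * (snd w)\<^sup>2)))"

definition kerK :: "real \<Rightarrow> real \<Rightarrow> real \<times> real \<Rightarrow> real" where
  "kerK A l w = ((fst w)\<^sup>2 - 3 / 4 * (snd w)\<^sup>2) / (((snd w)\<^sup>2 + l\<^sup>2) * (A + ((fst w)\<^sup>2 + 3 / 4 * (snd w)\<^sup>2)))"

text \<open>The part of \<open>kerU\<close> that is odd in v. For l = 0 its first fraction has a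
  simple pole at w2 = 0 with residue v^3 / (v^2 + A), which the last term removes.\<close>

definition kerO :: "real \<Rightarrow> real \<Rightarrow> real \<Rightarrow> real \<times> real \<Rightarrow> real" where
  "kerO A b l w = (((fst w)\<^sup>2 - 3 / 4 * (snd w)\<^sup>2) * fst w * snd w - 3 * fst w * snd w * b * l)
      / (((snd w)\<^sup>2 + l\<^sup>2) * (A + ((fst w)\<^sup>2 + 3 / 4 * (snd w)\<^sup>2)))
    - (if l = 0 then fst w ^ 3 / (snd w * ((fst w)\<^sup>2 + A)) else 0)"

text \<open>The first factor of the numerator is w1^2 + w2^2 + 4 w1 w2 in the coordinates v and
  w2.\<close>

definition kerU :: "real \<Rightarrow> real \<Rightarrow> real \<Rightarrow> real \<times> real \<Rightarrow> real" where
  "kerU A b l w = ((fst w)\<^sup>2 + 3 * fst w * snd w - 3 / 4 * (snd w)\<^sup>2) * (fst w * snd w - b * l)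
      / (((snd w)\<^sup>2 + l\<^sup>2) * (A + ((fst w)\<^sup>2 + 3 / 4 * (snd w)\<^sup>2)))
    - (if l = 0 then fst w ^ 3 / (snd w * ((fst w)\<^sup>2 + A)) else 0)"

lemma ker_measurable [measurable]:
  "kerJ A l \<in> borel_measurable borel" "kerK A l \<in> borel_measurable borel"
  "kerO A b l \<in> borel_measurable borel" "kerU A b l \<in> borel_measurable borel"
  unfolding kerJ_def[abs_def] kerK_def[abs_def] kerO_def[abs_def] kerU_def[abs_def] by measurable

lemma kerU_eq: "kerU A b l w = 3 * kerJ A l w - b * l * kerK A l w + kerO A b l w"
proof -
  have "((fst w)\<^sup>2 + 3 * fst w * snd w - 3 / 4 * (snd w)\<^sup>2) * (fst w * snd w - b * l) =
    3 * ((fst w)\<^sup>2 * (snd w)\<^sup>2) - b * l * ((fst w)\<^sup>2 - 3 / 4 * (snd w)\<^sup>2) +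
    (((fst w)\<^sup>2 - 3 / 4 * (snd w)\<^sup>2) * fst w * snd w - 3 * fst w * snd w * b * l)"
    by (simp add: power2_eq_square field_simps)
  moreover have "(3 * n1 - c * n2 + n3) / D - T = 3 * (n1 / D) - c * (n2 / D) + (n3 / D - T)" for n1 n2 n3 c D T :: real
    by (simp add: add_divide_distrib diff_divide_distrib)
  ultimately show ?thesis
    by (simp only: kerU_def kerJ_def kerK_def kerO_def)
qed

lemma abs_divide_le_1:
  fixes a b :: real
  assumes "\<bar>a\<bar> \<le> b"
  shows "\<bar>a / b\<bar> \<le> 1"
  using assms by (cases "b = 0") (auto simp: abs_divide)

lemma abs_mult_le_ellipse:
  fixes x y :: real
  shows "\<bar>x * y\<bar> \<le> x\<^sup>2 + 3 / 4 * y\<^sup>2"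
proof -
  have "0 \<le> (\<bar>x\<bar> - \<bar>y\<bar> / 2)\<^sup>2 + y\<^sup>2 / 2" by simp
  also have "\<dots> = x\<^sup>2 + 3 / 4 * y\<^sup>2 - \<bar>x * y\<bar>"
    by (simp add: power2_diff power_divide abs_mult)
  finally show ?thesis by simp
qed

lemma abs_diff_squares_le_ellipse:
  fixes x y :: real
  assumes "A \<ge> 0"
  shows "\<bar>x\<^sup>2 - 3 / 4 * y\<^sup>2\<bar> \<le> A + (x\<^sup>2 + 3 / 4 * y\<^sup>2)"
  using assms zero_le_power2[of x] zero_le_power2[of y] by linarith

lemma kerJ_le:
  assumes "A \<ge> 0"
  shows "\<bar>kerJ A l w\<bar> \<le> 1"
proof -
  have "\<bar>(fst w)\<^sup>2 * (snd w)\<^sup>2\<bar> \<le> ((snd w)\<^sup>2 + l\<^sup>2) * (A + ((fst w)\<^sup>2 + 3 / 4 * (snd w)\<^sup>2))"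
    using assms unfolding mult.commute[of "(fst w)\<^sup>2"] abs_mult abs_power2 by (intro mult_mono) auto
  thus ?thesis unfolding kerJ_def by (rule abs_divide_le_1)
qed

lemma kerK_le:
  assumes "A \<ge> 0" "l \<noteq> 0"
  shows "\<bar>kerK A l w\<bar> \<le> 1 / l\<^sup>2"
proof -
  have "kerK A l w = 1 / ((snd w)\<^sup>2 + l\<^sup>2) * (((fst w)\<^sup>2 - 3 / 4 * (snd w)\<^sup>2) / (A + ((fst w)\<^sup>2 + 3 / 4 * (snd w)\<^sup>2)))"
    by (simp add: kerK_def)
  hence "\<bar>kerK A l w\<bar> = \<bar>1 / ((snd w)\<^sup>2 + l\<^sup>2)\<bar> * \<bar>((fst w)\<^sup>2 - 3 / 4 * (snd w)\<^sup>2) / (A + ((fst w)\<^sup>2 + 3 / 4 * (snd w)\<^sup>2))\<bar>"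
    by (simp only: abs_mult)
  also have "\<dots> \<le> 1 / l\<^sup>2 * 1"
    using assms by (intro mult_mono abs_divide_le_1 abs_diff_squares_le_ellipse) (auto simp: frac_le)
  finally show ?thesis by simp
qed

text \<open>For l different from 0 each quotient is bounded on its own and only a factor |x| is left
  to grow. For l = 0 the two terms must be combined first, since either alone is unbounded near y =
  0.\<close>

lemma kerO_le:
  assumes "A = b\<^sup>2 + 3 / 4 * l\<^sup>2" "snd w \<noteq> 0"
  shows "\<bar>kerO A b l w\<bar> \<le> (3 / 2 + (if l = 0 then 0 else (1 + 3 * \<bar>b\<bar>) / \<bar>l\<bar>)) * (1 + norm w) ^ 1"
proof -
  define x y where "x = fst w" and "y = snd w"
  define D where "D = A + (x\<^sup>2 + 3 / 4 * y\<^sup>2)"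
  have A: "A \<ge> 0" using assms by simp
  have y: "y \<noteq> 0" using assms by (simp add: y_def)
  have x2: "x\<^sup>2 \<ge> 0" and y2: "y\<^sup>2 > 0" using y by auto
  have D: "D > 0" using A x2 y2 unfolding D_def by linarith
  have xle: "\<bar>x\<bar> \<le> norm w" unfolding x_def using norm_fst_le[of "fst w" "snd w"] by simp
  have b1: "\<bar>(x\<^sup>2 - 3 / 4 * y\<^sup>2) / D\<bar> \<le> 1"
    unfolding D_def by (intro abs_divide_le_1 abs_diff_squares_le_ellipse A)
  have "\<bar>x * y\<bar> \<le> D" using abs_mult_le_ellipse[of x y] A unfolding D_def by linarith
  hence b2: "\<bar>x * y / D\<bar> \<le> 1" by (rule abs_divide_le_1)
  show ?thesis
  proof (cases "l = 0")
    case False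
    have b3: "\<bar>y / (y\<^sup>2 + l\<^sup>2)\<bar> \<le> 1 / \<bar>l\<bar>"
    proof -
      have "0 \<le> (\<bar>y\<bar> - \<bar>l\<bar>)\<^sup>2 + \<bar>y\<bar> * \<bar>l\<bar>" by simp
      hence "\<bar>y\<bar> * \<bar>l\<bar> \<le> y\<^sup>2 + l\<^sup>2" by (simp add: power2_diff mult.commute)
      moreover have "y\<^sup>2 + l\<^sup>2 > 0" using y2 by (simp add: add_pos_nonneg)
      ultimately show ?thesis using False by (simp add: field_simps)
    qed
    have b4: "\<bar>l / (y\<^sup>2 + l\<^sup>2)\<bar> \<le> 1 / \<bar>l\<bar>"
    proof -
      have "\<bar>l\<bar> * \<bar>l\<bar> \<le> y\<^sup>2 + l\<^sup>2" by (simp add: power2_eq_square)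
      moreover have "y\<^sup>2 + l\<^sup>2 > 0" using y2 by (simp add: add_pos_nonneg)
      ultimately show ?thesis using False by (simp add: field_simps)
    qed
    have "kerO A b l w = (x\<^sup>2 - 3 / 4 * y\<^sup>2) / D * (x * (y / (y\<^sup>2 + l\<^sup>2))) - 3 * b * ((x * y / D) * (l / (y\<^sup>2 + l\<^sup>2)))"
    proof -
      have "(p * x * y - 3 * x * y * b * l) / (S * D) - 0 = p / D * (x * (y / S)) - 3 * b * ((x * y / D) * (l / S))" for p S
        by (simp add: diff_divide_distrib mult_ac)
      thus ?thesis unfolding kerO_def if_not_P[OF False] x_def[symmetric] y_def[symmetric] D_def[symmetric] .
    qed
    hence "\<bar>kerO A b l w\<bar> \<le> \<bar>(x\<^sup>2 - 3 / 4 * y\<^sup>2) / D\<bar> * (\<bar>x\<bar> * \<bar>y / (y\<^sup>2 + l\<^sup>2)\<bar>) + 3 * \<bar>b\<bar> * (\<bar>x * y / D\<bar> * \<bar>l / (y\<^sup>2 + l\<^sup>2)\<bar>)"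
      by (simp only:) (rule order.trans[OF abs_triangle_ineq4], simp add: abs_mult)
    also have "\<dots> \<le> 1 * (norm w * (1 / \<bar>l\<bar>)) + 3 * \<bar>b\<bar> * (1 * (1 / \<bar>l\<bar>))"
      by (intro add_mono mult_mono b1 b2 b3 b4 xle order.refl) auto
    also have "\<dots> \<le> (1 + 3 * \<bar>b\<bar>) / \<bar>l\<bar> * (1 + norm w)"
      using False by (simp add: field_simps)
    also have "\<dots> \<le> (3 / 2 + (1 + 3 * \<bar>b\<bar>) / \<bar>l\<bar>) * (1 + norm w)"
      by (intro mult_right_mono) auto
    finally show ?thesis using False by simp
  next
    case True
    have "kerO A b l w = - (3 / 4) * (x * y / D) - 3 / 4 * (x * y / D) * (x\<^sup>2 / (x\<^sup>2 + A))"
    proof (cases "x = 0")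
      case True
      thus ?thesis using \<open>l = 0\<close> by (simp add: kerO_def x_def[symmetric] y_def[symmetric])
    next
      case False
      hence "x\<^sup>2 > 0" by simp
      define S where "S = x\<^sup>2 + A"
      have S: "S > 0" unfolding S_def using \<open>x\<^sup>2 > 0\<close> A by (rule add_pos_nonneg)
      have DS: "D = S + 3 / 4 * y\<^sup>2" by (simp add: D_def S_def)
      have "(x\<^sup>2 - 3 / 4 * y\<^sup>2) * x * y / (y\<^sup>2 * D) - x ^ 3 / (y * S)
          = ((x\<^sup>2 - 3 / 4 * y\<^sup>2) * x * S - x ^ 3 * D) / (y * D * S)"
        using y D S by (simp add: field_simps power2_eq_square)
      \<comment> \<open>Over the common denominator the numerator acquires the factor y^2, which
        cancels the pole.\<close>
      also have "(x\<^sup>2 - 3 / 4 * y\<^sup>2) * x * S - x ^ 3 * D = - 3 / 4 * x * y\<^sup>2 * (S + x\<^sup>2)"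
        unfolding DS by (simp add: field_simps power2_eq_square power3_eq_cube)
      also have "- 3 / 4 * x * y\<^sup>2 * (S + x\<^sup>2) / (y * D * S) = - (3 / 4) * (x * y / D) - 3 / 4 * (x * y / D) * (x\<^sup>2 / S)"
        using y D S by (simp add: field_simps power2_eq_square)
      finally show ?thesis
        unfolding kerO_def if_P[OF True] x_def[symmetric] y_def[symmetric] D_def[symmetric] S_def[symmetric]
        using True by simp
    qed
    hence "\<bar>kerO A b l w\<bar> \<le> 3 / 4 * \<bar>x * y / D\<bar> + 3 / 4 * \<bar>x * y / D\<bar> * \<bar>x\<^sup>2 / (x\<^sup>2 + A)\<bar>"
      by (simp only:) (rule order.trans[OF abs_triangle_ineq4], simp add: abs_mult)
    also have "\<dots> \<le> 3 / 4 * 1 + 3 / 4 * 1 * 1"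
      using A by (intro add_mono mult_mono b2 abs_divide_le_1) auto
    also have "\<dots> \<le> 3 / 2 * (1 + norm w)" by simp
    finally show ?thesis using True by simp
  qed
qed

definition intJ :: "complex \<Rightarrow> real \<Rightarrow> real \<Rightarrow> complex" where
  "intJ z A l = (LINT w|lborel. of_real (kerJ A l w) * dgauss z w)"

definition intK :: "complex \<Rightarrow> real \<Rightarrow> real \<Rightarrow> complex" where
  "intK z A l = (LINT w|lborel. of_real (kerK A l w) * dgauss z w)"

lemma kerU_integral:
  assumes z: "Re z > 0" and A: "A = b\<^sup>2 + 3 / 4 * l\<^sup>2"
  shows "integrable lborel (\<lambda>w. of_real (kerU A b l w) * dgauss z w)"
    and "(LINT w|lborel. of_real (kerU A b l w) * dgauss z w) = 3 * intJ z A l - of_real (b * l) * intK z A l"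
proof -
  have A0: "A \<ge> 0" using A by simp
  have J: "integrable lborel (\<lambda>w. of_real (kerJ A l w) * dgauss z w)"
    by (rule integrable_dgauss_bounded[OF z, of _ 1]) (auto intro: kerJ_le A0)
  hence J3: "integrable lborel (\<lambda>w. 3 * (of_real (kerJ A l w) * dgauss z w))"
    by (rule integrable_mult_right)
  \<comment> \<open>For l = 0 the kernel \<open>kerK\<close> has a nonintegrable pole at w2 = 0, but
    its coefficient \<open>b * l\<close> vanishes.\<close>
  have "integrable lborel (\<lambda>w. of_real (b * l * kerK A l w) * dgauss z w)"
  proof (cases "l = 0")
    case False
    show ?thesis
      by (rule integrable_dgauss_bounded[OF z, of _ "\<bar>b * l\<bar> * (1 / l\<^sup>2)"])
         (auto simp only: abs_mult intro!: mult_left_mono kerK_le A0 False always_eventually, measurable)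
  qed simp
  hence K: "integrable lborel (\<lambda>w. of_real (b * l) * (of_real (kerK A l w) * dgauss z w))"
    by (simp add: mult.assoc)
  have "AE w :: real \<times> real in lborel. snd w \<noteq> 0"
    using AE_g2_regular by eventually_elim (auto simp: g2_regular_def)
  hence "AE w in lborel. \<bar>kerO A b l w\<bar> \<le> (3 / 2 + (if l = 0 then 0 else (1 + 3 * \<bar>b\<bar>) / \<bar>l\<bar>)) * (1 + norm w) ^ 1"
    by eventually_elim (rule kerO_le[OF A])
  hence O: "integrable lborel (\<lambda>w. of_real (kerO A b l w) * dgauss z w)"
    by (rule integrable_dgauss[OF z, rotated]) measurable
  have O0: "(LINT w|lborel. of_real (kerO A b l w) * dgauss z w) = 0"
  proof (rule integral_dgauss_odd)
    show "kerO A b l (- x, y) = - kerO A b l (x, y)" for x y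
      by (simp add: kerO_def diff_divide_distrib)
  qed measurable
  have eq: "of_real (kerU A b l w) * dgauss z w = 3 * (of_real (kerJ A l w) * dgauss z w)
     - of_real (b * l) * (of_real (kerK A l w) * dgauss z w) + of_real (kerO A b l w) * dgauss z w" for w
    by (simp add: kerU_eq algebra_simps)
  show "integrable lborel (\<lambda>w. of_real (kerU A b l w) * dgauss z w)"
    unfolding eq by (rule Bochner_Integration.integrable_add[OF Bochner_Integration.integrable_diff[OF J3 K] O])
  show "(LINT w|lborel. of_real (kerU A b l w) * dgauss z w) = 3 * intJ z A l - of_real (b * l) * intK z A l"
    unfolding eq intJ_def intK_def
    by (simp only: Bochner_Integration.integral_add[OF Bochner_Integration.integrable_diff[OF J3 K] O]
      Bochner_Integration.integral_diff[OF J3 K] integral_mult_right_zero O0 add_0_right)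
qed

definition moment_bound :: "complex \<Rightarrow> real" where
  "moment_bound z = (LINT w|lborel. norm (of_real (((fst w)\<^sup>2 - 3 / 4 * (snd w)\<^sup>2) * (snd w)\<^sup>2) * dgauss z w))"

text \<open>Write 1 / (y^2 + l^2) as (1 / l^2) (1 - y^2 / (y^2 + l^2)). The first part,
  \<open>p\<close>, changes sign under the exchange of the axes and integrates to 0; the second,
  \<open>s\<close>, brings another 1 / l^2. Without this gain the boundary terms of the box sums of
  X(r) could not be shown to vanish: 1 / l^2 alone would leave a bounded remainder.\<close>

lemma norm_intK_le:
  assumes z: "Re z > 0" and A: "A > 0" and l: "l \<noteq> 0"
  shows "norm (intK z A l) \<le> moment_bound z / (l ^ 4 * A)"
proof -
  define p where "p = (\<lambda>w::real\<times>real. ((fst w)\<^sup>2 - 3 / 4 * (snd w)\<^sup>2) / (A + ((fst w)\<^sup>2 + 3 / 4 * (snd w)\<^sup>2)))"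
  define m where "m = (\<lambda>w::real\<times>real. ((fst w)\<^sup>2 - 3 / 4 * (snd w)\<^sup>2) * (snd w)\<^sup>2)"
  define s where "s = (\<lambda>w::real\<times>real. m w / (((snd w)\<^sup>2 + l\<^sup>2) * (A + ((fst w)\<^sup>2 + 3 / 4 * (snd w)\<^sup>2))))"
  have [measurable]: "p \<in> borel_measurable borel" "s \<in> borel_measurable borel" "m \<in> borel_measurable borel"
    unfolding p_def s_def m_def by measurable
  have p: "integrable lborel (\<lambda>w. of_real (p w) * dgauss z w)"
    by (rule integrable_dgauss_bounded[OF z, of _ 1])
       (measurable, unfold p_def, use A in \<open>intro always_eventually allI abs_divide_le_1 abs_diff_squares_le_ellipse, simp\<close>)
  have p0: "(LINT w|lborel. of_real (p w) * dgauss z w) = 0"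
  proof (rule integral_dgauss_rotate)
    show "p (sqrt 3 / 2 * y, 2 / sqrt 3 * x) = - p (x, y)" for x y
      by (simp add: p_def power_mult_distrib power_divide add.commute minus_divide_left)
  qed measurable
  have m: "integrable lborel (\<lambda>w. of_real (m w) * dgauss z w)"
  proof (rule integrable_dgauss[OF z, of _ 2 4])
    show "AE w in lborel. \<bar>m w\<bar> \<le> 2 * (1 + norm w) ^ 4"
    proof (intro always_eventually allI)
      fix w :: "real \<times> real"
      have n: "(norm w)\<^sup>2 = (fst w)\<^sup>2 + (snd w)\<^sup>2" by (simp add: norm_prod_def)
      have "\<bar>(fst w)\<^sup>2 - 3 / 4 * (snd w)\<^sup>2\<bar> \<le> (norm w)\<^sup>2"
        using zero_le_power2[of "fst w"] zero_le_power2[of "snd w"] unfolding n by linarith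
      moreover have "(snd w)\<^sup>2 \<le> (norm w)\<^sup>2" unfolding n by simp
      ultimately have "\<bar>m w\<bar> \<le> (norm w)\<^sup>2 * (norm w)\<^sup>2"
        unfolding m_def abs_mult abs_power2 by (intro mult_mono) auto
      also have "\<dots> = norm w ^ 4" by (simp add: power4_eq_xxxx power2_eq_square)
      also have "\<dots> \<le> (1 + norm w) ^ 4" by (intro power_mono) auto
      also have "\<dots> \<le> 2 * (1 + norm w) ^ 4" by simp
      finally show "\<bar>m w\<bar> \<le> 2 * (1 + norm w) ^ 4" .
    qed
  qed measurable
  have sm: "norm (of_real (s w) * dgauss z w) \<le> norm (of_real (m w) * dgauss z w) / (l\<^sup>2 * A)" for w
  proof -
    have l2: "l\<^sup>2 > 0" using l by simp
    have "l\<^sup>2 * A \<le> ((snd w)\<^sup>2 + l\<^sup>2) * (A + ((fst w)\<^sup>2 + 3 / 4 * (snd w)\<^sup>2))"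
      using A by (intro mult_mono) auto
    moreover have "0 < l\<^sup>2 * A" using A l2 by simp
    ultimately have "\<bar>s w\<bar> \<le> \<bar>m w\<bar> / (l\<^sup>2 * A)"
      unfolding s_def abs_divide by (intro frac_le) auto
    hence "\<bar>s w\<bar> * norm (dgauss z w) \<le> \<bar>m w\<bar> / (l\<^sup>2 * A) * norm (dgauss z w)"
      by (rule mult_right_mono) simp
    thus ?thesis by (simp add: norm_mult)
  qed
  have s: "integrable lborel (\<lambda>w. of_real (s w) * dgauss z w)"
  proof (rule Bochner_Integration.integrable_bound[OF integrable_divide[OF integrable_norm[OF m], of "l\<^sup>2 * A"]])
    show "AE w in lborel. norm (of_real (s w) * dgauss z w) \<le> norm (norm (of_real (m w) * dgauss z w) / (l\<^sup>2 * A))"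
    proof (intro always_eventually allI)
      fix w
      have "0 \<le> norm (of_real (m w) * dgauss z w) / (l\<^sup>2 * A)" using A by simp
      thus "norm (of_real (s w) * dgauss z w) \<le> norm (norm (of_real (m w) * dgauss z w) / (l\<^sup>2 * A))"
        using sm[of w] by (simp only: real_norm_def abs_of_nonneg)
    qed
  qed measurable
  have eq: "of_real (kerK A l w) * dgauss z w = of_real (1 / l\<^sup>2) * (of_real (p w) * dgauss z w - of_real (s w) * dgauss z w)" for w
  proof -
    have "(snd w)\<^sup>2 + l\<^sup>2 > 0" "A + ((fst w)\<^sup>2 + 3 / 4 * (snd w)\<^sup>2) > 0"
      using A l by (auto simp: add_nonneg_pos add_pos_nonneg)
    hence "kerK A l w = 1 / l\<^sup>2 * (p w - s w)"
      using l unfolding kerK_def p_def s_def m_def by (simp add: divide_simps) (simp add: algebra_simps)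
    thus ?thesis by (simp add: left_diff_distrib right_diff_distrib diff_divide_distrib)
  qed
  have "intK z A l = - of_real (1 / l\<^sup>2) * (LINT w|lborel. of_real (s w) * dgauss z w)"
    unfolding intK_def eq using p s p0 by (simp del: of_real_divide)
  hence "norm (intK z A l) = 1 / l\<^sup>2 * norm (LINT w|lborel. of_real (s w) * dgauss z w)"
    by (simp add: norm_mult norm_divide norm_power)
  also have "norm (LINT w|lborel. of_real (s w) * dgauss z w) \<le> (LINT w|lborel. norm (of_real (s w) * dgauss z w))"
    by (rule integral_norm_bound)
  also have "\<dots> \<le> (LINT w|lborel. norm (of_real (m w) * dgauss z w) / (l\<^sup>2 * A))"
    by (intro integral_mono integrable_norm s integrable_divide m sm)
  also have "\<dots> = moment_bound z / (l\<^sup>2 * A)"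
    by (simp add: moment_bound_def m_def)
  finally have "norm (intK z A l) \<le> 1 / l\<^sup>2 * (moment_bound z / (l\<^sup>2 * A))"
    by (simp add: mult_left_mono divide_right_mono)
  also have "\<dots> = moment_bound z / (l ^ 4 * A)"
    by (simp add: power4_eq_xxxx power2_eq_square mult_ac)
  finally show ?thesis .
qed

section \<open>The rational summands and their Gaussian integrals\<close>

text \<open>The overview's C_r for r = (a, c). The fraction contains the real part of 1 / ((w1 - i
  a) (w2 - i c)). The term subtracted for a = 0 is (w2 + w1 / 2)^2 / w1 times the real part of 1 /
  (w2 + w1 / 2 - i c), so that summation over c turns it into the cotangent subtracted in
  g_(k,(0,r)).\<close>

definition termC :: "real \<Rightarrow> real \<Rightarrow> real \<times> real \<Rightarrow> real" where
  "termC a c w =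
    ((fst w)\<^sup>2 + (snd w)\<^sup>2 + 4 * fst w * snd w) * (fst w * snd w - a * c) / (((fst w)\<^sup>2 + a\<^sup>2) * ((snd w)\<^sup>2 + c\<^sup>2))
    - (if a = 0 then (snd w + fst w / 2) ^ 3 / (fst w * ((snd w + fst w / 2)\<^sup>2 + c\<^sup>2)) else 0)
    - (if c = 0 then (fst w + snd w / 2) ^ 3 / (snd w * ((fst w + snd w / 2)\<^sup>2 + a\<^sup>2)) else 0)"

lemma termC_measurable [measurable]: "termC a c \<in> borel_measurable borel"
  unfolding termC_def[abs_def] by measurable

lemma Qform_complete_square: "Qform (a, c) = (a + c / 2)\<^sup>2 + 3 / 4 * c\<^sup>2" for a c :: real
  by (simp add: power2_eq_square field_simps)

text \<open>
  \<open>Q(w) + Q(a, c)\<close> lies in the ideal generated by \<open>w\<^sub>1 - \<i>a\<close> and \<open>w\<^sub>2 - \<i>c\<close>, which splits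
  \<open>1 / ((w\<^sub>1 - \<i>a) (w\<^sub>2 - \<i>c))\<close> into two summands with only one linear factor each.
\<close>
lemma termC_eq_kerU:
  assumes w: "w \<in> g2_regular"
  shows "termC a c w = kerU (Qform (a, c)) (a + c / 2) c (fst w + snd w / 2, snd w)
    + kerU (Qform (a, c)) (c + a / 2) a (snd w + fst w / 2, fst w)"
proof -
  define x y where "x = fst w" and "y = snd w"
  define A where "A = Qform (a, c)"
  define D where "D = A + (x\<^sup>2 + y\<^sup>2 + x * y)"
  have xy: "x \<noteq> 0" "y \<noteq> 0" using w by (auto simp: g2_regular_def x_def y_def)
  have "A \<ge> 0" by (simp add: A_def Qform_complete_square del: Qform.simps)
  moreover have "x\<^sup>2 + y\<^sup>2 + x * y = (x + y / 2)\<^sup>2 + 3 / 4 * y\<^sup>2"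
    by (simp add: power2_eq_square field_simps)
  hence "x\<^sup>2 + y\<^sup>2 + x * y > 0" using xy by (simp add: add_nonneg_pos)
  ultimately have D: "D > 0" unfolding D_def by (rule add_nonneg_pos)
  have D1: "A + ((x + y / 2)\<^sup>2 + 3 / 4 * y\<^sup>2) = D" "A + ((y + x / 2)\<^sup>2 + 3 / 4 * x\<^sup>2) = D"
    by (simp_all add: D_def power2_eq_square field_simps)
  have X: "x\<^sup>2 + a\<^sup>2 \<noteq> 0" "y\<^sup>2 + c\<^sup>2 \<noteq> 0" using xy by (auto simp: sum_power2_eq_zero_iff)
  define P where "P = x\<^sup>2 + y\<^sup>2 + 4 * x * y"
  have P: "(x + y / 2)\<^sup>2 + 3 * (x + y / 2) * y - 3 / 4 * y\<^sup>2 = P" "(y + x / 2)\<^sup>2 + 3 * (y + x / 2) * x - 3 / 4 * x\<^sup>2 = P"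
    by (simp_all add: P_def power2_eq_square field_simps)
  \<comment> \<open>With the symmetric cofactors, D = (x - i a) (x + i a + (y + i c) / 2) + (y - i
    c) (y + i c + (x + i a) / 2). Each cofactor is multiplied by the conjugate of the linear factor
    left in its denominator; \<open>u\<close> and \<open>v\<close> are the real parts.\<close>
  define u v where "u = (x + y / 2) * y - (a + c / 2) * c" and "v = (y + x / 2) * x - (c + a / 2) * a"
  have "(x * y - a * c) * D = u * (x\<^sup>2 + a\<^sup>2) + v * (y\<^sup>2 + c\<^sup>2)"
    unfolding u_def v_def D_def A_def by (simp add: power2_eq_square field_simps)
  hence "P * (x * y - a * c) / ((x\<^sup>2 + a\<^sup>2) * (y\<^sup>2 + c\<^sup>2)) = P * u / ((y\<^sup>2 + c\<^sup>2) * D) + P * v / ((x\<^sup>2 + a\<^sup>2) * D)"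
  proof -
    assume *: "(x * y - a * c) * D = u * (x\<^sup>2 + a\<^sup>2) + v * (y\<^sup>2 + c\<^sup>2)"
    define X Y where "X = x\<^sup>2 + a\<^sup>2" and "Y = y\<^sup>2 + c\<^sup>2"
    have "P * (x * y - a * c) / (X * Y) = P * ((x * y - a * c) * D) / (X * Y * D)" using D by simp
    also have "\<dots> = P * (u * X + v * Y) / (X * Y * D)" using * by (simp add: X_def Y_def)
    also have "\<dots> = P * u / (Y * D) + P * v / (X * D)"
    proof -
      have "X \<noteq> 0" "Y \<noteq> 0" using X by (simp_all add: X_def Y_def)
      thus ?thesis using D by (simp add: field_simps)
    qed
    finally show ?thesis by (simp add: X_def Y_def)
  qed
  \<comment> \<open>When one index vanishes, A is the square of the other, so the pole subtractions
    in \<open>termC\<close> and \<open>kerU\<close> coincide.\<close>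
  moreover have "A = c\<^sup>2" if "a = 0" using that by (simp add: A_def)
  moreover have "A = a\<^sup>2" if "c = 0" using that by (simp add: A_def)
  ultimately show ?thesis
    unfolding termC_def kerU_def fst_conv snd_conv x_def[symmetric] y_def[symmetric] A_def[symmetric] D1 P
      u_def[symmetric] v_def[symmetric] P_def[symmetric]
    by (auto simp: add.commute)
qed

text \<open>The share of the summand whose linear factor is w2 - i c; the share of w1 - i a is the
  same expression with \<open>a\<close> and \<open>c\<close> exchanged.\<close>

definition half_term :: "complex \<Rightarrow> real \<Rightarrow> real \<Rightarrow> complex" where
  "half_term z a c = 3 * intJ z (Qform (a, c)) c - of_real ((a + c / 2) * c) * intK z (Qform (a, c)) c"

lemma termC_integral:
  assumes z: "Re z > 0"
  shows "integrable lborel (\<lambda>w. of_real (termC a c w) * qgauss z w)"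
    and "(LINT w|lborel. of_real (termC a c w) * qgauss z w) = half_term z a c + half_term z c a"
proof -
  define u where "u = (\<lambda>a c w. kerU (Qform (a, c)) (a + c / 2) c (fst w + snd w / 2, snd w))"
  have m: "u a c \<in> borel_measurable borel" for a c
    unfolding u_def
    by (rule measurable_compose[of _ borel borel, OF borel_measurable_continuous_onI])
       (auto intro!: continuous_intros)
  have u: "integrable lborel (\<lambda>w. of_real (u a c w) * qgauss z w)"
    "(LINT w|lborel. of_real (u a c w) * qgauss z w) = half_term z a c" for a c
  proof -
    have eq: "u a c (fst w - snd w / 2, snd w) = kerU (Qform (a, c)) (a + c / 2) c w" for w
      by (simp add: u_def)
    show "integrable lborel (\<lambda>w. of_real (u a c w) * qgauss z w)"
      "(LINT w|lborel. of_real (u a c w) * qgauss z w) = half_term z a c"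
      unfolding integral_qgauss_dgauss[OF m] eq half_term_def
      by (intro kerU_integral z Qform_complete_square)+
  qed
  have us: "integrable lborel (\<lambda>w. of_real (u c a (snd w, fst w)) * qgauss z w)"
    "(LINT w|lborel. of_real (u c a (snd w, fst w)) * qgauss z w) = half_term z c a"
    unfolding integral_qgauss_swap[OF m] by (rule u)+
  have "Qform (c, a) = Qform (a, c)" by (simp add: algebra_simps)
  hence ae: "AE w in lborel. of_real (termC a c w) * qgauss z w =
     of_real (u a c w) * qgauss z w + of_real (u c a (snd w, fst w)) * qgauss z w"
    using AE_g2_regular
    by (auto elim!: eventually_mono simp: termC_eq_kerU u_def algebra_simps simp del: Qform.simps)
  have int: "integrable lborel (\<lambda>w. of_real (u a c w) * qgauss z w + of_real (u c a (snd w, fst w)) * qgauss z w)"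
    by (intro Bochner_Integration.integrable_add u us)
  have meas: "(\<lambda>w. of_real (termC a c w) * qgauss z w) \<in> borel_measurable lborel"
    by measurable
  show "integrable lborel (\<lambda>w. of_real (termC a c w) * qgauss z w)"
    using int by (subst integrable_cong_AE[OF meas borel_measurable_integrable[OF int] ae])
  have "(LINT w|lborel. of_real (termC a c w) * qgauss z w) =
     (LINT w|lborel. of_real (u a c w) * qgauss z w + of_real (u c a (snd w, fst w)) * qgauss z w)"
    by (rule integral_cong_AE[OF meas borel_measurable_integrable[OF int] ae])
  thus "(LINT w|lborel. of_real (termC a c w) * qgauss z w) = half_term z a c + half_term z c a"
    by (simp only: Bochner_Integration.integral_add[OF u(1) us(1)] u(2) us(2))
qed

subsection \<open>The double Eichler integral as a lattice sum\<close>

lemma integral_lborel_pair_mult: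
  fixes f g :: "real \<Rightarrow> 'a :: {real_normed_field, banach, second_countable_topology}"
  assumes f: "integrable lborel f" and g: "integrable lborel g"
  shows "(LINT w|lborel. f (fst w) * g (snd w)) = (LINT x|lborel. f x) * (LINT y|lborel. g y)"
proof -
  have "(LINT w|lborel. f (fst w) * g (snd w)) = (LINT x|lborel. LINT y|lborel. f x * g y)"
    using lborel_pair.integral_fst'[of "\<lambda>w. f (fst w) * g (snd w)"] integrable_lborel_pair_mult[OF f g]
    by (simp add: lborel_prod)
  also have "\<dots> = (LINT x|lborel. f x) * (LINT y|lborel. g y)"
    using f g by simp
  finally show ?thesis .
qed

section \<open>A single lattice term of the Eichler integral\<close>

lemma exp_half_line:
  fixes u :: real
  assumes "u > 0"
  shows "integrable lborel (\<lambda>t. indicator {0<..} t * exp (- (u * t)))"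
    and "(LINT t|lborel. indicator {0<..} t * exp (- (u * t))) = 1 / u"
  using integrable_I0i_exp_mscale[OF assms] LBINT_I0i_exp_mscale[OF assms]
  by (simp_all add: set_integrable_def set_lebesgue_integral_def interval_lebesgue_integral_0_infty mult.commute)

lemma powr_three_halves_scale:
  assumes "c > 0" "z \<noteq> 0"
  shows "(of_real c * z :: complex) powr (3/2) = of_real (c powr (3/2)) * z powr (3/2)"
proof -
  have "(of_real c * z) powr (3/2) = exp (3/2 * (of_real (ln c) + Ln z))"
    using assms by (simp add: powr_def Ln_times_of_real Ln_of_real)
  also have "\<dots> = exp (of_real (3/2 * ln c)) * exp (3/2 * Ln z)"
    by (simp add: distrib_left exp_add)
  also have "exp (of_real (3/2 * ln c)) = (of_real (c powr (3/2)) :: complex)"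
    using assms by (simp add: powr_def flip: exp_of_real)
  finally show ?thesis using assms by (simp add: powr_def)
qed

text \<open>The contribution of a lattice point r with b = r1 + r2 / 2 and l = r2 on w1 = rho + i s,
  w2 = w1 + i t, where p = (s, t), stripped of its root of unity. There -i (w1 + tau) = s + z and -i
  (w2 + tau) = s + t + z.\<close>

definition eichler_term :: "complex \<Rightarrow> real \<Rightarrow> real \<Rightarrow> real \<times> real \<Rightarrow> complex" where
  "eichler_term z b l p =
     of_real (indicator {0<..} (fst p) * indicator {0<..} (snd p) * exp (- 2 * pi * (l\<^sup>2 * (fst p + snd p) / 4 + b\<^sup>2 * fst p / 3)))
     / ((of_real (fst p + snd p) + z) powr (3/2) * (of_real (fst p) + z) powr (3/2))"

text \<open>The two powers are second moments of Gaussians with parameters (2 pi / 3) (s + z) and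
  (pi / 2) (s + t + z). The ratio 4 : 3 of the scales turns the coefficient of z into the exponent
  of \<open>dgauss\<close>. What remains of the exponent is linear in s and t, with rates
  \<open>\<beta>\<close> and \<open>\<alpha>\<close>, so that integrating out s and t first gives 1
  / (\<open>\<alpha>\<close> \<open>\<beta>\<close>).\<close>

lemma eichler_term_integral:
  assumes z: "Re z > 0" and A: "A = b\<^sup>2 + 3 / 4 * l\<^sup>2"
  shows "integrable lborel (eichler_term z b l)"
    and "(LINT p|lborel. eichler_term z b l p) = of_real (4 / sqrt 3) * intJ z A l"
proof -
  define \<alpha> where "\<alpha> = (\<lambda>w :: real \<times> real. pi / 2 * ((snd w)\<^sup>2 + l\<^sup>2))"
  define \<beta> where "\<beta> = (\<lambda>w :: real \<times> real. 2 * pi / 3 * (A + ((fst w)\<^sup>2 + 3 / 4 * (snd w)\<^sup>2)))"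
  define k where "k = (\<lambda>w (p :: real \<times> real). (indicator {0<..} (fst p) * exp (- (\<beta> w * fst p))) * (indicator {0<..} (snd p) * exp (- (\<alpha> w * snd p))))"
  define h where "h = (\<lambda>w p. of_real ((fst w)\<^sup>2 * (snd w)\<^sup>2 * k w p) * dgauss z w)"
  have A0: "A \<ge> 0" using A by simp
  have [measurable]: "(\<lambda>u. k (fst u) (snd u)) \<in> borel_measurable borel"
    unfolding k_def \<alpha>_def \<beta>_def by measurable
  have [measurable]: "k w \<in> borel_measurable borel" for w
    unfolding k_def by measurable
  have hm: "(\<lambda>u. h (fst u) (snd u)) \<in> borel_measurable borel"
    unfolding h_def by measurable
  have kint: "integrable lborel (k w)" "(LINT p|lborel. k w p) = 1 / (\<alpha> w * \<beta> w)" if "snd w \<noteq> 0" for w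
  proof -
    have \<alpha>: "\<alpha> w > 0" using that by (simp add: \<alpha>_def add_pos_nonneg)
    have "0 < (snd w)\<^sup>2" using that by simp
    hence "0 < (fst w)\<^sup>2 + 3 / 4 * (snd w)\<^sup>2" using zero_le_power2[of "fst w"] by linarith
    hence "0 < A + ((fst w)\<^sup>2 + 3 / 4 * (snd w)\<^sup>2)" using A0 by linarith
    hence \<beta>: "\<beta> w > 0" unfolding \<beta>_def by (intro mult_pos_pos) auto
    show "integrable lborel (k w)" unfolding k_def
      by (rule integrable_lborel_pair_mult[OF exp_half_line(1)[OF \<beta>] exp_half_line(1)[OF \<alpha>]])
    show "(LINT p|lborel. k w p) = 1 / (\<alpha> w * \<beta> w)"
      unfolding k_def integral_lborel_pair_mult[OF exp_half_line(1)[OF \<beta>] exp_half_line(1)[OF \<alpha>]]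
        exp_half_line(2)[OF \<alpha>] exp_half_line(2)[OF \<beta>] by simp
  qed
  \<comment> \<open>For l = 0 the rate \<open>\<alpha>\<close> vanishes on the line w2 = 0, where
    the prefactor \<open>(snd w)\<^sup>2\<close> makes both sides 0.\<close>
  have kint': "integrable lborel (\<lambda>p. (fst w)\<^sup>2 * (snd w)\<^sup>2 * k w p)"
    "(LINT p|lborel. (fst w)\<^sup>2 * (snd w)\<^sup>2 * k w p) = 3 / pi\<^sup>2 * kerJ A l w" for w
  proof -
    show "integrable lborel (\<lambda>p. (fst w)\<^sup>2 * (snd w)\<^sup>2 * k w p)"
      using kint(1)[of w] by (cases "snd w = 0") auto
    show "(LINT p|lborel. (fst w)\<^sup>2 * (snd w)\<^sup>2 * k w p) = 3 / pi\<^sup>2 * kerJ A l w"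
    proof (cases "snd w = 0")
      case False
      have "3 / pi\<^sup>2 * (X / (S * T)) = X * (1 / (pi / 2 * S * (2 * pi / 3 * T)))" for X S T :: real
        by (simp add: power2_eq_square mult_ac)
      thus ?thesis unfolding kerJ_def integral_mult_right_zero kint(2)[OF False] \<alpha>_def \<beta>_def by simp
    qed (simp add: kerJ_def)
  qed
  have kpos: "k w p \<ge> 0" for w p by (simp add: k_def)
  have hint: "integrable lborel (h w)" "(LINT p|lborel. h w p) = of_real (3 / pi\<^sup>2) * (of_real (kerJ A l w) * dgauss z w)"
    "(LINT p|lborel. norm (h w p)) = 3 / pi\<^sup>2 * kerJ A l w * norm (dgauss z w)" for w
  proof -
    show "integrable lborel (h w)" unfolding h_def
      by (intro integrable_mult_left integrable_of_real kint')
    show "(LINT p|lborel. h w p) = of_real (3 / pi\<^sup>2) * (of_real (kerJ A l w) * dgauss z w)"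
      unfolding h_def integral_mult_left_zero integral_complex_of_real kint' by simp
    have "norm (h w p) = (fst w)\<^sup>2 * (snd w)\<^sup>2 * k w p * norm (dgauss z w)" for p
      unfolding h_def norm_mult norm_of_real using kpos by simp
    thus "(LINT p|lborel. norm (h w p)) = 3 / pi\<^sup>2 * kerJ A l w * norm (dgauss z w)"
      by (simp only: integral_mult_left_zero kint')
  qed
  have J: "integrable lborel (\<lambda>w. of_real (kerJ A l w) * dgauss z w)"
    by (rule integrable_dgauss_bounded[OF z, of _ 1]) (auto intro: kerJ_le A0)
  have Jpos: "kerJ A l w \<ge> 0" for w unfolding kerJ_def using A0 by simp
  have H: "integrable (lborel \<Otimes>\<^sub>M lborel) (case_prod h)"
  proof (rule lborel_pair.Fubini_integrable)
    show "case_prod h \<in> borel_measurable (lborel \<Otimes>\<^sub>M lborel)"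
      using hm by (simp add: lborel_prod split_beta')
    have "integrable lborel (\<lambda>w. 3 / pi\<^sup>2 * norm (of_real (kerJ A l w) * dgauss z w))"
      by (intro integrable_mult_right integrable_norm J)
    thus "integrable lborel (\<lambda>w. LINT p|lborel. norm (case_prod h (w, p)))"
      using Jpos by (simp add: hint(3) norm_mult mult.assoc)
    show "AE w in lborel. integrable lborel (\<lambda>p. case_prod h (w, p))"
      using hint(1) by simp
  qed
  \<comment> \<open>Two factors sqrt pi / 2 of the moments, divided by the scales ((2 pi / 3) (pi /
    2)) powr (3/2). The quotient of 3 / pi^2, coming from the rates, by \<open>c\<close> is the 4 /
    sqrt 3 of the statement.\<close>
  define c where "c = 3 * sqrt 3 / (4 * pi\<^sup>2)"
  have c0: "c \<noteq> 0" by (simp add: c_def)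
  have hE: "(LINT w|lborel. h w p) = of_real c * eichler_term z b l p" for p
  proof (cases "fst p > 0 \<and> snd p > 0")
    case False
    thus ?thesis by (auto simp: h_def k_def eichler_term_def)
  next
    case True
    define s t where "s = fst p" and "t = snd p"
    have st: "s > 0" "t > 0" using True by (auto simp: s_def t_def)
    define S T where "S = of_real s + z" and "T = of_real (s + t) + z"
    have ST: "Re S > 0" "Re T > 0" "S \<noteq> 0" "T \<noteq> 0" using st z by (auto simp: S_def T_def complex_eq_iff)
    define e where "e = exp (- 2 * pi * (l\<^sup>2 * (s + t) / 4 + b\<^sup>2 * s / 3))"
    have cS: "Re (of_real (2 * pi / 3) * S) > 0" "Re (of_real (pi / 2) * T) > 0" using ST by auto
    have heq: "h w p = of_real e * ((of_real ((fst w)\<^sup>2) * exp (- (of_real (2 * pi / 3) * S) * of_real ((fst w)\<^sup>2)))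
       * (of_real ((snd w)\<^sup>2) * exp (- (of_real (pi / 2) * T) * of_real ((snd w)\<^sup>2))))" for w
    proof -
      have "k w p = exp (- (\<beta> w * s)) * exp (- (\<alpha> w * t))"
        using st by (simp add: k_def s_def[symmetric] t_def[symmetric])
      also have "\<dots> = exp (- (\<beta> w * s) - \<alpha> w * t)" by (simp flip: exp_add)
      finally have k: "k w p = exp (- (\<beta> w * s) - \<alpha> w * t)" .
      have "of_real (exp (- (\<beta> w * s) - \<alpha> w * t)) * dgauss z w =
         exp (of_real (- (\<beta> w * s) - \<alpha> w * t) + (- (2 / 3) * of_real pi * z * of_real ((fst w)\<^sup>2 + 3 / 4 * (snd w)\<^sup>2)))"
        by (simp only: dgauss_def exp_add exp_of_real)
      also have "of_real (- (\<beta> w * s) - \<alpha> w * t) + (- (2 / 3) * of_real pi * z * of_real ((fst w)\<^sup>2 + 3 / 4 * (snd w)\<^sup>2))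
         = of_real (- 2 * pi * (l\<^sup>2 * (s + t) / 4 + b\<^sup>2 * s / 3)) + (- (of_real (2 * pi / 3) * S) * of_real ((fst w)\<^sup>2)
           + - (of_real (pi / 2) * T) * of_real ((snd w)\<^sup>2))"
        by (simp add: \<alpha>_def \<beta>_def A S_def T_def field_simps)
      finally have "of_real (exp (- (\<beta> w * s) - \<alpha> w * t)) * dgauss z w =
        of_real e * (exp (- (of_real (2 * pi / 3) * S) * of_real ((fst w)\<^sup>2)) * exp (- (of_real (pi / 2) * T) * of_real ((snd w)\<^sup>2)))"
        by (simp only: exp_add exp_of_real e_def)
      moreover have "X * Y * x * g = q * ((X * E) * (Y * F))" if "x * g = q * (E * F)" for X Y x g q E F :: complex
      proof -
        have "X * Y * x * g = X * Y * (x * g)" by (simp only: mult.assoc)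
        also have "\<dots> = q * ((X * E) * (Y * F))" unfolding that by (simp only: mult_ac)
        finally show ?thesis .
      qed
      ultimately show ?thesis unfolding h_def k of_real_mult by blast
    qed
    note iS = integrable_complex_gaussian_moment[OF cS(1), of 1, unfolded mult_1_right]
    note iT = integrable_complex_gaussian_moment[OF cS(2), of 1, unfolded mult_1_right]
    have "(LINT w|lborel. h w p) = of_real e *
       ((of_real (sqrt pi / 2) / (of_real (2 * pi / 3) * S) powr (3/2)) * (of_real (sqrt pi / 2) / (of_real (pi / 2) * T) powr (3/2)))"
      unfolding heq integral_mult_right_zero
      by (subst integral_lborel_pair_mult[OF iS iT]) (simp only: complex_gaussian_moment[OF cS(1)] complex_gaussian_moment[OF cS(2)])
    also have "\<dots> = of_real e * (of_real (sqrt pi / 2 * (sqrt pi / 2) / ((2 * pi / 3) powr (3/2) * (pi / 2) powr (3/2))) / (S powr (3/2) * T powr (3/2)))"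
    proof -
      have "complex_of_real (sqrt pi) * complex_of_real (sqrt pi) = of_real pi" by (simp flip: of_real_mult)
      thus ?thesis using ST by (subst (1 2) powr_three_halves_scale) (auto simp: mult_ac)
    qed
    also have "sqrt pi / 2 * (sqrt pi / 2) / ((2 * pi / 3) powr (3/2) * (pi / 2) powr (3/2)) = c"
    proof -
      have "(2 * pi / 3) powr (3/2) * (pi / 2) powr (3/2) = (2 * pi / 3 * (pi / 2)) powr (3/2)"
        by (rule powr_mult[symmetric]) 
      also have "2 * pi / 3 * (pi / 2) = pi\<^sup>2 / 3" by (simp add: power2_eq_square)
      also have "(pi\<^sup>2 / 3) powr (3/2) = (pi\<^sup>2 / 3) powr (1 + 1/2)" by simp
      also have "\<dots> = pi\<^sup>2 / 3 * (pi / sqrt 3)"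
        by (subst powr_add) (simp add: powr_half_sqrt real_sqrt_divide)
      finally show ?thesis by (simp add: c_def field_simps power2_eq_square)
    qed
    finally have "(LINT w|lborel. h w p) = of_real e * (of_real c / (S powr (3/2) * T powr (3/2)))" .
    moreover have "eichler_term z b l p = of_real e / (T powr (3/2) * S powr (3/2))"
      using st by (simp add: eichler_term_def s_def[symmetric] t_def[symmetric] e_def S_def T_def)
    ultimately show ?thesis by (simp add: mult_ac)
  qed
  have "integrable lborel (\<lambda>p. of_real c * eichler_term z b l p)"
    using lborel_pair.integrable_snd[OF H] by (simp only: hE)
  hence "integrable lborel (\<lambda>p. 1 / of_real c * (of_real c * eichler_term z b l p))"
    by (rule integrable_mult_right)
  moreover have "1 / of_real c * (of_real c * u) = u" for u :: complex using c0 by simp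
  ultimately show "integrable lborel (eichler_term z b l)" by (simp only:)
  have "of_real c * (LINT p|lborel. eichler_term z b l p) = (LINT p|lborel. LINT w|lborel. h w p)"
    by (simp only: hE integral_mult_right_zero)
  also have "\<dots> = (LINT w|lborel. LINT p|lborel. h w p)"
    by (rule lborel_pair.Fubini_integral[OF H])
  also have "\<dots> = of_real (3 / pi\<^sup>2) * intJ z A l"
    by (simp only: hint(2) integral_mult_right_zero intJ_def)
  also have "\<dots> = of_real c * (of_real (4 / sqrt 3) * intJ z A l)"
  proof -
    have "3 / pi\<^sup>2 = c * (4 / sqrt 3)" by (simp add: c_def)
    thus ?thesis by (simp only: of_real_mult mult.assoc)
  qed
  finally show "(LINT p|lborel. eichler_term z b l p) = of_real (4 / sqrt 3) * intJ z A l"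
    using c0 by (subst (asm) mult_left_cancel) auto
qed

section \<open>Theta products as sums over the lattice\<close>

lemma sum_nat_abs_le_suminf:
  fixes f :: "nat \<Rightarrow> real"
  assumes f: "summable f" "\<And>n. f n \<ge> 0" and A: "finite A"
  shows "(\<Sum>j\<in>A. f (nat \<bar>j\<bar>)) \<le> 2 * suminf f"
proof -
  have part: "(\<Sum>j\<in>B. f (nat \<bar>j\<bar>)) \<le> suminf f" if "finite B" "inj_on (\<lambda>j. nat \<bar>j\<bar>) B" for B
    using sum.reindex[OF that(2), of f] sum_le_suminf[OF f(1), of "(\<lambda>j. nat \<bar>j\<bar>) ` B"] that(1) f(2) by simp
  have "(\<Sum>j\<in>A. f (nat \<bar>j\<bar>)) = (\<Sum>j\<in>A \<inter> {0..}. f (nat \<bar>j\<bar>)) + (\<Sum>j\<in>A \<inter> {..<0}. f (nat \<bar>j\<bar>))"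
    using A by (subst sum.union_disjoint[symmetric]) (auto intro!: sum.cong)
  also have "\<dots> \<le> suminf f + suminf f"
    using A by (intro add_mono part) (auto simp: inj_on_def)
  finally show ?thesis by simp
qed

text \<open>This is 2 zeta(3/2): the index n = 0 contributes 0 because
  \<open>0 powr x = 0\<close>.\<close>

definition theta_const :: real where
  "theta_const = 2 * (\<Sum>n. real n powr (- 3 / 2))"

lemma theta_const_nonneg: "theta_const \<ge> 0"
  unfolding theta_const_def by (intro mult_nonneg_nonneg suminf_nonneg) (auto simp: summable_real_powr_iff)

text \<open>The exponent 3/4 lies strictly between 1/2 and 1: with u = s j^2 the bound is summable
  over j different from 0 and integrable in s near 0.\<close>

lemma exp_minus_le_powr:
  fixes u :: real
  assumes "u > 0"
  shows "exp (- u) \<le> u powr (- 3 / 4)"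
proof -
  have "u powr (3/4) \<le> exp u"
  proof (cases "u \<ge> 1")
    case True
    hence "u powr (3/4) \<le> u powr 1" by (intro powr_mono) auto
    also have "\<dots> \<le> exp u" using True exp_ge_add_one_self[of u] by (simp del: exp_ge_add_one_self)
    finally show ?thesis .
  next
    case False
    hence "u powr (3/4) \<le> 1 powr (3/4)" using assms by (intro powr_mono2) auto
    also have "\<dots> \<le> exp u" using assms by simp
    finally show ?thesis .
  qed
  hence "inverse (exp u) \<le> inverse (u powr (3/4))" using assms by (intro le_imp_inverse_le) auto
  thus ?thesis by (simp add: exp_minus powr_minus)
qed

lemma theta_partial_sum_le:
  assumes A: "finite A" and s: "s > 0"
  shows "(\<Sum>j\<in>A. exp (- (s * (real_of_int j)\<^sup>2))) \<le> 1 + theta_const * s powr (- 3 / 4)"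
proof -
  let ?f = "\<lambda>n. real n powr (- 3 / 2)"
  have sf: "summable ?f" by (simp add: summable_real_powr_iff)
  let ?g = "\<lambda>j::int. \<bar>real_of_int j\<bar> powr (- 3 / 2)"
  have le: "exp (- (s * (real_of_int j)\<^sup>2)) \<le> (if j = 0 then 1 else 0) + s powr (- 3 / 4) * ?g j" for j
  proof (cases "j = 0")
    case False
    have "exp (- (s * (real_of_int j)\<^sup>2)) \<le> (s * (real_of_int j)\<^sup>2) powr (- 3 / 4)"
      using s False by (intro exp_minus_le_powr) auto
    also have "\<dots> = s powr (- 3 / 4) * ((real_of_int j)\<^sup>2) powr (- 3 / 4)"
      using s by (intro powr_mult)
    also have "((real_of_int j)\<^sup>2) powr (- 3 / 4) = (\<bar>real_of_int j\<bar> powr 2) powr (- 3 / 4)"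
      using False by simp
    also have "\<dots> = ?g j" by (simp only: powr_powr) simp
    finally show ?thesis using False by simp
  qed simp
  have "(\<Sum>j\<in>A. exp (- (s * (real_of_int j)\<^sup>2))) \<le> (\<Sum>j\<in>A. (if j = 0 then 1 else 0) + s powr (- 3 / 4) * ?g j)"
    by (intro sum_mono le)
  also have "\<dots> = (\<Sum>j\<in>A. if j = 0 then 1 else 0) + s powr (- 3 / 4) * sum ?g A"
    by (simp add: sum.distrib sum_distrib_left)
  also have "\<dots> \<le> 1 + s powr (- 3 / 4) * theta_const"
  proof (intro add_mono mult_left_mono)
    show "(\<Sum>j\<in>A. if j = 0 then 1 else 0) \<le> (1::real)"
      using A by (simp add: sum.delta)
    show "sum ?g A \<le> theta_const"
      using sum_nat_abs_le_suminf[OF sf _ A] by (simp add: theta_const_def)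
  qed simp
  finally show ?thesis by (simp add: mult.commute)
qed

text \<open>The indices are the integers c + d n divided by d, so the partial sums are theta sums
  over finite sets of integers.\<close>

lemma theta_abs_summable:
  fixes c d :: int and \<tau> :: complex
  assumes d: "d > 0" and \<tau>: "Im \<tau> > 0"
  shows "(\<lambda>n::int. norm (exp (2 * of_real pi * \<i> * (of_real (of_int c / of_int d + of_int n))\<^sup>2 * \<tau>))) summable_on UNIV"
  unfolding Infinite_Sum.abs_summable_iff_bdd_above
proof (rule bdd_aboveI2)
  let ?s = "2 * pi * Im \<tau> / (of_int d)\<^sup>2"
  fix F :: "int set" assume F: "F \<in> {F. F \<subseteq> UNIV \<and> finite F}"
  have s: "?s > 0" using assms by simp
  have n: "norm (exp (2 * of_real pi * \<i> * (of_real (of_int c / of_int d + of_int n))\<^sup>2 * \<tau>)) = exp (- (?s * (real_of_int (c + d * n))\<^sup>2))" for n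
  proof -
    have "of_int c / of_int d + of_int n = real_of_int (c + d * n) / of_int d" using d by (simp add: field_simps)
    hence "- (?s * (real_of_int (c + d * n))\<^sup>2) = - (2 * pi * Im \<tau> * (of_int c / of_int d + of_int n)\<^sup>2)"
      by (simp only: power_divide) simp
    thus ?thesis by (simp add: norm_exp_eq_Re Re_power2 Im_power2 mult_ac flip: of_real_power of_real_add)
  qed
  have "inj_on (\<lambda>n. c + d * n) F" using d by (auto simp: inj_on_def)
  hence "(\<Sum>n\<in>F. exp (- (?s * (real_of_int (c + d * n))\<^sup>2))) = (\<Sum>j\<in>(\<lambda>n. c + d * n) ` F. exp (- (?s * (real_of_int j)\<^sup>2)))"
    by (simp add: sum.reindex del: of_int_add of_int_mult)
  also have "\<dots> \<le> 1 + theta_const * ?s powr (- 3 / 4)"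
    using F s by (intro theta_partial_sum_le) auto
  finally show "(\<Sum>n\<in>F. norm (exp (2 * of_real pi * \<i> * (of_real (of_int c / of_int d + of_int n))\<^sup>2 * \<tau>))) \<le> 1 + theta_const * ?s powr (- 3 / 4)"
    by (simp only: n)
qed

lemma jtheta_eq_infsum:
  "jtheta l \<tau> = (\<Sum>\<^sub>\<infinity>n::int. exp (2 * of_real pi * \<i> * (of_real (l + of_int n))\<^sup>2 * \<tau>))"
proof -
  have "{l + of_int n |n::int. True} = (\<lambda>n. l + of_int n) ` UNIV" by auto
  moreover have "inj (\<lambda>n::int. l + real_of_int n)" by (auto simp: inj_def)
  ultimately show ?thesis unfolding jtheta_def by (simp add: infsum_reindex o_def)
qed

lemma has_sum_product_abs:
  fixes f :: "'a \<Rightarrow> complex" and g :: "'b \<Rightarrow> complex"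
  assumes f: "(\<lambda>n. norm (f n)) summable_on UNIV" and g: "(\<lambda>n. norm (g n)) summable_on UNIV"
  shows "((\<lambda>p. f (fst p) * g (snd p)) has_sum (infsum f UNIV * infsum g UNIV)) UNIV"
proof -
  have "(\<lambda>p. norm (f (fst p) * g (snd p))) summable_on UNIV"
    unfolding Infinite_Sum.abs_summable_iff_bdd_above
  proof (rule bdd_aboveI2)
    fix F :: "('a \<times> 'b) set" assume F: "F \<in> {F. F \<subseteq> UNIV \<and> finite F}"
    have "(\<Sum>p\<in>F. norm (f (fst p) * g (snd p))) \<le> (\<Sum>p\<in>fst ` F \<times> snd ` F. norm (f (fst p) * g (snd p)))"
      using F by (intro sum_mono2 subset_fst_snd) auto
    also have "\<dots> = (\<Sum>x\<in>fst ` F. norm (f x)) * (\<Sum>y\<in>snd ` F. norm (g y))"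
      by (simp add: sum_product sum.cartesian_product norm_mult split_beta')
    also have "\<dots> \<le> infsum (\<lambda>x. norm (f x)) UNIV * infsum (\<lambda>y. norm (g y)) UNIV"
      using F f g by (intro mult_mono finite_sum_le_infsum infsum_nonneg sum_nonneg) auto
    finally show "(\<Sum>p\<in>F. norm (f (fst p) * g (snd p))) \<le> infsum (\<lambda>x. norm (f x)) UNIV * infsum (\<lambda>y. norm (g y)) UNIV" .
  qed
  hence s: "(\<lambda>(x, y). f x * g y) summable_on Sigma UNIV (\<lambda>_. UNIV)"
    by (simp add: Infinite_Sum.abs_summable_summable split_beta')
  have "infsum (\<lambda>(x, y). f x * g y) (Sigma UNIV (\<lambda>_. UNIV)) = infsum (\<lambda>x. infsum (\<lambda>y. f x * g y) UNIV) UNIV"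
    by (rule infsum_Sigma'_banach[OF s, symmetric])
  also have "\<dots> = infsum f UNIV * infsum g UNIV"
    using f g by (simp add: infsum_cmult_right infsum_cmult_left Infinite_Sum.abs_summable_summable)
  finally show ?thesis
    using has_sum_infsum[OF s] by (simp add: split_beta')
qed

text \<open>The summation index \<open>\<alpha>\<close> of the Eichler integral reappears as the
  parity of r2.\<close>

definition lat :: "nat \<Rightarrow> nat \<Rightarrow> (int \<times> int) set" where
  "lat \<nu> \<alpha> = {r. [fst r = snd r + int \<nu>] (mod 3) \<and> snd r mod 2 = int \<alpha>}"

text \<open>The theta indices are \<open>\<alpha>\<close>/2 + n = r2 / 2 and (2 \<open>\<nu>\<close>
  + 3 \<open>\<alpha>\<close>) / 6 + m = (r1 + r2 / 2) / 3. Solving for r yields the map at p = (n,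
  m).\<close>

lemma lat_bij:
  assumes "\<alpha> < 2"
  shows "bij_betw (\<lambda>p. (int \<nu> + int \<alpha> + 3 * snd p - fst p, int \<alpha> + 2 * fst p)) UNIV (lat \<nu> \<alpha>)"
proof (rule bij_betwI[where g = "\<lambda>r. (snd r div 2, (fst r - int \<nu> - int \<alpha> + snd r div 2) div 3)"])
  show "(\<lambda>p. (int \<nu> + int \<alpha> + 3 * snd p - fst p, int \<alpha> + 2 * fst p)) \<in> UNIV \<rightarrow> lat \<nu> \<alpha>"
  proof
    fix p :: "int \<times> int"
    have "int \<nu> + int \<alpha> + 3 * snd p - fst p - (int \<alpha> + 2 * fst p + int \<nu>) = 3 * (snd p - fst p)" by simp
    hence "[int \<nu> + int \<alpha> + 3 * snd p - fst p = int \<alpha> + 2 * fst p + int \<nu>] (mod 3)"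
      by (metis cong_iff_dvd_diff dvd_triv_left)
    thus "(int \<nu> + int \<alpha> + 3 * snd p - fst p, int \<alpha> + 2 * fst p) \<in> lat \<nu> \<alpha>"
      using assms by (simp add: lat_def)
  qed
  show "(snd (int \<nu> + int \<alpha> + 3 * snd p - fst p, int \<alpha> + 2 * fst p) div 2,
     (fst (int \<nu> + int \<alpha> + 3 * snd p - fst p, int \<alpha> + 2 * fst p) - int \<nu> - int \<alpha> +
       snd (int \<nu> + int \<alpha> + 3 * snd p - fst p, int \<alpha> + 2 * fst p) div 2) div 3) = p" for p
    using assms by (cases p) simp
  fix r assume r: "r \<in> lat \<nu> \<alpha>"
  have 2: "snd r = int \<alpha> + 2 * (snd r div 2)"
    using r div_mult_mod_eq[of "snd r" 2] by (simp add: lat_def)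
  define q where "q = snd r div 2"
  have "3 dvd fst r - (snd r + int \<nu>)" using r by (simp add: lat_def cong_iff_dvd_diff)
  then obtain m where "fst r - (snd r + int \<nu>) = 3 * m" by auto
  hence m: "fst r = int \<nu> + int \<alpha> + 2 * q + 3 * m" and c: "snd r = int \<alpha> + 2 * q"
    using 2 by (simp_all add: q_def)
  have "fst r - int \<nu> - int \<alpha> + q = 3 * (q + m)" using m by simp
  hence "(fst r - int \<nu> - int \<alpha> + q) div 3 = q + m" by simp
  thus "(int \<nu> + int \<alpha> + 3 * snd (snd r div 2, (fst r - int \<nu> - int \<alpha> + snd r div 2) div 3) -
       fst (snd r div 2, (fst r - int \<nu> - int \<alpha> + snd r div 2) div 3),
      int \<alpha> + 2 * fst (snd r div 2, (fst r - int \<nu> - int \<alpha> + snd r div 2) div 3)) = r"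
    unfolding q_def[symmetric] fst_conv snd_conv by (simp add: prod_eq_iff m c)
qed simp

text \<open>For w1 = w2 = w the exponent is 2 pi i Q(r) w / 3, which is how the common real part of
  the two half-lines produces the root of unity.\<close>

definition lat_exp :: "complex \<Rightarrow> complex \<Rightarrow> int \<times> int \<Rightarrow> complex" where
  "lat_exp w1 w2 r = exp (2 * of_real pi * \<i> *
     ((of_int (snd r))\<^sup>2 / 4 * w2 + (of_int (fst r) + of_int (snd r) / 2)\<^sup>2 / 3 * w1))"

lemma theta_product_has_sum:
  assumes \<alpha>: "\<alpha> < 2" and w: "Im w1 > 0" "Im w2 > 0"
  shows "(lat_exp w1 w2 has_sum (jtheta (real \<alpha> / 2) w2 * jtheta ((2 * real \<nu> + 3 * real \<alpha>) / 6) (3 * w1))) (lat \<nu> \<alpha>)"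
proof -
  let ?f = "\<lambda>n::int. exp (2 * of_real pi * \<i> * (of_real (real \<alpha> / 2 + of_int n))\<^sup>2 * w2)"
  let ?g = "\<lambda>n::int. exp (2 * of_real pi * \<i> * (of_real ((2 * real \<nu> + 3 * real \<alpha>) / 6 + of_int n))\<^sup>2 * (3 * w1))"
  have "(\<lambda>n. norm (?f n)) summable_on UNIV" using theta_abs_summable[of 2 w2 "int \<alpha>"] w by simp
  moreover have "(\<lambda>n. norm (?g n)) summable_on UNIV" using theta_abs_summable[of 6 "3 * w1" "2 * int \<nu> + 3 * int \<alpha>"] w by simp
  ultimately have "((\<lambda>p. ?f (fst p) * ?g (snd p)) has_sum
     (jtheta (real \<alpha> / 2) w2 * jtheta ((2 * real \<nu> + 3 * real \<alpha>) / 6) (3 * w1))) UNIV"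
    unfolding jtheta_eq_infsum by (rule has_sum_product_abs)
  also have "(\<lambda>p. ?f (fst p) * ?g (snd p)) = (\<lambda>p. lat_exp w1 w2 (int \<nu> + int \<alpha> + 3 * snd p - fst p, int \<alpha> + 2 * fst p))"
  proof
    fix p :: "int \<times> int"
    have "2 * of_real pi * \<i> * (of_real (real \<alpha> / 2 + of_int (fst p)))\<^sup>2 * w2 +
       2 * of_real pi * \<i> * (of_real ((2 * real \<nu> + 3 * real \<alpha>) / 6 + of_int (snd p)))\<^sup>2 * (3 * w1) =
       2 * of_real pi * \<i> * ((of_int (int \<alpha> + 2 * fst p))\<^sup>2 / 4 * w2 +
         (of_int (int \<nu> + int \<alpha> + 3 * snd p - fst p) + of_int (int \<alpha> + 2 * fst p) / 2)\<^sup>2 / 3 * w1)"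
      by (simp add: field_simps power2_eq_square)
    thus "?f (fst p) * ?g (snd p) = lat_exp w1 w2 (int \<nu> + int \<alpha> + 3 * snd p - fst p, int \<alpha> + 2 * fst p)"
      unfolding lat_exp_def fst_conv snd_conv exp_add[symmetric] by (simp only:)
  qed
  finally show ?thesis
    by (simp only: has_sum_reindex_bij_betw[OF lat_bij[OF \<alpha>], where f = "lat_exp w1 w2"])
qed

lemma has_sum_exhaustion:
  fixes f :: "'a \<Rightarrow> complex"
  assumes "(f has_sum S) A" and fin: "\<And>N. finite (B N)" and sub: "\<And>N. B N \<subseteq> A"
    and exh: "\<And>x. x \<in> A \<Longrightarrow> eventually (\<lambda>N. x \<in> B N) sequentially"
  shows "(\<lambda>N. sum f (B N)) \<longlonglongrightarrow> S"
proof -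
  have "filterlim B (finite_subsets_at_top A) sequentially"
    unfolding filterlim_finite_subsets_at_top
  proof (intro allI impI)
    fix X assume X: "finite X \<and> X \<subseteq> A"
    hence "eventually (\<lambda>N. \<forall>x\<in>X. x \<in> B N) sequentially"
      by (intro eventually_ball_finite) (auto intro: exh)
    thus "eventually (\<lambda>N. finite (B N) \<and> X \<subseteq> B N \<and> B N \<subseteq> A) sequentially"
      by eventually_elim (use fin sub in auto)
  qed
  thus ?thesis using assms(1) unfolding has_sum_def by (rule filterlim_compose[rotated])
qed

section \<open>Majorants on the half-lines\<close>

text \<open>The theta bound is integrable at 0 and the inverse power at infinity; the two regimes
  are separated at t = 1.\<close>

lemma integrable_lborel_powr_dominator:
  assumes x: "x > 0" and C: "C \<ge> 0"
  shows "integrable lborel (\<lambda>t::real. indicator {0<..} t * ((1 + C * t powr (- 3 / 4)) * (t + x) powr (- 3 / 2)))"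
proof -
  have "(\<lambda>t::real. t powr (- 3 / 4)) absolutely_integrable_on {0<..1}"
    by (intro nonnegative_absolutely_integrable_1 integrable_on_powr_from_0') auto
  hence 1: "integrable lborel (\<lambda>t::real. indicator {0<..1} t * t powr (- 3 / 4))"
    by (simp add: set_integrable_def integrable_completion)
  have "(\<lambda>t::real. t powr (- 3 / 2)) absolutely_integrable_on {1..}"
    using has_integral_powr_to_inf[of "- 3 / 2" 1]
    by (intro nonnegative_absolutely_integrable_1) (auto simp: integrable_on_def)
  hence 2: "integrable lborel (\<lambda>t::real. indicator {1..} t * t powr (- 3 / 2))"
    by (simp add: set_integrable_def integrable_completion)
  show ?thesis
  proof (rule Bochner_Integration.integrable_bound)
    show "integrable lborel (\<lambda>t::real. (1 + C) * x powr (- 3 / 2) * (indicator {0<..1} t * t powr (- 3 / 4)) +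
       (1 + C) * (indicator {1..} t * t powr (- 3 / 2)))"
      by (intro Bochner_Integration.integrable_add integrable_mult_right 1 2)
    show "AE t in lborel. norm (indicator {0<..} t * ((1 + C * t powr (- 3 / 4)) * (t + x) powr (- 3 / 2)))
      \<le> norm ((1 + C) * x powr (- 3 / 2) * (indicator {0<..1} t * t powr (- 3 / 4)) + (1 + C) * (indicator {1..} t * t powr (- 3 / 2)))"
    proof (intro always_eventually allI)
      fix t :: real
      consider "t \<le> 0" | "0 < t" "t < 1" | "t \<ge> 1" by linarith
      thus "norm (indicator {0<..} t * ((1 + C * t powr (- 3 / 4)) * (t + x) powr (- 3 / 2)))
        \<le> norm ((1 + C) * x powr (- 3 / 2) * (indicator {0<..1} t * t powr (- 3 / 4)) + (1 + C) * (indicator {1..} t * t powr (- 3 / 2)))"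
      proof cases
        case 2
        have a: "1 \<le> t powr (- 3 / 4)" using 2 powr_mono2'[of "- 3 / 4" t 1] by simp
        have "(t + x) powr (- 3 / 2) \<le> x powr (- 3 / 2)" using 2 x by (intro powr_mono2') auto
        moreover have "1 + C * t powr (- 3 / 4) \<le> (1 + C) * t powr (- 3 / 4)" using a by (simp add: algebra_simps)
        ultimately have "(1 + C * t powr (- 3 / 4)) * (t + x) powr (- 3 / 2) \<le> ((1 + C) * t powr (- 3 / 4)) * x powr (- 3 / 2)"
          using C by (intro mult_mono) auto
        thus ?thesis using 2 C by (simp add: mult_ac)
      next
        case 3
        have a: "t powr (- 3 / 4) \<le> 1" using 3 powr_mono2'[of "- 3 / 4" 1 t] by simp
        have "(t + x) powr (- 3 / 2) \<le> t powr (- 3 / 2)" using 3 x by (intro powr_mono2') auto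
        moreover have "1 + C * t powr (- 3 / 4) \<le> 1 + C" using a C by (simp add: mult_left_le)
        ultimately have b: "(1 + C * t powr (- 3 / 4)) * (t + x) powr (- 3 / 2) \<le> (1 + C) * t powr (- 3 / 2)"
          using C by (intro mult_mono) auto
        let ?X = "(1 + C) * x powr (- 3 / 2) * (indicator {0<..1} t * t powr (- 3 / 4))"
        have "0 \<le> ?X" using C by simp
        moreover have "norm (?X + (1 + C) * (indicator {1..} t * t powr (- 3 / 2))) = ?X + (1 + C) * t powr (- 3 / 2)"
          using 3 C by simp
        moreover have "norm (indicator {0<..} t * ((1 + C * t powr (- 3 / 4)) * (t + x) powr (- 3 / 2))) = (1 + C * t powr (- 3 / 4)) * (t + x) powr (- 3 / 2)"
          using 3 C by simp
        ultimately show ?thesis using b by linarith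
      qed simp
    qed
  qed measurable
qed

lemma norm_powr_three_halves_ge:
  assumes "0 < y" "y \<le> Re u"
  shows "inverse (norm (u powr (3/2))) \<le> y powr (- 3 / 2)"
proof -
  have "norm (u powr (3/2)) = norm u powr (3/2)"
    by (subst norm_powr_real_powr') auto
  moreover have "y powr (3/2) \<le> norm u powr (3/2)"
    using assms complex_Re_le_cmod[of u] by (intro powr_mono2) auto
  ultimately have "inverse (norm (u powr (3/2))) \<le> inverse (y powr (3/2))"
    using assms by (intro le_imp_inverse_le) auto
  thus ?thesis by (simp add: powr_minus)
qed

text \<open>The numbers pi / 6 and pi / 2 are the coefficients of s (2 r1 + r2)^2 and of t r2^2 in
  the exponent of a lattice term.\<close>

definition eichler_dominator :: "complex \<Rightarrow> real \<times> real \<Rightarrow> real" where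
  "eichler_dominator z p =
    (indicator {0<..} (fst p) * ((1 + theta_const * (pi / 6) powr (- 3 / 4) * fst p powr (- 3 / 4)) * (fst p + Re z) powr (- 3 / 2))) *
    (indicator {0<..} (snd p) * ((1 + theta_const * (pi / 2) powr (- 3 / 4) * snd p powr (- 3 / 4)) * (snd p + Re z) powr (- 3 / 2)))"

lemma integrable_eichler_dominator: "Re z > 0 \<Longrightarrow> integrable lborel (eichler_dominator z)"
  unfolding eichler_dominator_def
  by (intro integrable_lborel_pair_mult integrable_lborel_powr_dominator mult_nonneg_nonneg theta_const_nonneg) auto

text \<open>The bound concerns sums of absolute values over arbitrary finite sets, so it serves all
  boxes and both parities at once.\<close>

lemma eichler_term_sum_le:
  assumes z: "Re z > 0" and F: "finite F"
  shows "(\<Sum>r\<in>F. norm (eichler_term z (real_of_int (fst r) + real_of_int (snd r) / 2) (real_of_int (snd r)) p)) \<le> eichler_dominator z p"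
proof (cases "fst p > 0 \<and> snd p > 0")
  case False
  thus ?thesis by (auto simp: eichler_term_def eichler_dominator_def)
next
  case True
  define s t where "s = fst p" and "t = snd p"
  have st: "s > 0" "t > 0" using True by (auto simp: s_def t_def)
  define S T where "S = inverse (norm ((of_real s + z) powr (3/2)))" and "T = inverse (norm ((of_real (s + t) + z) powr (3/2)))"
  have S: "0 \<le> S" "S \<le> (s + Re z) powr (- 3 / 2)"
    unfolding S_def by (simp, rule norm_powr_three_halves_ge) (use st z in auto)
  have T: "0 \<le> T" "T \<le> (t + Re z) powr (- 3 / 2)"
    unfolding T_def by (simp, rule norm_powr_three_halves_ge) (use st z in auto)
  \<comment> \<open>In the coordinates (2 r1 + r2, r2) the exponent is diagonal and integral.
    Enlarging the image to the product of its projections splits the sum into two theta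
    sums.\<close>
  define J where "J = (\<lambda>r :: int \<times> int. (2 * fst r + snd r, snd r))"
  have injJ: "inj_on J F" by (auto simp: inj_on_def J_def prod_eq_iff)
  let ?e = "\<lambda>c j. exp (- (c * (real_of_int j)\<^sup>2))"
  have term_eq: "norm (eichler_term z (real_of_int (fst r) + real_of_int (snd r) / 2) (real_of_int (snd r)) p)
     = ?e (pi / 6 * s) (fst (J r)) * ?e (pi / 2 * (s + t)) (snd (J r)) * (S * T)" for r
  proof -
    have "- 2 * pi * ((real_of_int (snd r))\<^sup>2 * (s + t) / 4 + (real_of_int (fst r) + real_of_int (snd r) / 2)\<^sup>2 * s / 3)
       = - (pi / 6 * s * (real_of_int (fst (J r)))\<^sup>2) + - (pi / 2 * (s + t) * (real_of_int (snd (J r)))\<^sup>2)"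
      unfolding J_def fst_conv snd_conv of_int_add of_int_mult of_int_numeral
      by (simp add: power2_eq_square algebra_simps add_divide_distrib)
    hence E: "exp (- 2 * pi * ((real_of_int (snd r))\<^sup>2 * (s + t) / 4 + (real_of_int (fst r) + real_of_int (snd r) / 2)\<^sup>2 * s / 3))
       = ?e (pi / 6 * s) (fst (J r)) * ?e (pi / 2 * (s + t)) (snd (J r))"
      by (simp only: exp_add)
    have N: "norm (of_real (indicator {0<..} s * indicator {0<..} t * X) / (U * V)) = X * (inverse (norm V) * inverse (norm U))"
      if "X \<ge> 0" for X :: real and U V :: complex
      using st that by (simp add: norm_divide norm_mult norm_inverse divide_inverse mult.commute)
    show ?thesis
      unfolding eichler_term_def s_def[symmetric] t_def[symmetric] S_def T_def E by (rule N) simp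
  qed
  have "(\<Sum>r\<in>F. ?e (pi / 6 * s) (fst (J r)) * ?e (pi / 2 * (s + t)) (snd (J r)))
     = (\<Sum>q\<in>J ` F. ?e (pi / 6 * s) (fst q) * ?e (pi / 2 * (s + t)) (snd q))"
    by (simp add: sum.reindex[OF injJ])
  also have "\<dots> \<le> (\<Sum>q\<in>fst ` J ` F \<times> snd ` J ` F. ?e (pi / 6 * s) (fst q) * ?e (pi / 2 * (s + t)) (snd q))"
    using F by (intro sum_mono2 subset_fst_snd) auto
  also have "\<dots> = (\<Sum>j\<in>fst ` J ` F. ?e (pi / 6 * s) j) * (\<Sum>j\<in>snd ` J ` F. ?e (pi / 2 * (s + t)) j)"
    by (simp add: sum_product sum.cartesian_product split_beta')
  also have "\<dots> \<le> (1 + theta_const * (pi / 6 * s) powr (- 3 / 4)) * (1 + theta_const * (pi / 2 * (s + t)) powr (- 3 / 4))"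
    using F st theta_const_nonneg by (intro mult_mono theta_partial_sum_le sum_nonneg add_nonneg_nonneg mult_nonneg_nonneg) auto
  \<comment> \<open>Replacing s + t by t makes the majorant a product of a function of s and one of
    t.\<close>
  also have "\<dots> \<le> (1 + theta_const * (pi / 6 * s) powr (- 3 / 4)) * (1 + theta_const * (pi / 2 * t) powr (- 3 / 4))"
    using st theta_const_nonneg by (intro mult_left_mono add_left_mono powr_mono2') auto
  finally have "(\<Sum>r\<in>F. ?e (pi / 6 * s) (fst (J r)) * ?e (pi / 2 * (s + t)) (snd (J r))) * (S * T)
     \<le> (1 + theta_const * (pi / 6 * s) powr (- 3 / 4)) * (1 + theta_const * (pi / 2 * t) powr (- 3 / 4))
       * ((s + Re z) powr (- 3 / 2) * (t + Re z) powr (- 3 / 2))"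
    using S T st theta_const_nonneg by (intro mult_mono mult_nonneg_nonneg add_nonneg_nonneg) auto
  also have "\<dots> = eichler_dominator z p"
    using st unfolding eichler_dominator_def s_def[symmetric] t_def[symmetric]
      powr_mult[of "pi / 6" s] powr_mult[of "pi / 2" t]
    by (simp add: mult_ac)
  finally show ?thesis by (simp only: term_eq sum_distrib_right)
qed

section \<open>The Eichler integral as a limit of box sums\<close>

definition ibox :: "int \<Rightarrow> nat \<Rightarrow> (int \<times> int) set" where
  "ibox L N = {- (L * int N)..L * int N} \<times> {- (L * int N)..L * int N}"

definition full_lat :: "nat \<Rightarrow> (int \<times> int) set" where
  "full_lat \<nu> = {r. [fst r = snd r + int \<nu>] (mod 3)}"

definition zeta_pow :: "int \<Rightarrow> int \<Rightarrow> int \<times> int \<Rightarrow> complex" where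
  "zeta_pow h k r = root_unity (3 * k) powi (- h * Qform r)"

lemma finite_ibox [simp]: "finite (ibox L N)"
  by (simp add: ibox_def)

lemma eventually_in_ibox:
  assumes "L > 0"
  shows "eventually (\<lambda>N. r \<in> ibox L N) sequentially"
  using eventually_ge_at_top[of "nat (max \<bar>fst r\<bar> \<bar>snd r\<bar>)"]
proof eventually_elim
  case (elim N)
  have "1 * int N \<le> L * int N" using assms by (intro mult_right_mono) auto
  thus ?case using elim by (cases r) (auto simp: ibox_def)
qed

lemma norm_zeta_pow [simp]: "norm (zeta_pow h k r) = 1"
  by (simp add: zeta_pow_def root_unity_def norm_power_int)

lemma zeta_pow_eq_exp:
  assumes "k > 0"
  shows "zeta_pow h k r = exp (2 * of_real pi * \<i> * (- (of_int h / of_int k)) * (of_int (Qform r) / 3))"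
proof -
  have "zeta_pow h k r = exp (of_int (- h * Qform r) * (2 * of_real pi * \<i> / of_int (3 * k)))"
    unfolding zeta_pow_def root_unity_def by (rule exp_power_int)
  also have "of_int (- h * Qform r) * (2 * of_real pi * \<i> / of_int (3 * k)) =
     2 * of_real pi * \<i> * (- (of_int h / of_int k)) * (of_int (Qform r) / 3 :: complex)"
    using assms by (simp add: mult_ac)
  finally show ?thesis .
qed

abbreviation lat_term :: "complex \<Rightarrow> int \<times> int \<Rightarrow> real \<times> real \<Rightarrow> complex" where
  "lat_term z r \<equiv> eichler_term z (real_of_int (fst r) + real_of_int (snd r) / 2) (real_of_int (snd r))"

lemma lat_exp_eq:
  assumes "k > 0"
  shows "lat_exp (- (of_int h / of_int k) + \<i> * of_real s) (- (of_int h / of_int k) + \<i> * of_real s + \<i> * of_real t) r =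
    zeta_pow h k r * of_real (exp (- 2 * pi * ((real_of_int (snd r))\<^sup>2 * (s + t) / 4 + (real_of_int (fst r) + real_of_int (snd r) / 2)\<^sup>2 * s / 3)))"
proof -
  define \<rho> :: complex where "\<rho> = - (of_int h / of_int k)"
  obtain a c where r: "r = (a, c)" by force
  have "2 * of_real pi * \<i> * ((of_int c)\<^sup>2 / 4 * (\<rho> + \<i> * of_real s + \<i> * of_real t) + (of_int a + of_int c / 2)\<^sup>2 / 3 * (\<rho> + \<i> * of_real s))
    = 2 * of_real pi * \<i> * \<rho> * (of_int (Qform r) / 3) +
      of_real (- 2 * pi * ((real_of_int c)\<^sup>2 * (s + t) / 4 + (real_of_int a + real_of_int c / 2)\<^sup>2 * s / 3))"
    by (simp add: r field_simps power2_eq_square)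
  thus ?thesis
    unfolding lat_exp_def zeta_pow_eq_exp[OF assms] \<rho>_def[symmetric] exp_of_real[symmetric] r fst_conv snd_conv
    by (simp only: exp_add)
qed

text \<open>For fixed s and t the box sums converge to the theta product; integration is justified
  by the common majorant. The minus sign is i times i, one factor from each of the two vertical
  half-lines.\<close>

lemma Eichler2_summand_limit:
  fixes h k :: int and z :: complex
  assumes k: "k > 0" and z: "Re z > 0" and \<alpha>: "\<alpha> < 2"
  defines "\<rho> \<equiv> - (of_int h / of_int k) :: complex"
  shows "(\<lambda>N. \<Sum>r\<in>ibox (3 * k) N \<inter> lat \<nu> \<alpha>. zeta_pow h k r * (of_real (4 / sqrt 3) * intJ z (real_of_int (Qform r)) (real_of_int (snd r))))
    \<longlonglongrightarrow> - integral_to_i_infinity \<rho> (\<lambda>w1. integral_to_i_infinity w1 (\<lambda>w2.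
            jtheta (real \<alpha> / 2) w2 * jtheta ((2 * real \<nu> + 3 * real \<alpha>) / 6) (3 * w1)
            / ((- \<i> * (w2 + (of_int h / of_int k + \<i> * z))) powr (3/2) * (- \<i> * (w1 + (of_int h / of_int k + \<i> * z))) powr (3/2))))"
proof -
  define F where "F = (\<lambda>w1 w2. jtheta (real \<alpha> / 2) w2 * jtheta ((2 * real \<nu> + 3 * real \<alpha>) / 6) (3 * w1)
            / ((- \<i> * (w2 + (of_int h / of_int k + \<i> * z))) powr (3/2) * (- \<i> * (w1 + (of_int h / of_int k + \<i> * z))) powr (3/2)))"
  define G where "G = (\<lambda>p :: real \<times> real. (indicator {0<..} (fst p) * indicator {0<..} (snd p) :: real) *\<^sub>R
     F (\<rho> + \<i> * of_real (fst p)) (\<rho> + \<i> * of_real (fst p) + \<i> * of_real (snd p)))"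
  define S where "S = (\<lambda>N p. \<Sum>r\<in>ibox (3 * k) N \<inter> lat \<nu> \<alpha>. zeta_pow h k r * lat_term z r p)"
  have conv: "(\<lambda>N. S N p) \<longlonglongrightarrow> G p" for p
  proof (cases "fst p > 0 \<and> snd p > 0")
    case False
    thus ?thesis by (auto simp: S_def G_def eichler_term_def)
  next
    case True
    define s t where "s = fst p" and "t = snd p"
    have st: "s > 0" "t > 0" using True by (auto simp: s_def t_def)
    define w1 w2 where "w1 = \<rho> + \<i> * of_real s" and "w2 = \<rho> + \<i> * of_real s + \<i> * of_real t"
    have Im: "Im w1 > 0" "Im w2 > 0" using st by (simp_all add: w1_def w2_def \<rho>_def)
    have "(\<lambda>N. sum (lat_exp w1 w2) (ibox (3 * k) N \<inter> lat \<nu> \<alpha>)) \<longlonglongrightarrow>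
       jtheta (real \<alpha> / 2) w2 * jtheta ((2 * real \<nu> + 3 * real \<alpha>) / 6) (3 * w1)"
      by (rule has_sum_exhaustion[OF theta_product_has_sum[OF \<alpha> Im]])
         (use eventually_in_ibox[of "3 * k"] k in auto)
    hence lim: "(\<lambda>N. sum (lat_exp w1 w2) (ibox (3 * k) N \<inter> lat \<nu> \<alpha>) / ((of_real (s + t) + z) powr (3/2) * (of_real s + z) powr (3/2))) \<longlonglongrightarrow>
       jtheta (real \<alpha> / 2) w2 * jtheta ((2 * real \<nu> + 3 * real \<alpha>) / 6) (3 * w1) / ((of_real (s + t) + z) powr (3/2) * (of_real s + z) powr (3/2))"
      unfolding divide_inverse by (intro tendsto_mult tendsto_const)
    have "- \<i> * (w2 + (of_int h / of_int k + \<i> * z)) = of_real (s + t) + z" "- \<i> * (w1 + (of_int h / of_int k + \<i> * z)) = of_real s + z"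
      by (simp_all add: w1_def w2_def \<rho>_def algebra_simps)
    moreover have "G p = F w1 w2"
      using st unfolding G_def s_def[symmetric] t_def[symmetric] w1_def w2_def by simp
    ultimately have "G p = jtheta (real \<alpha> / 2) w2 * jtheta ((2 * real \<nu> + 3 * real \<alpha>) / 6) (3 * w1) / ((of_real (s + t) + z) powr (3/2) * (of_real s + z) powr (3/2))"
      unfolding F_def by (simp only:)
    moreover have "S N p = sum (lat_exp w1 w2) (ibox (3 * k) N \<inter> lat \<nu> \<alpha>) / ((of_real (s + t) + z) powr (3/2) * (of_real s + z) powr (3/2))" for N
      unfolding S_def sum_divide_distrib w1_def w2_def \<rho>_def lat_exp_eq[OF k]
      using st by (intro sum.cong refl) (simp add: eichler_term_def s_def[symmetric] t_def[symmetric])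
    ultimately show ?thesis using lim by simp
  qed
  have S_meas: "S N \<in> borel_measurable lborel" for N
    unfolding S_def using eichler_term_integral(1)[OF z refl]
    by (auto intro!: borel_measurable_sum borel_measurable_times dest: borel_measurable_integrable)
  \<comment> \<open>The theta quotient inherits measurability from the finite sums that converge to
    it.\<close>
  have G_meas: "G \<in> borel_measurable lborel"
    by (rule borel_measurable_LIMSEQ_metric[of S, OF S_meas]) (rule conv)
  have bound: "norm (S N p) \<le> eichler_dominator z p" for N p
  proof -
    have "norm (S N p) \<le> (\<Sum>r\<in>ibox (3 * k) N \<inter> lat \<nu> \<alpha>. norm (lat_term z r p))"
      unfolding S_def by (rule order.trans[OF norm_sum]) (simp add: norm_mult)
    also have "\<dots> \<le> eichler_dominator z p"
      by (rule eichler_term_sum_le[OF z]) simp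
    finally show ?thesis .
  qed
  have G_int: "integrable lborel G"
    by (rule integrable_dominated_convergence[where s = S, OF G_meas S_meas integrable_eichler_dominator[OF z]])
       (use conv bound in auto)
  have "(\<lambda>N. LINT p|lborel. S N p) \<longlonglongrightarrow> (LINT p|lborel. G p)"
    by (rule integral_dominated_convergence[OF G_meas S_meas integrable_eichler_dominator[OF z]])
       (use conv bound in auto)
  moreover have "(LINT p|lborel. S N p) = (\<Sum>r\<in>ibox (3 * k) N \<inter> lat \<nu> \<alpha>. zeta_pow h k r * (of_real (4 / sqrt 3) * intJ z (real_of_int (Qform r)) (real_of_int (snd r))))" for N
  proof -
    have Q: "real_of_int (Qform r) = (real_of_int (fst r) + real_of_int (snd r) / 2)\<^sup>2 + 3 / 4 * (real_of_int (snd r))\<^sup>2" for r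
      by (cases r) (simp add: power2_eq_square field_simps)
    show ?thesis unfolding S_def
      by (subst Bochner_Integration.integral_sum)
         (auto intro!: sum.cong integrable_mult_right eichler_term_integral(1)[OF z refl] simp: eichler_term_integral(2)[OF z Q])
  qed
  moreover have "(LINT p|lborel. G p) = - integral_to_i_infinity \<rho> (\<lambda>w1. integral_to_i_infinity w1 (F w1))"
  proof -
    have "integral_to_i_infinity \<rho> (\<lambda>w1. integral_to_i_infinity w1 (F w1)) =
      \<i> * (LINT s|lborel. indicator {0<..} s *\<^sub>R (\<i> * (LINT t|lborel. indicator {0<..} t *\<^sub>R F (\<rho> + \<i> * of_real s) (\<rho> + \<i> * of_real s + \<i> * of_real t))))"
      unfolding integral_to_i_infinity_def set_lebesgue_integral_def ..
    also have "\<dots> = \<i> * (LINT s|lborel. \<i> * (LINT t|lborel. G (s, t)))"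
    proof -
      have "indicator {0<..} s *\<^sub>R (\<i> * (LINT t|lborel. indicator {0<..} t *\<^sub>R F (\<rho> + \<i> * of_real s) (\<rho> + \<i> * of_real s + \<i> * of_real t)))
         = \<i> * (LINT t|lborel. G (s, t))" for s :: real
        by (simp add: G_def indicator_def)
      thus ?thesis by (simp only:)
    qed
    also have "\<dots> = - (LINT s|lborel. LINT t|lborel. G (s, t))"
      by (simp add: mult.assoc[symmetric])
    also have "(LINT s|lborel. LINT t|lborel. G (s, t)) = (LINT p|lborel. G p)"
      using lborel_pair.integral_fst'[of G] G_int by (simp add: lborel_prod)
    finally show ?thesis by simp
  qed
  ultimately show ?thesis by (simp add: F_def)
qed

lemma Eichler2_limit:
  assumes k: "k > 0" and z: "Re z > 0"
  shows "(\<lambda>N. \<Sum>r\<in>ibox (3 * k) N \<inter> full_lat \<nu>. zeta_pow h k r * (of_real (4 / sqrt 3) * intJ z (real_of_int (Qform r)) (real_of_int (snd r))))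
    \<longlonglongrightarrow> - Eichler2 \<nu> (- (of_int h / of_int k)) (of_int h / of_int k + \<i> * z)"
proof -
  let ?f = "\<lambda>r. zeta_pow h k r * (of_real (4 / sqrt 3) * intJ z (real_of_int (Qform r)) (real_of_int (snd r)))"
  have rho: "of_rat (- (of_int h / of_int k)) = - (of_int h / of_int k :: complex)"
    by (simp add: of_rat_divide of_rat_minus)
  have E: "- Eichler2 \<nu> (- (of_int h / of_int k)) (of_int h / of_int k + \<i> * z) =
    (\<Sum>\<alpha>\<in>{0, 1::nat}. - integral_to_i_infinity (- (of_int h / of_int k)) (\<lambda>w1. integral_to_i_infinity w1 (\<lambda>w2.
            jtheta (real \<alpha> / 2) w2 * jtheta ((2 * real \<nu> + 3 * real \<alpha>) / 6) (3 * w1)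
            / ((- \<i> * (w2 + (of_int h / of_int k + \<i> * z))) powr (3/2) * (- \<i> * (w1 + (of_int h / of_int k + \<i> * z))) powr (3/2)))))"
    unfolding Eichler2_def rho by (simp only: sum_negf)
  have "(\<lambda>N. \<Sum>\<alpha>\<in>{0, 1::nat}. sum ?f (ibox (3 * k) N \<inter> lat \<nu> \<alpha>)) \<longlonglongrightarrow> - Eichler2 \<nu> (- (of_int h / of_int k)) (of_int h / of_int k + \<i> * z)"
    unfolding E by (intro tendsto_sum Eichler2_summand_limit k z) auto
  moreover have "(\<Sum>\<alpha>\<in>{0, 1::nat}. sum ?f (ibox (3 * k) N \<inter> lat \<nu> \<alpha>)) = sum ?f (ibox (3 * k) N \<inter> full_lat \<nu>)" for N
  proof -
    have "full_lat \<nu> = lat \<nu> 0 \<union> lat \<nu> 1" by (auto simp: full_lat_def lat_def)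
    moreover have "lat \<nu> 0 \<inter> lat \<nu> 1 = {}" by (auto simp: lat_def)
    ultimately have "sum ?f (ibox (3 * k) N \<inter> full_lat \<nu>) = sum ?f (ibox (3 * k) N \<inter> lat \<nu> 0) + sum ?f (ibox (3 * k) N \<inter> lat \<nu> 1)"
      by (simp only: Int_Un_distrib) (intro sum.union_disjoint, auto)
    thus ?thesis by simp
  qed
  ultimately show ?thesis by simp
qed

subsection \<open>Residue class sums of the rational kernels\<close>

text \<open>This is 2 zeta(2). As \<open>1 / 0 = 0\<close>, the index 0 is harmless both here and in
  the finite sums bounded by it.\<close>

definition inverse_square_const :: real where
  "inverse_square_const = 2 * (\<Sum>n. 1 / (real n)\<^sup>2)"

lemma sum_inverse_squares_le:
  assumes A: "finite A"
  shows "(\<Sum>j\<in>A. 1 / (real_of_int j)\<^sup>2) \<le> inverse_square_const"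
proof -
  have "summable (\<lambda>n. 1 / (real n)\<^sup>2)"
    using inverse_power_summable[of 2, where 'a = real] by (simp add: inverse_eq_divide)
  from sum_nat_abs_le_suminf[OF this _ A] show ?thesis by (simp add: inverse_square_const_def)
qed

lemma zero_in_residue_ball: "0 \<in> residue_ball L a N \<longleftrightarrow> a = 0" if "L > 0"
  using that by (auto simp: residue_ball_def)

section \<open>Finite cotangent sums and bounds uniform in the truncation\<close>

definition pole_sum :: "int \<Rightarrow> int \<Rightarrow> nat \<Rightarrow> real \<Rightarrow> complex" where
  "pole_sum L a N x = (\<Sum>r\<in>residue_ball L a N. 1 / (of_real x - \<i> * of_int r))"

text \<open>The index 0 is the only one whose pole lies on the real axis.\<close>

definition pole_sum_reg :: "int \<Rightarrow> int \<Rightarrow> nat \<Rightarrow> real \<Rightarrow> complex" where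
  "pole_sum_reg L a N x = (\<Sum>r\<in>residue_ball L a N - {0}. 1 / (of_real x - \<i> * of_int r))"

lemma pole_sum_eq:
  assumes "L > 0"
  shows "pole_sum L a N x = (if a = 0 then 1 / of_real x else 0) + pole_sum_reg L a N x"
proof (cases "a = 0")
  case True
  hence "0 \<in> residue_ball L a N" using assms by (simp add: zero_in_residue_ball)
  from sum.remove[OF finite_residue_ball this, of "\<lambda>r. 1 / (of_real x - \<i> * of_int r)"] True
  show ?thesis by (simp add: pole_sum_def pole_sum_reg_def)
next
  case False
  hence "0 \<notin> residue_ball L a N" using assms by (simp add: zero_in_residue_ball)
  thus ?thesis using False by (simp add: pole_sum_def pole_sum_reg_def)
qed

lemma Re_pole: "Re (1 / (of_real x - \<i> * of_int r)) = x / (x\<^sup>2 + (real_of_int r)\<^sup>2)"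
  by (simp add: Re_divide)

lemma Im_pole: "Im (1 / (of_real x - \<i> * of_int r)) = r / (x\<^sup>2 + (real_of_int r)\<^sup>2)"
  by (simp add: Im_divide)

lemma abs_le_norm_pole: "\<bar>real_of_int r\<bar> \<le> norm (of_real x - \<i> * of_int r :: complex)"
  using abs_Im_le_cmod[of "of_real x - \<i> * of_int r"] by simp

text \<open>The series is only conditionally convergent, so a termwise bound fails. Convergence at
  the base point x = 1 bounds all truncations there, and differences from the base point are
  dominated by |x - 1| times the sum of 1 / r^2.\<close>

lemma norm_pole_sum_reg_le:
  assumes k: "k > 0" and a: "0 \<le> a" "a < 3 * k"
  obtains B where "B \<ge> 0" "\<And>N x. norm (pole_sum_reg (3 * k) a N x) \<le> B * (1 + \<bar>x\<bar>)"
proof -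
  have "convergent (\<lambda>N. pole_sum (3 * k) a N 1)"
    unfolding pole_sum_def by (rule convergentI) (rule residue_ball_sum_tendsto[OF k a], simp)
  hence "Bseq (\<lambda>N. pole_sum (3 * k) a N 1)" by (rule convergent_imp_Bseq)
  then obtain K where K: "K > 0" "\<And>N. norm (pole_sum (3 * k) a N 1) \<le> K" by (auto elim: BseqE)
  have 1: "norm (pole_sum_reg (3 * k) a N 1) \<le> K + 1" for N
  proof -
    have "pole_sum_reg (3 * k) a N 1 = pole_sum (3 * k) a N 1 - (if a = 0 then 1 else 0)"
      using k by (simp add: pole_sum_eq)
    also have "norm \<dots> \<le> norm (pole_sum (3 * k) a N 1) + norm (if a = 0 then 1 else 0 :: complex)"
      by (rule norm_triangle_ineq4)
    also have "\<dots> \<le> K + 1" using K(2)[of N] by (intro add_mono) auto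
    finally show ?thesis .
  qed
  have 2: "norm (pole_sum_reg (3 * k) a N x - pole_sum_reg (3 * k) a N 1) \<le> \<bar>x - 1\<bar> * inverse_square_const" for N x
  proof -
    have "norm (1 / (of_real x - \<i> * of_int r) - 1 / (of_real 1 - \<i> * of_int r :: complex)) \<le> \<bar>x - 1\<bar> * (1 / (real_of_int r)\<^sup>2)"
      if "r \<noteq> 0" for r
    proof -
      let ?p = "of_real x - \<i> * of_int r :: complex" and ?q = "of_real 1 - \<i> * of_int r :: complex"
      have nz: "?p \<noteq> 0" "?q \<noteq> 0" using that by (auto simp: complex_eq_iff)
      have "1 / ?p - 1 / ?q = (?q - ?p) / (?p * ?q)" using nz by (simp add: field_simps)
      also have "norm \<dots> = \<bar>x - 1\<bar> / (norm ?p * norm ?q)"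
        by (simp add: norm_divide norm_mult flip: of_real_diff) (metis abs_minus_commute norm_of_real of_real_1 of_real_diff)
      also have "\<dots> \<le> \<bar>x - 1\<bar> / (\<bar>real_of_int r\<bar> * \<bar>real_of_int r\<bar>)"
        using that by (intro divide_left_mono mult_mono abs_le_norm_pole mult_pos_pos) (use nz in auto)
      finally show ?thesis by (simp add: power2_eq_square)
    qed
    hence "norm (pole_sum_reg (3 * k) a N x - pole_sum_reg (3 * k) a N 1)
      \<le> (\<Sum>r\<in>residue_ball (3 * k) a N - {0}. \<bar>x - 1\<bar> * (1 / (real_of_int r)\<^sup>2))"
      unfolding pole_sum_reg_def sum_subtractf[symmetric] by (intro sum_norm_le) auto
    also have "\<dots> \<le> \<bar>x - 1\<bar> * inverse_square_const"
      unfolding sum_distrib_left[symmetric] by (intro mult_left_mono sum_inverse_squares_le) auto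
    finally show ?thesis .
  qed
  have S0: "inverse_square_const \<ge> 0" using sum_inverse_squares_le[of "{}"] by simp
  show thesis
  proof (rule that[of "K + 1 + inverse_square_const"])
    show "norm (pole_sum_reg (3 * k) a N x) \<le> (K + 1 + inverse_square_const) * (1 + \<bar>x\<bar>)" for N x
    proof -
      have "norm (pole_sum_reg (3 * k) a N x) \<le> (K + 1) + \<bar>x - 1\<bar> * inverse_square_const"
        using norm_triangle_sub[of "pole_sum_reg (3 * k) a N x" "pole_sum_reg (3 * k) a N 1"] 1[of N] 2[of N x] by linarith
      also have "\<dots> \<le> (K + 1) * (1 + \<bar>x\<bar>) + (1 + \<bar>x\<bar>) * inverse_square_const"
        using K S0 by (intro add_mono mult_right_mono) (auto simp: mult_le_cancel_left1)
      finally show ?thesis by (simp add: algebra_simps)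
    qed
  qed (use K S0 in simp)
qed

text \<open>The factor x - y is what later cancels a denominator w1 or w2, and the factor 1 / c^2
  makes the bound summable over a residue class.\<close>

lemma cubic_over_quadratic_diff_le:
  fixes x y c :: real
  assumes c: "c \<noteq> 0"
  shows "\<bar>x ^ 3 / (x\<^sup>2 + c\<^sup>2) - y ^ 3 / (y\<^sup>2 + c\<^sup>2)\<bar> \<le> \<bar>x - y\<bar> * (3 * (x\<^sup>2 + y\<^sup>2)) * (1 / c\<^sup>2)"
proof -
  have c2: "c\<^sup>2 > 0" using c by simp
  define X Y where "X = x\<^sup>2 + c\<^sup>2" and "Y = y\<^sup>2 + c\<^sup>2"
  have X: "X > 0" "c\<^sup>2 \<le> X" "x\<^sup>2 \<le> X" and Y: "Y > 0" "c\<^sup>2 \<le> Y" "y\<^sup>2 \<le> Y"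
    using c2 by (auto simp: X_def Y_def add_nonneg_pos)
  have "x ^ 3 * Y - y ^ 3 * X = (x - y) * (x\<^sup>2 * y\<^sup>2 + c\<^sup>2 * (x\<^sup>2 + x * y + y\<^sup>2))"
    by (simp add: X_def Y_def power2_eq_square power3_eq_cube algebra_simps)
  hence "x ^ 3 / X - y ^ 3 / Y = (x - y) * ((x\<^sup>2 * y\<^sup>2 + c\<^sup>2 * (x\<^sup>2 + x * y + y\<^sup>2)) / (X * Y))"
    using X Y by (simp add: field_simps)
  moreover have "\<bar>(x\<^sup>2 * y\<^sup>2 + c\<^sup>2 * (x\<^sup>2 + x * y + y\<^sup>2)) / (X * Y)\<bar> \<le> 3 * (x\<^sup>2 + y\<^sup>2) * (1 / c\<^sup>2)"
  proof -
    have xy: "\<bar>x * y\<bar> \<le> x\<^sup>2 + y\<^sup>2"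
    proof -
      have "0 \<le> (\<bar>x\<bar> - \<bar>y\<bar>)\<^sup>2" by simp
      hence "2 * (\<bar>x\<bar> * \<bar>y\<bar>) \<le> x\<^sup>2 + y\<^sup>2" by (simp add: power2_diff)
      moreover have "\<bar>x\<bar> * \<bar>y\<bar> \<ge> 0" by simp
      ultimately show ?thesis unfolding abs_mult by linarith
    qed
    have "\<bar>x\<^sup>2 * y\<^sup>2 + c\<^sup>2 * (x\<^sup>2 + x * y + y\<^sup>2)\<bar> * c\<^sup>2 \<le> (3 * (x\<^sup>2 + y\<^sup>2)) * (X * Y)"
    proof -
      have "\<bar>x\<^sup>2 * y\<^sup>2 + c\<^sup>2 * (x\<^sup>2 + x * y + y\<^sup>2)\<bar> \<le> x\<^sup>2 * y\<^sup>2 + c\<^sup>2 * (2 * (x\<^sup>2 + y\<^sup>2))"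
      proof -
        have "\<bar>x\<^sup>2 + x * y + y\<^sup>2\<bar> \<le> 2 * (x\<^sup>2 + y\<^sup>2)" using xy by (auto simp: abs_if split: if_splits)
        hence "\<bar>c\<^sup>2 * (x\<^sup>2 + x * y + y\<^sup>2)\<bar> \<le> c\<^sup>2 * (2 * (x\<^sup>2 + y\<^sup>2))"
          unfolding abs_mult by (simp add: mult_left_mono)
        moreover have "\<bar>x\<^sup>2 * y\<^sup>2\<bar> = x\<^sup>2 * y\<^sup>2" by simp
        ultimately show ?thesis using abs_triangle_ineq[of "x\<^sup>2 * y\<^sup>2" "c\<^sup>2 * (x\<^sup>2 + x * y + y\<^sup>2)"] by linarith
      qed
      hence "\<bar>x\<^sup>2 * y\<^sup>2 + c\<^sup>2 * (x\<^sup>2 + x * y + y\<^sup>2)\<bar> * c\<^sup>2 \<le> (x\<^sup>2 * y\<^sup>2 + c\<^sup>2 * (2 * (x\<^sup>2 + y\<^sup>2))) * c\<^sup>2"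
        by (rule mult_right_mono) simp
      also have "\<dots> = x\<^sup>2 * (y\<^sup>2 * c\<^sup>2) + 2 * (x\<^sup>2 + y\<^sup>2) * (c\<^sup>2 * c\<^sup>2)" by (simp add: algebra_simps)
      also have "\<dots> \<le> (x\<^sup>2 + y\<^sup>2) * (X * Y) + 2 * (x\<^sup>2 + y\<^sup>2) * (X * Y)"
      proof (intro add_mono mult_mono[where c = "y\<^sup>2 * c\<^sup>2"] mult_mono[where c = "c\<^sup>2 * c\<^sup>2"])
        show "y\<^sup>2 * c\<^sup>2 \<le> X * Y" using mult_mono[OF Y(3) X(2)] Y X by (simp add: mult.commute)
        show "c\<^sup>2 * c\<^sup>2 \<le> X * Y" using mult_mono[OF X(2) Y(2)] Y X by simp
      qed (use X Y in auto)
      finally show ?thesis by (simp add: algebra_simps)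
    qed
    moreover have "n / D \<le> m * (1 / C)" if "n * C \<le> m * D" "D > 0" "C > 0" for n D m C :: real
      using that by (simp add: field_simps)
    moreover have XY: "X * Y > 0" using X Y by simp
    ultimately show ?thesis using c2 by (simp only: abs_divide abs_of_pos[OF XY])
  qed
  ultimately have "\<bar>x ^ 3 / X - y ^ 3 / Y\<bar> \<le> \<bar>x - y\<bar> * (3 * (x\<^sup>2 + y\<^sup>2) * (1 / c\<^sup>2))"
    by (simp only: abs_mult mult_left_mono abs_ge_zero)
  thus ?thesis by (simp add: X_def Y_def)
qed

lemma pole_sum_reg_cubic_diff_le:
  "\<bar>x\<^sup>2 * Re (pole_sum_reg L a N x) - y\<^sup>2 * Re (pole_sum_reg L a N y)\<bar> \<le> \<bar>x - y\<bar> * (3 * (x\<^sup>2 + y\<^sup>2)) * inverse_square_const"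
proof -
  have eq: "x\<^sup>2 * Re (pole_sum_reg L a N x) = (\<Sum>r\<in>residue_ball L a N - {0}. x ^ 3 / (x\<^sup>2 + (real_of_int r)\<^sup>2))" for x
    unfolding pole_sum_reg_def Re_sum Re_pole sum_distrib_left
    by (intro sum.cong refl) (simp add: power2_eq_square power3_eq_cube)
  have "\<bar>x\<^sup>2 * Re (pole_sum_reg L a N x) - y\<^sup>2 * Re (pole_sum_reg L a N y)\<bar> \<le>
     (\<Sum>r\<in>residue_ball L a N - {0}. \<bar>x - y\<bar> * (3 * (x\<^sup>2 + y\<^sup>2)) * (1 / (real_of_int r)\<^sup>2))"
    unfolding eq sum_subtractf[symmetric]
    by (rule order.trans[OF sum_abs]) (intro sum_mono cubic_over_quadratic_diff_le, auto)
  also have "\<dots> \<le> \<bar>x - y\<bar> * (3 * (x\<^sup>2 + y\<^sup>2)) * inverse_square_const"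
    unfolding sum_distrib_left[symmetric] by (intro mult_left_mono sum_inverse_squares_le) auto
  finally show ?thesis .
qed

section \<open>Sums over pairs of residue classes: limit and majorant\<close>

definition class_sum :: "int \<Rightarrow> int \<Rightarrow> int \<Rightarrow> nat \<Rightarrow> real \<times> real \<Rightarrow> real" where
  "class_sum L a c N w = (\<Sum>r\<in>residue_ball L a N \<times> residue_ball L c N. termC (real_of_int (fst r)) (real_of_int (snd r)) w)"

lemma class_sum_eq:
  assumes L: "L > 0"
  shows "class_sum L a c N (x, y) = (x\<^sup>2 + y\<^sup>2 + 4 * x * y) * Re (pole_sum L a N x * pole_sum L c N y)
    - (if a = 0 then (y + x / 2)\<^sup>2 / x * Re (pole_sum L c N (y + x / 2)) else 0)
    - (if c = 0 then (x + y / 2)\<^sup>2 / y * Re (pole_sum L a N (x + y / 2)) else 0)"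
proof -
  let ?A = "residue_ball L a N" and ?C = "residue_ball L c N"
  have t: "termC (real_of_int r) (real_of_int s) (x, y) =
    (x\<^sup>2 + y\<^sup>2 + 4 * x * y) * Re ((1 / (of_real x - \<i> * of_int r)) * (1 / (of_real y - \<i> * of_int s)))
    - (if r = 0 then (y + x / 2)\<^sup>2 / x * Re (1 / (of_real (y + x / 2) - \<i> * of_int s)) else 0)
    - (if s = 0 then (x + y / 2)\<^sup>2 / y * Re (1 / (of_real (x + y / 2) - \<i> * of_int r)) else 0)" for r s
  proof -
    have 1: "Re ((1 / (of_real x - \<i> * of_int r)) * (1 / (of_real y - \<i> * of_int s))) =
       (x * y - r * s) / ((x\<^sup>2 + (real_of_int r)\<^sup>2) * (y\<^sup>2 + (real_of_int s)\<^sup>2))"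
      unfolding times_complex.simps(1) Re_pole Im_pole by (simp add: diff_divide_distrib)
    show ?thesis unfolding 1 Re_pole termC_def fst_conv snd_conv
      by (simp add: power2_eq_square power3_eq_cube)
  qed
  have d: "(\<Sum>r\<in>?A. \<Sum>s\<in>?C. if r = 0 then (h s :: real) else 0) = (if a = 0 then sum h ?C else 0)" for h
  proof -
    have "(\<Sum>r\<in>?A. \<Sum>s\<in>?C. if r = 0 then h s else 0) = (\<Sum>r\<in>?A. if r = 0 then sum h ?C else 0)"
      by (intro sum.cong refl) simp
    thus ?thesis using L by (simp add: sum.delta' zero_in_residue_ball)
  qed
  have d': "(\<Sum>r\<in>?A. \<Sum>s\<in>?C. if s = 0 then (h r :: real) else 0) = (if c = 0 then sum h ?A else 0)" for h
    using L by (simp add: sum.delta' zero_in_residue_ball)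
  have "class_sum L a c N (x, y) = (\<Sum>r\<in>?A. \<Sum>s\<in>?C. termC (real_of_int r) (real_of_int s) (x, y))"
    by (simp add: class_sum_def sum.cartesian_product split_beta)
  moreover have "Re (pole_sum L a N x * pole_sum L c N y) =
     (\<Sum>r\<in>?A. \<Sum>s\<in>?C. Re ((1 / (of_real x - \<i> * of_int r)) * (1 / (of_real y - \<i> * of_int s))))"
    by (simp only: pole_sum_def sum_product Re_sum)
  ultimately show ?thesis
    by (simp only: t sum_subtractf d d' pole_sum_def Re_sum sum_distrib_left)
qed

text \<open>One formula for all four cases: \<open>f1\<close> vanishes for class 0, and each
  vanishing index switches on its own subtraction. For c = 0 it treats the second variable as the
  singular one, unlike \<open>g2_formula\<close>.\<close>

definition gker :: "int \<Rightarrow> int \<Rightarrow> int \<Rightarrow> real \<times> real \<Rightarrow> real" where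
  "gker k a c w =
     ((fst w)\<^sup>2 + (snd w)\<^sup>2 + 4 * fst w * snd w)
       * (g1 (of_int a / of_int (3 * k)) (fst w / of_int k) * g1 (of_int c / of_int (3 * k)) (snd w / of_int k)
          - f1 (of_int a / of_int (3 * k)) (fst w / of_int k) * f1 (of_int c / of_int (3 * k)) (snd w / of_int k))
     - (if a = 0 then 3 * of_int k / (pi * fst w) * (snd w + fst w / 2)\<^sup>2 * g1 (of_int c / of_int (3 * k)) ((snd w + fst w / 2) / of_int k) else 0)
     - (if c = 0 then 3 * of_int k / (pi * snd w) * (fst w + snd w / 2)\<^sup>2 * g1 (of_int a / of_int (3 * k)) ((fst w + snd w / 2) / of_int k) else 0)"

lemma g1_f1_measurable [measurable]: "g1 c \<in> borel_measurable borel" "f1 c \<in> borel_measurable borel"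
  unfolding g1_def[abs_def] f1_def[abs_def] sinh_def cosh_def by measurable

lemma gker_measurable [measurable]: "gker k a c \<in> borel_measurable borel"
  unfolding gker_def[abs_def] by measurable

lemma class_sum_measurable [measurable]: "class_sum L a c N \<in> borel_measurable borel"
  unfolding class_sum_def[abs_def] by measurable

text \<open>Each pole sum tends to p = pi / (3k) times a scaled cotangent. A subtraction contains
  only one pole sum, but its factor 3k / pi = 1 / p restores the common p^2. Regular points keep all
  four arguments away from 0, the pole of class 0.\<close>

lemma class_sum_tendsto:
  assumes w: "w \<in> g2_regular" and k: "k > 0" and a: "0 \<le> a" "a < 3 * k" and c: "0 \<le> c" "c < 3 * k"
  shows "(\<lambda>N. class_sum (3 * k) a c N w) \<longlonglongrightarrow> (pi / of_int (3 * k))\<^sup>2 * gker k a c w"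
proof -
  obtain x y where xy: "w = (x, y)" by force
  have nz: "x \<noteq> 0" "y \<noteq> 0" "y + x / 2 \<noteq> 0" "x + y / 2 \<noteq> 0" using w by (auto simp: g2_regular_def xy)
  define G where "G = (\<lambda>a x. Complex (g1 (of_int a / of_int (3 * k)) (x / of_int k)) (f1 (of_int a / of_int (3 * k)) (x / of_int k)))"
  define p where "p = pi / of_int (3 * k)"
  have lim: "(\<lambda>N. pole_sum (3 * k) a N x) \<longlonglongrightarrow> of_real p * G a x" if "x \<noteq> 0" "0 \<le> a" "a < 3 * k" for x a
    unfolding pole_sum_def p_def G_def by (rule residue_ball_sum_tendsto) (use that k in auto)
  have "(\<lambda>N. class_sum (3 * k) a c N w) \<longlonglongrightarrow>
    (x\<^sup>2 + y\<^sup>2 + 4 * x * y) * Re ((of_real p * G a x) * (of_real p * G c y))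
    - (if a = 0 then (y + x / 2)\<^sup>2 / x * Re (of_real p * G c (y + x / 2)) else 0)
    - (if c = 0 then (x + y / 2)\<^sup>2 / y * Re (of_real p * G a (x + y / 2)) else 0)"
  proof -
    have i: "(\<lambda>N. if b then u N else (0::real)) \<longlonglongrightarrow> (if b then l else 0)" if "u \<longlonglongrightarrow> l" for b u l
      using that by simp
    have "3 * k > 0" using k by simp
    show ?thesis
      unfolding xy class_sum_eq[OF \<open>3 * k > 0\<close>]
      by (intro tendsto_diff tendsto_mult tendsto_const tendsto_Re i lim nz a c)
  qed
  moreover have "(pi / of_int (3 * k))\<^sup>2 * gker k a c w = (x\<^sup>2 + y\<^sup>2 + 4 * x * y) * Re ((of_real p * G a x) * (of_real p * G c y))
    - (if a = 0 then (y + x / 2)\<^sup>2 / x * Re (of_real p * G c (y + x / 2)) else 0)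
    - (if c = 0 then (x + y / 2)\<^sup>2 / y * Re (of_real p * G a (x + y / 2)) else 0)"
  proof -
    have q: "3 * of_int k / (pi * x) = 1 / (p * x)" for x
      by (simp add: p_def)
    have p0: "p \<noteq> 0" using k by (simp add: p_def)
    show ?thesis
      unfolding gker_def xy fst_conv snd_conv p_def[symmetric] q G_def using p0 nz
      by (simp add: field_simps power2_eq_square)
  qed
  ultimately show ?thesis by simp
qed

text \<open>A majorant independent of N has to survive near the lines w1 = 0 and w2 = 0. The
  singular summands 1 / x and 1 / y are therefore separated from the pole sums and cancelled against
  the subtractions, which leaves difference quotients of regular functions.\<close>

lemma class_sum_bound:
  assumes k: "k > 0" and a: "0 \<le> a" "a < 3 * k" and c: "0 \<le> c" "c < 3 * k"
  obtains B where "\<And>N w. w \<in> g2_regular \<Longrightarrow> \<bar>class_sum (3 * k) a c N w\<bar> \<le> B * (1 + norm w) ^ 4"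
proof -
  obtain A where A: "A \<ge> 0" "\<And>N x. norm (pole_sum_reg (3 * k) a N x) \<le> A * (1 + \<bar>x\<bar>)"
    by (rule norm_pole_sum_reg_le[OF k a]) blast
  obtain C where C: "C \<ge> 0" "\<And>N x. norm (pole_sum_reg (3 * k) c N x) \<le> C * (1 + \<bar>x\<bar>)"
    by (rule norm_pole_sum_reg_le[OF k c]) blast
  define S where "S = inverse_square_const"
  have S0: "S \<ge> 0" using sum_inverse_squares_le[of "{}"] by (simp add: S_def)
  \<comment> \<open>The 5 comes from |x + 4 y| <= 5 t. The 8 rounds up 15 / 2, which is 3 / 2 times
    y^2 + (y + x/2)^2 <= 5 t^2.\<close>
  have edge: "\<bar>(x + 4 * y) * Re (pole_sum_reg L e N y) + (y\<^sup>2 * Re (pole_sum_reg L e N y) - (y + x / 2)\<^sup>2 * Re (pole_sum_reg L e N (y + x / 2))) / x\<bar>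
     \<le> (5 * E + 8 * S) * t ^ 4"
    if E: "E \<ge> 0" "\<And>N x. norm (pole_sum_reg L e N x) \<le> E * (1 + \<bar>x\<bar>)"
      and t: "t \<ge> 1" "1 + \<bar>x\<bar> \<le> t" "1 + \<bar>y\<bar> \<le> t" and x: "x \<noteq> 0" for L e N x y t E
  proof -
    have "\<bar>Re (pole_sum_reg L e N y)\<bar> \<le> E * t"
      using order.trans[OF abs_Re_le_cmod E(2)[of N y]] mult_left_mono[OF t(3) E(1)] by linarith
    moreover have "\<bar>x + 4 * y\<bar> \<le> 5 * t" using t by (auto simp: abs_if split: if_splits)
    ultimately have "\<bar>(x + 4 * y) * Re (pole_sum_reg L e N y)\<bar> \<le> (5 * t) * (E * t)"
      unfolding abs_mult by (intro mult_mono) (use t in auto)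
    also have "\<dots> = 5 * E * t ^ 2" by (simp add: power2_eq_square)
    also have "\<dots> \<le> 5 * E * t ^ 4" using E t by (intro mult_left_mono power_increasing) auto
    finally have 1: "\<bar>(x + 4 * y) * Re (pole_sum_reg L e N y)\<bar> \<le> 5 * E * t ^ 4" .
    have y: "\<bar>y\<bar> \<le> t" "\<bar>y + x / 2\<bar> \<le> 2 * t" using t by (auto simp: abs_if split: if_splits)
    have sq: "y\<^sup>2 \<le> t\<^sup>2" "(y + x / 2)\<^sup>2 \<le> (2 * t)\<^sup>2"
      using power_mono[OF y(1), of 2] power_mono[OF y(2), of 2] by simp_all
    have "\<bar>y\<^sup>2 * Re (pole_sum_reg L e N y) - (y + x / 2)\<^sup>2 * Re (pole_sum_reg L e N (y + x / 2))\<bar>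
       \<le> \<bar>y - (y + x / 2)\<bar> * (3 * (y\<^sup>2 + (y + x / 2)\<^sup>2)) * S"
      unfolding S_def by (rule pole_sum_reg_cubic_diff_le)
    also have "\<dots> = \<bar>x\<bar> * (3 / 2 * (y\<^sup>2 + (y + x / 2)\<^sup>2) * S)" by (simp add: abs_divide)
    also have "\<dots> \<le> \<bar>x\<bar> * (8 * t ^ 2 * S)"
    proof (intro mult_left_mono mult_right_mono S0)
      have "(2 * t)\<^sup>2 = 4 * t\<^sup>2" by simp
      thus "3 / 2 * (y\<^sup>2 + (y + x / 2)\<^sup>2) \<le> 8 * t\<^sup>2"
        using sq zero_le_power2[of t] unfolding distrib_left by linarith
    qed simp
    also have "\<dots> \<le> \<bar>x\<bar> * (8 * t ^ 4 * S)"
      using S0 t by (intro mult_left_mono mult_right_mono power_increasing) auto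
    finally have 2: "\<bar>(y\<^sup>2 * Re (pole_sum_reg L e N y) - (y + x / 2)\<^sup>2 * Re (pole_sum_reg L e N (y + x / 2))) / x\<bar> \<le> 8 * t ^ 4 * S"
      using x unfolding abs_divide by (subst pos_divide_le_eq) (simp_all only: zero_less_abs_iff mult.commute not_False_eq_True)
    have "(5 * E + 8 * S) * t ^ 4 = 5 * E * t ^ 4 + 8 * t ^ 4 * S" by (simp add: algebra_simps)
    thus ?thesis using order.trans[OF abs_triangle_ineq add_mono[OF 1 2]] by (simp only:)
  qed
  have main: "\<bar>class_sum (3 * k) a c N (x, y)\<bar> \<le> (6 * (A * C) + (5 * C + 8 * S) + (5 * A + 8 * S) + 3) * (1 + norm (x, y)) ^ 4"
    if w: "(x, y) \<in> g2_regular" for N x y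
  proof -
    define t where "t = 1 + norm (x, y)"
    have t: "t \<ge> 1" "1 + \<bar>x\<bar> \<le> t" "1 + \<bar>y\<bar> \<le> t"
      using norm_fst_le[of x y] norm_snd_le[of y x] by (auto simp: t_def)
    have nz: "x \<noteq> 0" "y \<noteq> 0" "y + x / 2 \<noteq> 0" "x + y / 2 \<noteq> 0" using w by (auto simp: g2_regular_def)
    define da dc :: real where "da = (if a = 0 then 1 else 0)" and "dc = (if c = 0 then 1 else 0)"
    define U V where "U = pole_sum_reg (3 * k) a N x" and "V = pole_sum_reg (3 * k) c N y"
    define U' V' where "U' = pole_sum_reg (3 * k) a N (x + y / 2)" and "V' = pole_sum_reg (3 * k) c N (y + x / 2)"
    define P where "P = x\<^sup>2 + y\<^sup>2 + 4 * x * y"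
    define e1 where "e1 = (x + 4 * y) * Re V + (y\<^sup>2 * Re V - (y + x / 2)\<^sup>2 * Re V') / x"
    define e2 where "e2 = (y + 4 * x) * Re U + (x\<^sup>2 * Re U - (x + y / 2)\<^sup>2 * Re U') / y"
    have L: "3 * k > 0" using k by simp
    have ps: "pole_sum (3 * k) a N u = of_real (da / u) + pole_sum_reg (3 * k) a N u"
      "pole_sum (3 * k) c N u = of_real (dc / u) + pole_sum_reg (3 * k) c N u" for u
      by (simp_all add: pole_sum_eq[OF L] da_def dc_def)
    have "class_sum (3 * k) a c N (x, y) = P * Re ((of_real (da / x) + U) * (of_real (dc / y) + V))
      - da * ((y + x / 2)\<^sup>2 / x * (dc / (y + x / 2) + Re V')) - dc * ((x + y / 2)\<^sup>2 / y * (da / (x + y / 2) + Re U'))"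
      unfolding class_sum_eq[OF L] ps U_def V_def U'_def V'_def P_def by (simp add: da_def dc_def)
    \<comment> \<open>The coefficient of da dc is P / (x y) - (y + x/2) / x - (x + y/2) / y = 4 -
      1/2 - 1/2 = 3.\<close>
    also have "\<dots> = P * Re (U * V) + da * e1 + dc * e2 + 3 * da * dc"
    proof -
      have "Re ((of_real (da / x) + U) * (of_real (dc / y) + V)) = da * dc / (x * y) + da / x * Re V + dc / y * Re U + Re (U * V)"
        by (simp add: algebra_simps)
      moreover have m: "u\<^sup>2 / v * (d / u + q) = u * d / v + u\<^sup>2 * q / v" if "u \<noteq> 0" for u v d q :: real
        using that by (simp add: distrib_left power2_eq_square)
      moreover have "(y + x / 2)\<^sup>2 / x * (dc / (y + x / 2) + Re V') = (y + x / 2) * dc / x + (y + x / 2)\<^sup>2 * Re V' / x"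
        using nz by (intro m)
      moreover have "(x + y / 2)\<^sup>2 / y * (da / (x + y / 2) + Re U') = (x + y / 2) * da / y + (x + y / 2)\<^sup>2 * Re U' / y"
        using nz by (intro m)
      moreover have "P * (da * dc / (x * y) + da / x * v + dc / y * u + uv)
         - da * ((y + x / 2) * dc / x + q * v' / x) - dc * ((x + y / 2) * da / y + r * u' / y)
         = P * uv + da * ((x + 4 * y) * v + (y\<^sup>2 * v - q * v') / x) + dc * ((y + 4 * x) * u + (x\<^sup>2 * u - r * u') / y) + 3 * da * dc"
        for u v uv u' v' q r
        using nz(1,2) unfolding P_def by (simp add: field_simps power2_eq_square)
      ultimately show ?thesis unfolding e1_def e2_def by (simp only:)
    qed
    finally have "\<bar>class_sum (3 * k) a c N (x, y)\<bar> \<le> \<bar>P * Re (U * V)\<bar> + \<bar>da * e1\<bar> + \<bar>dc * e2\<bar> + \<bar>3 * da * dc\<bar>"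
      by linarith
    also have "\<dots> \<le> 6 * (A * C) * t ^ 4 + (5 * C + 8 * S) * t ^ 4 + (5 * A + 8 * S) * t ^ 4 + 3 * t ^ 4"
    proof (intro add_mono)
      have "\<bar>x\<bar> * \<bar>x\<bar> \<le> t * t" "\<bar>y\<bar> * \<bar>y\<bar> \<le> t * t" "\<bar>x\<bar> * \<bar>y\<bar> \<le> t * t"
        by (rule mult_mono; use t in linarith)+
      hence "\<bar>x * x\<bar> \<le> t * t" "\<bar>y * y\<bar> \<le> t * t" "\<bar>x * y\<bar> \<le> t * t" by (simp_all only: abs_mult)
      hence "\<bar>P\<bar> \<le> 6 * t\<^sup>2" unfolding P_def power2_eq_square mult.assoc by linarith
      moreover have "\<bar>Re (U * V)\<bar> \<le> (A * t) * (C * t)"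
      proof -
        have "norm U \<le> A * t" "norm V \<le> C * t"
          using A(2)[of N x] C(2)[of N y] mult_left_mono[OF t(2) A(1)] mult_left_mono[OF t(3) C(1)]
          by (simp_all add: U_def V_def)
        hence "norm U * norm V \<le> (A * t) * (C * t)" using A C t by (intro mult_mono) auto
        thus ?thesis using abs_Re_le_cmod[of "U * V"] by (simp add: norm_mult)
      qed
      ultimately have "\<bar>P * Re (U * V)\<bar> \<le> (6 * t\<^sup>2) * ((A * t) * (C * t))"
        unfolding abs_mult by (intro mult_mono) auto
      thus "\<bar>P * Re (U * V)\<bar> \<le> 6 * (A * C) * t ^ 4"
        by (simp add: power4_eq_xxxx power2_eq_square mult_ac)
      have "\<bar>e1\<bar> \<le> (5 * C + 8 * S) * t ^ 4"
        unfolding e1_def V_def V'_def by (rule edge) (use C t nz in auto)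
      thus "\<bar>da * e1\<bar> \<le> (5 * C + 8 * S) * t ^ 4" using C S0 by (auto simp: da_def)
      have "\<bar>e2\<bar> \<le> (5 * A + 8 * S) * t ^ 4"
        unfolding e2_def U_def U'_def by (rule edge) (use A t nz in auto)
      thus "\<bar>dc * e2\<bar> \<le> (5 * A + 8 * S) * t ^ 4" using A S0 by (auto simp: dc_def)
      show "\<bar>3 * da * dc\<bar> \<le> 3 * t ^ 4" using one_le_power[OF t(1), of 4] by (auto simp: da_def dc_def)
    qed
    finally show ?thesis by (simp add: algebra_simps t_def)
  qed
  show thesis by (rule that) (use main in auto)
qed

subsection \<open>Removable singularities of \<open>g\<^bsub>k,r\<^esub>\<close>\<close>

text \<open>Integrals over \<open>lborel\<close> call for Borel measurability, so the values of
  \<open>g2\<close> on the exceptional null set matter. Off S a limit along S exists exactly where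
  the oscillation of F vanishes. That set E is Borel, \<open>Lim\<close> is continuous on it, and
  elsewhere off S it has one default value.\<close>

lemma Lim_within_measurable:
  fixes F :: "real \<times> real \<Rightarrow> real" and S :: "(real \<times> real) set"
  assumes S: "closure S = UNIV" "S \<in> sets borel" and F: "F \<in> borel_measurable borel"
  shows "(\<lambda>w. if w \<in> S then F w else Lim (at w within S) F) \<in> borel_measurable borel"
proof -
  \<comment> \<open>The points near which F oscillates by at most 1 / (n + 1) along S; open by
    construction.\<close>
  define O' where "O' = (\<lambda>n :: nat. \<Union>{B. open B \<and> (\<forall>x\<in>B \<inter> S. \<forall>y\<in>B \<inter> S. \<bar>F x - F y\<bar> \<le> 1 / real (Suc n))})"
  define E where "E = (\<Inter>n. O' n) - S"
  have nt: "at w within S \<noteq> bot" if "w \<notin> S" for w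
  proof -
    have "w \<in> closure S" using S by simp
    thus ?thesis using that by (simp add: closure_def trivial_limit_within)
  qed
  have osc: "\<exists>B. open B \<and> w \<in> B \<and> (\<forall>x\<in>B \<inter> S. \<forall>y\<in>B \<inter> S. \<bar>F x - F y\<bar> < e)" if w: "w \<in> E" and e: "e > 0" for w e
  proof -
    obtain n where n: "1 / real (Suc n) < e"
      using reals_Archimedean[OF e] by (auto simp: inverse_eq_divide)
    have "w \<in> O' n" using w by (simp add: E_def)
    then obtain B where "open B" "w \<in> B" "\<forall>x\<in>B \<inter> S. \<forall>y\<in>B \<inter> S. \<bar>F x - F y\<bar> \<le> 1 / real (Suc n)"
      unfolding O'_def by blast
    thus ?thesis using n by (intro exI[of _ B] conjI ballI) (auto intro: le_less_trans)
  qed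
  have lim: "(F \<longlongrightarrow> Lim (at w within S) F) (at w within S)" if w: "w \<in> E" for w
  proof -
    have "w \<notin> S" using w by (simp add: E_def)
    have "cauchy_filter (filtermap F (at w within S))"
      unfolding cauchy_filter_metric_filtermap
    proof (intro allI impI)
      fix e :: real assume "e > 0"
      then obtain B where B: "open B" "w \<in> B" "\<forall>x\<in>B \<inter> S. \<forall>y\<in>B \<inter> S. \<bar>F x - F y\<bar> < e"
        using osc[OF w] by blast
      have "eventually (\<lambda>x. x \<in> B \<inter> S) (at w within S)"
        using B \<open>w \<notin> S\<close> unfolding eventually_at_topological by auto
      thus "\<exists>P. eventually P (at w within S) \<and> (\<forall>x y. P x \<and> P y \<longrightarrow> dist (F x) (F y) < e)"
        using B by (intro exI[of _ "\<lambda>x. x \<in> B \<inter> S"]) (auto simp: dist_real_def)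
    qed
    moreover have "filtermap F (at w within S) \<noteq> bot" using nt[OF \<open>w \<notin> S\<close>] by (simp add: filtermap_bot_iff)
    ultimately obtain l where "filtermap F (at w within S) \<le> nhds l"
      using complete_uniform[of "UNIV :: real set"] complete_UNIV by (auto simp: complete_uniform)
    hence "(F \<longlongrightarrow> l) (at w within S)" by (simp add: filterlim_def)
    thus ?thesis using tendsto_Lim[OF nt[OF \<open>w \<notin> S\<close>]] by metis
  qed
  have cont: "continuous_on E (\<lambda>w. Lim (at w within S) F)"
    unfolding continuous_on_def tendsto_iff
  proof (intro ballI allI impI)
    fix w and e :: real assume w: "w \<in> E" and e: "e > 0"
    obtain B where B: "open B" "w \<in> B" "\<forall>x\<in>B \<inter> S. \<forall>y\<in>B \<inter> S. \<bar>F x - F y\<bar> < e / 2"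
      using osc[OF w, of "e / 2"] e by auto
    have near: "\<exists>x\<in>B \<inter> S. \<bar>F x - Lim (at v within S) F\<bar> < e / 4" if "v \<in> E" "v \<in> B" for v
    proof -
      have "v \<notin> S" using that by (simp add: E_def)
      have "eventually (\<lambda>x. x \<in> B \<inter> S) (at v within S)"
        using B that \<open>v \<notin> S\<close> unfolding eventually_at_topological by auto
      moreover have "eventually (\<lambda>x. dist (F x) (Lim (at v within S) F) < e / 4) (at v within S)"
        using lim[OF that(1)] e by (intro tendstoD) auto
      ultimately have "eventually (\<lambda>x. x \<in> B \<inter> S \<and> \<bar>F x - Lim (at v within S) F\<bar> < e / 4) (at v within S)"
        by eventually_elim (auto simp: dist_real_def)
      thus ?thesis using eventually_happens'[OF nt[OF \<open>v \<notin> S\<close>]] by blast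
    qed
    have "dist (Lim (at v within S) F) (Lim (at w within S) F) < e" if v: "v \<in> E" "v \<in> B" for v
    proof -
      obtain x y where xy: "x \<in> B \<inter> S" "y \<in> B \<inter> S" "\<bar>F x - Lim (at v within S) F\<bar> < e / 4" "\<bar>F y - Lim (at w within S) F\<bar> < e / 4"
        using near[OF v] near[OF w B(2)] by blast
      have "\<bar>F x - F y\<bar> < e / 2" using B(3) xy by blast
      thus ?thesis using xy(3,4) unfolding dist_real_def by linarith
    qed
    thus "eventually (\<lambda>v. dist (Lim (at v within S) F) (Lim (at w within S) F) < e) (at w within E)"
      using B unfolding eventually_at_topological by blast
  qed
  \<comment> \<open>Where no limit exists, \<open>Lim\<close> is a definite description with
    unsatisfiable predicate, hence the same value at all such points.\<close>
  have junk: "Lim (at w within S) F = (THE l. False)" if "w \<notin> S" "w \<notin> E" for w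
  proof -
    have "\<not> (F \<longlongrightarrow> l) (at w within S)" for l
    proof
      assume l: "(F \<longlongrightarrow> l) (at w within S)"
      have "w \<in> O' n" for n
      proof -
        have "eventually (\<lambda>x. dist (F x) l < 1 / real (Suc n) / 2) (at w within S)"
          by (rule tendstoD[OF l]) simp
        then obtain B where B: "open B" "w \<in> B" "\<forall>x\<in>B. x \<noteq> w \<longrightarrow> x \<in> S \<longrightarrow> dist (F x) l < 1 / real (Suc n) / 2"
          unfolding eventually_at_topological by blast
        have "\<forall>x\<in>B \<inter> S. \<forall>y\<in>B \<inter> S. \<bar>F x - F y\<bar> \<le> 1 / real (Suc n)"
        proof (intro ballI)
          fix x y assume "x \<in> B \<inter> S" "y \<in> B \<inter> S"
          hence "dist (F x) l < 1 / real (Suc n) / 2" "dist (F y) l < 1 / real (Suc n) / 2"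
            using B(3) \<open>w \<notin> S\<close> by auto
          thus "\<bar>F x - F y\<bar> \<le> 1 / real (Suc n)" 
            using dist_triangle_half_l[of "F x" l "1 / real (Suc n)" "F y"] by (simp add: dist_real_def)
        qed
        thus "w \<in> O' n" using B unfolding O'_def by blast
      qed
      thus False using that by (simp add: E_def)
    qed
    thus ?thesis by (simp add: t2_space_class.Lim_def)
  qed
  have "open (O' n)" for n unfolding O'_def by (intro open_Union) auto
  hence E_sets: "E \<in> sets borel" unfolding E_def using S(2) by (intro sets.Diff sets.countable_INT) auto
  have eq: "(\<lambda>w. if w \<in> S then F w else Lim (at w within S) F) =
      (\<lambda>w. if w \<in> S then F w else if w \<in> E then Lim (at w within S) F else (THE l. False))"
    using junk by auto
  have ext: "(\<lambda>w. if w \<in> E then Lim (at w within S) F else (THE l. False)) \<in> borel_measurable borel"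
    by (rule borel_measurable_continuous_on_if[OF E_sets cont]) simp
  show ?thesis unfolding eq by (rule measurable_If_set[OF F ext]) (simp add: S(2))
qed

lemma g2_regular_borel: "g2_regular \<in> sets borel"
proof -
  have "open {w :: real \<times> real. fst w \<noteq> 0 \<and> snd w \<noteq> 0 \<and> snd w + fst w / 2 \<noteq> 0 \<and> fst w + snd w / 2 \<noteq> 0}"
    by (intro open_Collect_conj open_Collect_neq continuous_intros) auto
  moreover have "{w :: real \<times> real. fst w \<noteq> 0 \<and> snd w \<noteq> 0 \<and> snd w + fst w / 2 \<noteq> 0 \<and> fst w + snd w / 2 \<noteq> 0} = g2_regular"
    by (auto simp: g2_regular_def)
  ultimately show ?thesis by simp
qed

text \<open>A nonempty open set cannot lie in the null complement.\<close>

lemma closure_g2_regular: "closure g2_regular = UNIV"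
proof -
  have "- g2_regular \<in> null_sets lborel"
    using AE_g2_regular g2_regular_borel by (subst AE_iff_null_sets) (auto simp: Compl_in_sets_lebesgue)
  hence "negligible (- g2_regular)"
    by (simp add: negligible_iff_null_sets null_sets_completionI)
  moreover have "- closure g2_regular \<subseteq> - g2_regular" using closure_subset by blast
  ultimately have "negligible (- closure g2_regular)" by (rule negligible_subset)
  hence "- closure g2_regular = {}" using open_not_negligible[of "- closure g2_regular"] by (auto simp: open_Compl)
  thus ?thesis by blast
qed

text \<open>The convention g_(k,(r,0)) = g_(k,(0,r)) keeps the order of the variables, which forces
  the exchange of indices for c = 0.\<close>

lemma g2_formula_eq:
  assumes "w \<in> g2_regular"
  shows "g2_formula k (a, c) w = (if c = 0 then gker k c a w else gker k a c w)"
proof -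
  have f0: "f1 0 x = 0" for x by (simp add: f1_def)
  obtain x y where "w = (x, y)" by force
  thus ?thesis by (simp add: gker_def f0 g1_def)
qed

lemma g2_measurable [measurable]: "g2 k r \<in> borel_measurable borel"
proof -
  define a c where "a = fst r mod (3 * k)" and "c = snd r mod (3 * k)"
  let ?F = "\<lambda>w. if c = 0 then gker k c a w else gker k a c w"
  have "(\<lambda>w. if w \<in> g2_regular then ?F w else Lim (at w within g2_regular) ?F) \<in> borel_measurable borel"
    by (intro Lim_within_measurable closure_g2_regular g2_regular_borel) measurable
  moreover have "Lim (at w within g2_regular) (g2_formula k (a, c)) = Lim (at w within g2_regular) ?F" for w
  proof -
    have "eventually (\<lambda>v. g2_formula k (a, c) v = ?F v) (at w within g2_regular)"
      unfolding eventually_at_filter by (auto simp: g2_formula_eq)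
    thus ?thesis by (rule Lim_cong) simp
  qed
  hence "g2 k r w = (if w \<in> g2_regular then ?F w else Lim (at w within g2_regular) ?F)" for w
    by (simp add: g2_def Let_def a_def[symmetric] c_def[symmetric] g2_formula_eq)
  ultimately show ?thesis by presburger
qed

lemma gker_swap: "gker k a c (snd w, fst w) = gker k c a w"
  by (simp add: gker_def algebra_simps)

text \<open>The convention for (r, 0) is invisible after integration because Q is symmetric; off a
  null set \<open>g2\<close> is otherwise \<open>gker\<close>.\<close>

lemma integral_g2:
  assumes "0 \<le> a" "a < 3 * k" "0 \<le> c" "c < 3 * k"
  shows "(LINT w|lborel. of_real (g2 k (a, c) w) * qgauss z w) = (LINT w|lborel. of_real (gker k a c w) * qgauss z w)"
proof -
  have "(LINT w|lborel. of_real (g2 k (a, c) w) * qgauss z w) =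
     (LINT w|lborel. of_real (if c = 0 then gker k c a w else gker k a c w) * qgauss z w)"
  proof (rule integral_cong_AE)
    show "AE w in lborel. of_real (g2 k (a, c) w) * qgauss z w = of_real (if c = 0 then gker k c a w else gker k a c w) * qgauss z w"
      using AE_g2_regular by eventually_elim (use assms in \<open>simp add: g2_def Let_def g2_formula_eq\<close>)
  qed measurable
  also have "\<dots> = (LINT w|lborel. of_real (gker k a c w) * qgauss z w)"
    using integral_qgauss_swap[OF gker_measurable, of k a c z] by (cases "c = 0") (simp_all add: gker_swap)
  finally show ?thesis .
qed

subsection \<open>Comparison of the two lattice sums\<close>

lemma class_integral_tendsto:
  assumes z: "Re z > 0" and k: "k > 0" and a: "0 \<le> a" "a < 3 * k" and c: "0 \<le> c" "c < 3 * k"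
  shows "(\<lambda>N. \<Sum>r\<in>residue_ball (3 * k) a N \<times> residue_ball (3 * k) c N.
      half_term z (real_of_int (fst r)) (real_of_int (snd r)) + half_term z (real_of_int (snd r)) (real_of_int (fst r)))
    \<longlonglongrightarrow> of_real ((pi / of_int (3 * k))\<^sup>2) * (LINT w|lborel. of_real (g2 k (a, c) w) * qgauss z w)"
proof -
  obtain B where B: "\<And>N w. w \<in> g2_regular \<Longrightarrow> \<bar>class_sum (3 * k) a c N w\<bar> \<le> B * (1 + norm w) ^ 4"
    by (rule class_sum_bound[OF k a c]) blast
  let ?dom = "\<lambda>w :: real \<times> real. B * (1 + norm w) ^ 4 * exp (- (pi * Re z / 3) * (norm w)\<^sup>2)"
  have "(\<lambda>N. LINT w|lborel. of_real (class_sum (3 * k) a c N w) * qgauss z w) \<longlonglongrightarrow>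
    (LINT w|lborel. of_real ((pi / of_int (3 * k))\<^sup>2 * gker k a c w) * qgauss z w)"
  proof (rule integral_dominated_convergence[where w = ?dom])
    show "integrable lborel ?dom" using z by (intro integrable_poly_gaussian) simp
    show "AE w in lborel. (\<lambda>N. of_real (class_sum (3 * k) a c N w) * qgauss z w) \<longlonglongrightarrow>
       of_real ((pi / of_int (3 * k))\<^sup>2 * gker k a c w) * qgauss z w"
      using AE_g2_regular
      by eventually_elim (intro tendsto_mult tendsto_of_real tendsto_const class_sum_tendsto k a c)
    show "AE w in lborel. norm (of_real (class_sum (3 * k) a c N w) * qgauss z w) \<le> ?dom w" for N
      using AE_g2_regular
    proof eventually_elim
      case (elim w)
      show ?case
        unfolding norm_mult norm_of_real
        by (intro mult_mono' B elim norm_qgauss_le z) auto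
    qed
  qed measurable
  moreover have "(LINT w|lborel. of_real (class_sum (3 * k) a c N w) * qgauss z w) =
      (\<Sum>r\<in>residue_ball (3 * k) a N \<times> residue_ball (3 * k) c N.
      half_term z (real_of_int (fst r)) (real_of_int (snd r)) + half_term z (real_of_int (snd r)) (real_of_int (fst r)))" for N
    unfolding class_sum_def of_real_sum sum_distrib_right
    by (subst Bochner_Integration.integral_sum) (auto intro!: termC_integral z sum.cong)
  moreover have "(LINT w|lborel. of_real ((pi / of_int (3 * k))\<^sup>2 * gker k a c w) * qgauss z w) =
     of_real ((pi / of_int (3 * k))\<^sup>2) * (LINT w|lborel. of_real (g2 k (a, c) w) * qgauss z w)"
    unfolding integral_g2[OF a c] of_real_mult mult.assoc by (rule integral_mult_right_zero)
  ultimately show ?thesis by simp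
qed

lemma zeta_pow_cong:
  assumes k: "k > 0" and Q: "[Qform r = Qform s] (mod 3 * k)"
  shows "zeta_pow h k r = zeta_pow h k s"
proof -
  have "3 * k dvd Qform r - Qform s" using Q by (simp add: cong_iff_dvd_diff)
  then obtain m where "Qform r - Qform s = 3 * k * m" by (elim dvdE)
  hence m: "Qform r = Qform s + 3 * k * m" by (simp only: diff_eq_eq add.commute)
  have "2 * of_real pi * \<i> * (- (of_int h / of_int k)) * (of_int (Qform r) / 3) =
    2 * of_real pi * \<i> * (- (of_int h / of_int k)) * (of_int (Qform s) / 3) + of_real (of_int (2 * (- h * m)) * pi) * \<i>"
    unfolding m using k by (simp add: field_simps)
  thus ?thesis unfolding zeta_pow_eq_exp[OF k] exp_eq by blast
qed

definition lat_classes :: "nat \<Rightarrow> int \<Rightarrow> (int \<times> int) set" where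
  "lat_classes \<nu> k = {r \<in> {0..<3 * k} \<times> {0..<3 * k}. [fst r = snd r + int \<nu>] (mod 3)}"

text \<open>A box of half-width 3kN meets a class modulo 3k in a product of residue balls. The root
  of unity depends only on the class, and so does membership in the lattice because 3 divides
  3k.\<close>

lemma sum_ibox_lat_classes:
  fixes f :: "int \<times> int \<Rightarrow> complex"
  assumes k: "k > 0"
  shows "(\<Sum>r\<in>ibox (3 * k) N \<inter> full_lat \<nu>. zeta_pow h k r * f r) =
    (\<Sum>s\<in>lat_classes \<nu> k. zeta_pow h k s * (\<Sum>r\<in>residue_ball (3 * k) (fst s) N \<times> residue_ball (3 * k) (snd s) N. f r))"
proof -
  define red where "red = (\<lambda>r :: int \<times> int. (fst r mod (3 * k), snd r mod (3 * k)))"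
  have mod3: "[a mod (3 * k) = a] (mod 3)" for a :: int
    by (simp add: cong_def mod_mod_cancel)
  have fin: "finite (lat_classes \<nu> k)"
    by (rule finite_subset[of _ "{0..<3 * k} \<times> {0..<3 * k}"]) (auto simp: lat_classes_def)
  have lat_red: "r \<in> full_lat \<nu> \<longleftrightarrow> red r \<in> lat_classes \<nu> k" for r
  proof -
    have "[fst r = snd r + int \<nu>] (mod 3) \<longleftrightarrow> [fst r mod (3 * k) = snd r mod (3 * k) + int \<nu>] (mod 3)"
    proof -
      have "(snd r mod (3 * k) + int \<nu>) mod 3 = (snd r + int \<nu>) mod 3"
        using mod3[of "snd r"] unfolding cong_def by (rule mod_add_cong) simp
      thus ?thesis using mod3[of "fst r"] by (simp only: cong_def)
    qed
    thus ?thesis using k by (simp add: full_lat_def lat_classes_def red_def)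
  qed
  have "(\<Sum>r\<in>ibox (3 * k) N \<inter> full_lat \<nu>. zeta_pow h k r * f r) =
     (\<Sum>s\<in>lat_classes \<nu> k. \<Sum>r\<in>{r \<in> ibox (3 * k) N \<inter> full_lat \<nu>. red r = s}. zeta_pow h k r * f r)"
    by (rule sum.group[symmetric]) (use fin lat_red in auto)
  also have "\<dots> = (\<Sum>s\<in>lat_classes \<nu> k. zeta_pow h k s * (\<Sum>r\<in>residue_ball (3 * k) (fst s) N \<times> residue_ball (3 * k) (snd s) N. f r))"
  proof (intro sum.cong refl)
    fix s assume s: "s \<in> lat_classes \<nu> k"
    have "{r \<in> ibox (3 * k) N \<inter> full_lat \<nu>. red r = s} = residue_ball (3 * k) (fst s) N \<times> residue_ball (3 * k) (snd s) N"
      using s lat_red by (auto simp: ibox_def residue_ball_def red_def)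
    moreover have "zeta_pow h k r = zeta_pow h k s" if "red r = s" for r
    proof (rule zeta_pow_cong[OF k])
      have "[fst r = fst s] (mod 3 * k)" "[snd r = snd s] (mod 3 * k)"
        using that by (auto simp: red_def cong_def)
      thus "[Qform r = Qform s] (mod 3 * k)"
        by (cases r, cases s) (auto intro!: cong_add cong_mult cong_pow)
    qed
    ultimately show "(\<Sum>r\<in>{r \<in> ibox (3 * k) N \<inter> full_lat \<nu>. red r = s}. zeta_pow h k r * f r) =
       zeta_pow h k s * (\<Sum>r\<in>residue_ball (3 * k) (fst s) N \<times> residue_ball (3 * k) (snd s) N. f r)"
      by (auto simp: sum_distrib_left red_def residue_ball_def intro!: sum.cong)
  qed
  finally show ?thesis .
qed

text \<open>The overview's X(r) with the opposite sign.\<close>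

definition cross_term :: "complex \<Rightarrow> int \<times> int \<Rightarrow> complex" where
  "cross_term z r = of_real ((real_of_int (fst r) + real_of_int (snd r) / 2) * real_of_int (snd r))
     * intK z (real_of_int (Qform r)) (real_of_int (snd r))"

lemma intK_even: "intK z A (- l) = intK z A l" and intJ_even: "intJ z A (- l) = intJ z A l"
  by (simp_all add: intK_def intJ_def kerK_def kerJ_def)

text \<open>From 4 Q >= (|r1| + |r2|)^2 > M^2 and Q >= b^2 follows Q >= |b| M / 2. Together with the
  fourth-order decay of \<open>intK\<close> in r2 this leaves |r2|^(-3) and a factor 1 / M.\<close>

lemma norm_cross_term_le:
  assumes z: "Re z > 0" and M: "M > 0" and r: "\<bar>fst r\<bar> + \<bar>snd r\<bar> > M" and l: "snd r \<noteq> 0"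
  shows "norm (cross_term z r) \<le> 2 * moment_bound z / of_int M * (1 / \<bar>real_of_int (snd r)\<bar> ^ 3)"
proof -
  define a l b A where "a = real_of_int (fst r)" and "l = real_of_int (snd r)" and "b = a + l / 2" and "A = real_of_int (Qform r)"
  have A: "A = b\<^sup>2 + 3 / 4 * l\<^sup>2" "A = a\<^sup>2 + l\<^sup>2 + a * l"
    by (cases r, simp add: A_def b_def a_def l_def power2_eq_square field_simps)+
  have l0: "l \<noteq> 0" using l by (simp add: l_def)
  have m0: "moment_bound z \<ge> 0" unfolding moment_bound_def by (rule integral_nonneg_AE) simp
  have Mr: "real_of_int M < \<bar>a\<bar> + \<bar>l\<bar>"
  proof -
    have "real_of_int M < real_of_int (\<bar>fst r\<bar> + \<bar>snd r\<bar>)" using r by (simp only: of_int_less_iff)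
    thus ?thesis by (simp add: a_def l_def)
  qed
  have "0 < l\<^sup>2" using l0 by simp
  hence A0: "A > 0" "b\<^sup>2 \<le> A" unfolding A(1) using zero_le_power2[of b] by linarith+
  have "(of_int M)\<^sup>2 \<le> (\<bar>a\<bar> + \<bar>l\<bar>)\<^sup>2" using Mr M by (intro power_mono) auto
  also have "\<dots> \<le> 4 * A"
  proof -
    have "4 * A - (\<bar>a\<bar> + \<bar>l\<bar>)\<^sup>2 = 3 * (\<bar>a\<bar> - \<bar>l\<bar>)\<^sup>2 + 4 * (\<bar>a * l\<bar> + a * l)"
      unfolding A(2) power2_sum power2_diff abs_mult power2_abs by (simp add: algebra_simps)
    moreover have "\<bar>a * l\<bar> + a * l \<ge> 0" by linarith
    ultimately show ?thesis by (smt (verit) zero_le_power2)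
  qed
  finally have M4: "(of_int M / 2)\<^sup>2 \<le> A" by (simp add: power_divide)
  have "\<bar>b\<bar> * (of_int M / 2) \<le> A"
  proof (rule power2_le_imp_le)
    have "(\<bar>b\<bar> * (of_int M / 2))\<^sup>2 = b\<^sup>2 * (of_int M / 2)\<^sup>2" by (simp only: power_mult_distrib power2_abs)
    also have "\<dots> \<le> A * A" using M4 A0 by (intro mult_mono) auto
    finally show "(\<bar>b\<bar> * (of_int M / 2))\<^sup>2 \<le> A\<^sup>2" by (simp add: power2_eq_square)
  qed (use A0 in simp)
  hence bA: "\<bar>b\<bar> / A \<le> 2 / of_int M" using A0 M by (simp add: field_simps)
  have "norm (cross_term z r) = \<bar>b * l\<bar> * norm (intK z A l)"
    unfolding cross_term_def norm_mult norm_of_real a_def[symmetric] l_def[symmetric] b_def[symmetric] A_def[symmetric] by simp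
  also have "\<dots> \<le> \<bar>b * l\<bar> * (moment_bound z / (l ^ 4 * A))"
    by (intro mult_left_mono norm_intK_le z A0 l0) simp
  also have "\<dots> = (\<bar>b\<bar> / A) * (moment_bound z * (1 / \<bar>l\<bar> ^ 3))"
  proof -
    have "l ^ 4 = \<bar>l\<bar> * \<bar>l\<bar> ^ 3" by (simp add: power4_eq_xxxx power3_eq_cube abs_mult[symmetric])
    thus ?thesis using l0 by (simp add: abs_mult)
  qed
  also have "\<dots> \<le> (2 / of_int M) * (moment_bound z * (1 / \<bar>l\<bar> ^ 3))"
    using m0 by (intro mult_right_mono bA) auto
  finally show ?thesis by (simp add: l_def)
qed

text \<open>
  The terms are odd under \<open>(r\<^sub>1, r\<^sub>2) \<mapsto> (r\<^sub>1 + r\<^sub>2, - r\<^sub>2)\<close>, but the series does not converge absolutely: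
  what remains of the sum over a box is the sum over the part of the box that this map moves out of it.
\<close>
lemma cross_term_sum_tendsto_0:
  assumes z: "Re z > 0" and k: "k > 0"
  shows "(\<lambda>N. \<Sum>r\<in>ibox (3 * k) N \<inter> full_lat \<nu>. zeta_pow h k r * cross_term z r) \<longlonglongrightarrow> 0"
proof (rule Lim_null_comparison)
  let ?C = "2 * moment_bound z * inverse_square_const"
  show "eventually (\<lambda>N. norm (\<Sum>r\<in>ibox (3 * k) N \<inter> full_lat \<nu>. zeta_pow h k r * cross_term z r) \<le> ?C / real N) sequentially"
    using eventually_gt_at_top[of 0]
  proof eventually_elim
    case (elim N)
    define M where "M = 3 * k * int N"
    have M: "M > 0" using k elim by (simp add: M_def)
    have m0: "moment_bound z \<ge> 0" unfolding moment_bound_def by (rule integral_nonneg_AE) simp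
    define B where "B = ibox (3 * k) N \<inter> full_lat \<nu>"
    define D where "D = {r \<in> B. \<bar>fst r + snd r\<bar> > M}"
    define f where "f = (\<lambda>r. zeta_pow h k r * cross_term z r)"
    \<comment> \<open>The involution fixes b = r1 + r2 / 2 and negates l = r2; hence it preserves Q
      = b^2 + (3/4) l^2 and negates b l.\<close>
    define \<sigma> where "\<sigma> = (\<lambda>r :: int \<times> int. (fst r + snd r, - snd r))"
    have fin: "finite B" "finite D" by (simp_all add: B_def D_def)
    have odd: "f (\<sigma> r) = - f r" for r
    proof -
      have Q: "Qform (\<sigma> r) = Qform r" by (cases r) (simp add: \<sigma>_def power2_eq_square algebra_simps)
      have "zeta_pow h k (\<sigma> r) = zeta_pow h k r" by (simp add: zeta_pow_def Q)
      moreover have "cross_term z (\<sigma> r) = - cross_term z r"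
        unfolding cross_term_def Q by (simp add: \<sigma>_def intK_even field_simps)
      ultimately show ?thesis by (simp add: f_def)
    qed
    have mem: "\<sigma> r \<in> B - D" if "r \<in> B - D" for r
    proof -
      have r: "\<bar>fst r\<bar> \<le> M" "\<bar>snd r\<bar> \<le> M" "\<bar>fst r + snd r\<bar> \<le> M" "[fst r = snd r + int \<nu>] (mod 3)"
        using that by (auto simp: B_def D_def ibox_def M_def full_lat_def)
      have "3 dvd fst r - (snd r + int \<nu>)" using r(4) by (simp add: cong_iff_dvd_diff)
      \<comment> \<open>Under the involution the difference of the coordinates changes by 3 r2, so
        the congruence modulo 3 persists.\<close>
      hence "3 dvd (fst r - (snd r + int \<nu>)) + 3 * snd r" by (intro dvd_add) auto
      hence "[fst r + snd r = - snd r + int \<nu>] (mod 3)" by (simp add: cong_iff_dvd_diff algebra_simps)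
      thus "\<sigma> r \<in> B - D" using r by (auto simp: B_def D_def ibox_def M_def full_lat_def \<sigma>_def)
    qed
    have "\<sigma> (\<sigma> r) = r" for r by (simp add: \<sigma>_def)
    hence "sum f (B - D) = sum (\<lambda>r. f (\<sigma> r)) (B - D)"
      by (intro sum.reindex_bij_witness[where i = \<sigma> and j = \<sigma>]) (simp_all only: mem)
    hence "sum f (B - D) = 0" by (simp add: odd sum_negf)
    hence "sum f B = sum f D"
      using sum.subset_diff[of D B f] fin by (simp add: D_def)
    also have "norm \<dots> \<le> (\<Sum>r\<in>D. 2 * moment_bound z / of_int M * (1 / \<bar>real_of_int (snd r)\<bar> ^ 3))"
    proof (rule sum_norm_le)
      fix r assume r: "r \<in> D"
      have "snd r \<noteq> 0" using r by (auto simp: D_def B_def ibox_def M_def)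
      moreover have "\<bar>fst r\<bar> + \<bar>snd r\<bar> > M" using r abs_triangle_ineq[of "fst r" "snd r"] by (auto simp: D_def)
      ultimately show "norm (f r) \<le> 2 * moment_bound z / of_int M * (1 / \<bar>real_of_int (snd r)\<bar> ^ 3)"
        unfolding f_def norm_mult using norm_cross_term_le[OF z M] by simp
    qed
    also have "\<dots> = (\<Sum>l\<in>{- M..M}. \<Sum>r\<in>{r \<in> D. snd r = l}. 2 * moment_bound z / of_int M * (1 / \<bar>real_of_int (snd r)\<bar> ^ 3))"
      by (rule sum.group[symmetric]) (use fin in \<open>auto simp: D_def B_def ibox_def M_def\<close>)
    also have "\<dots> \<le> (\<Sum>l\<in>{- M..M}. 2 * moment_bound z / of_int M * (1 / (real_of_int l)\<^sup>2))"
    proof (rule sum_mono)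
      fix l :: int
      \<comment> \<open>At height l at most |l| points leave the box, which turns the bound |l|^(-3)
        into the summable 1 / l^2.\<close>
      have "{r \<in> D. snd r = l} \<subseteq> (if l \<ge> 0 then {M - l<..M} else {- M..<- M - l}) \<times> {l}"
        by (auto simp: D_def B_def ibox_def M_def)
      hence "card {r \<in> D. snd r = l} \<le> card ((if l \<ge> 0 then {M - l<..M} else {- M..<- M - l}) \<times> {l})"
        by (intro card_mono) auto
      also have "\<dots> = nat \<bar>l\<bar>" by (simp add: card_cartesian_product)
      finally have card: "real (card {r \<in> D. snd r = l}) \<le> \<bar>real_of_int l\<bar>" by linarith
      have "(\<Sum>r\<in>{r \<in> D. snd r = l}. 2 * moment_bound z / of_int M * (1 / \<bar>real_of_int (snd r)\<bar> ^ 3))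
         = real (card {r \<in> D. snd r = l}) * (2 * moment_bound z / of_int M * (1 / \<bar>real_of_int l\<bar> ^ 3))"
        by simp
      also have "\<dots> \<le> \<bar>real_of_int l\<bar> * (2 * moment_bound z / of_int M * (1 / \<bar>real_of_int l\<bar> ^ 3))"
        using m0 M by (intro mult_right_mono card) auto
      also have "\<dots> = 2 * moment_bound z / of_int M * (1 / (real_of_int l)\<^sup>2)"
        by (cases "l = 0") (simp_all add: power2_eq_square power3_eq_cube abs_mult[symmetric])
      finally show "(\<Sum>r\<in>{r \<in> D. snd r = l}. 2 * moment_bound z / of_int M * (1 / \<bar>real_of_int (snd r)\<bar> ^ 3))
         \<le> 2 * moment_bound z / of_int M * (1 / (real_of_int l)\<^sup>2)" .
    qed
    also have "\<dots> \<le> 2 * moment_bound z / of_int M * inverse_square_const"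
      unfolding sum_distrib_left[symmetric] using m0 M by (intro mult_left_mono sum_inverse_squares_le) auto
    also have "\<dots> = ?C / of_int M" by simp
    also have "\<dots> \<le> ?C / real N"
    proof (rule divide_left_mono)
      have "1 * int N \<le> 3 * k * int N" using k by (intro mult_right_mono) auto
      thus "real N \<le> of_int M" unfolding M_def by (metis mult_1 of_int_le_iff of_int_of_nat_eq)
      show "0 \<le> ?C" using m0 sum_inverse_squares_le[of "{}"] by simp
    qed (use M elim in auto)
    finally show ?case by (simp add: B_def f_def)
  qed
  show "(\<lambda>N. ?C / real N) \<longlonglongrightarrow> 0" by (rule lim_const_over_n)
qed

theorem theorem4p2:
  fixes \<nu> :: nat and h' k :: int and z :: complex
  assumes "k > 0" and "Re z > 0"
  shows "Eichler2 \<nu> (- (of_int h' / of_int k)) (of_int h' / of_int k + \<i> * z) =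
    - (2 * of_real pi ^ 2 / (27 * of_real (sqrt 3) * of_int k ^ 2))
    * (\<Sum>r\<in>{r \<in> {0..<3 * k} \<times> {0..<3 * k}. [fst r = snd r + int \<nu>] (mod 3)}.
        root_unity (3 * k) powi (- h' * Qform r)
        * (LINT w|lborel. of_real (g2 k r w) * exp (- (2 / 3) * of_real pi * z * of_real (Qform w))))"
proof -
  note k = assms(1) and z = assms(2)
  define B where "B = (\<lambda>N. ibox (3 * k) N \<inter> full_lat \<nu>)"
  define J where "J = (\<lambda>r :: int \<times> int. intJ z (real_of_int (Qform r)) (real_of_int (snd r)))"
  define H where "H = (\<lambda>r :: int \<times> int. half_term z (real_of_int (fst r)) (real_of_int (snd r)))"
  \<comment> \<open>The plain exchange would turn the congruence into r2 = r1 + \<open>\<nu>\<close>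
    modulo 3; the additional negation restores it and leaves \<open>half_term\<close> unchanged,
    since b l and l^2 are even in r.\<close>
  define \<phi> where "\<phi> = (\<lambda>r :: int \<times> int. (- snd r, - fst r))"
  define E where "E = Eichler2 \<nu> (- (of_int h' / of_int k)) (of_int h' / of_int k + \<i> * z)"
  define R where "R = (\<Sum>r\<in>lat_classes \<nu> k. zeta_pow h' k r * (LINT w|lborel. of_real (g2 k r w) * qgauss z w))"
  have H: "H r = 3 * J r - cross_term z r" for r
    by (cases r) (simp add: H_def J_def half_term_def cross_term_def)
  have Hswap: "half_term z (real_of_int (snd r)) (real_of_int (fst r)) = H (\<phi> r)" for r
    by (cases r) (simp add: H_def \<phi>_def half_term_def intJ_even intK_even algebra_simps)
  have mem: "\<phi> r \<in> B N" if r: "r \<in> B N" for r N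
  proof -
    have "3 dvd fst r - (snd r + int \<nu>)" using r by (simp add: B_def full_lat_def cong_iff_dvd_diff)
    hence "[- snd r = - fst r + int \<nu>] (mod 3)" by (simp add: cong_iff_dvd_diff algebra_simps)
    thus ?thesis using r by (auto simp: B_def full_lat_def \<phi>_def ibox_def)
  qed
  have inv: "\<phi> (\<phi> r) = r" for r by (simp add: \<phi>_def)
  have "zeta_pow h' k (\<phi> r) = zeta_pow h' k r" for r
    by (cases r) (simp add: zeta_pow_def \<phi>_def algebra_simps)
  hence sym: "(\<Sum>r\<in>B N. zeta_pow h' k r * H (\<phi> r)) = (\<Sum>r\<in>B N. zeta_pow h' k r * H r)" for N
    by (intro sum.reindex_bij_witness[where i = \<phi> and j = \<phi>]) (simp_all only: mem inv)
  have "(\<lambda>N. \<Sum>r\<in>B N. zeta_pow h' k r * (H r + half_term z (real_of_int (snd r)) (real_of_int (fst r))))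
     \<longlonglongrightarrow> (\<Sum>r\<in>lat_classes \<nu> k. zeta_pow h' k r * (of_real ((pi / of_int (3 * k))\<^sup>2) * (LINT w|lborel. of_real (g2 k r w) * qgauss z w)))"
    unfolding B_def H_def sum_ibox_lat_classes[OF k]
  proof (intro tendsto_sum tendsto_mult tendsto_const)
    fix s assume "s \<in> lat_classes \<nu> k"
    hence "0 \<le> fst s" "fst s < 3 * k" "0 \<le> snd s" "snd s < 3 * k" by (auto simp: lat_classes_def)
    from class_integral_tendsto[OF z k this]
    show "(\<lambda>N. \<Sum>r\<in>residue_ball (3 * k) (fst s) N \<times> residue_ball (3 * k) (snd s) N.
         half_term z (real_of_int (fst r)) (real_of_int (snd r)) + half_term z (real_of_int (snd r)) (real_of_int (fst r)))
       \<longlonglongrightarrow> of_real ((pi / of_int (3 * k))\<^sup>2) * (LINT w|lborel. of_real (g2 k s w) * qgauss z w)" by simp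
  qed
  also have "(\<lambda>N. \<Sum>r\<in>B N. zeta_pow h' k r * (H r + half_term z (real_of_int (snd r)) (real_of_int (fst r)))) =
    (\<lambda>N. 2 * (\<Sum>r\<in>B N. zeta_pow h' k r * H r))"
    unfolding Hswap distrib_left sum.distrib sym by simp
  also have "(\<Sum>r\<in>lat_classes \<nu> k. zeta_pow h' k r * (of_real ((pi / of_int (3 * k))\<^sup>2) * (LINT w|lborel. of_real (g2 k r w) * qgauss z w)))
     = of_real ((pi / of_int (3 * k))\<^sup>2) * R"
    unfolding R_def sum_distrib_left by (intro sum.cong refl) (simp only: mult.left_commute)
  finally have lim1: "(\<lambda>N. 2 * (\<Sum>r\<in>B N. zeta_pow h' k r * H r)) \<longlonglongrightarrow> of_real ((pi / of_int (3 * k))\<^sup>2) * R" .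
  \<comment> \<open>The factor undoes 4 / sqrt 3 and replaces it by the coefficient 6 that J(r) has
    in 2 \<open>H r\<close>.\<close>
  have "(\<lambda>N. (of_real (6 * sqrt 3 / 4)) * (\<Sum>r\<in>B N. zeta_pow h' k r * (of_real (4 / sqrt 3) * J r))
      - 2 * (\<Sum>r\<in>B N. zeta_pow h' k r * cross_term z r)) \<longlonglongrightarrow> of_real (6 * sqrt 3 / 4) * (- E) - 2 * 0"
    unfolding B_def J_def E_def
    by (intro tendsto_diff tendsto_mult tendsto_const Eichler2_limit cross_term_sum_tendsto_0 k z)
  also have "(\<lambda>N. (of_real (6 * sqrt 3 / 4)) * (\<Sum>r\<in>B N. zeta_pow h' k r * (of_real (4 / sqrt 3) * J r))
      - 2 * (\<Sum>r\<in>B N. zeta_pow h' k r * cross_term z r)) = (\<lambda>N. 2 * (\<Sum>r\<in>B N. zeta_pow h' k r * H r))"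
  proof
    fix N
    have "of_real (6 * sqrt 3 / 4) * (x * (of_real (4 / sqrt 3) * y)) = 2 * (x * (3 * y))" for x y :: complex
    proof -
      have "(6 * sqrt 3 / 4) * (4 / sqrt 3) = (6 :: real)" by simp
      hence "of_real (6 * sqrt 3 / 4) * of_real (4 / sqrt 3) = (6 :: complex)"
        by (metis of_real_mult of_real_numeral)
      thus ?thesis by (simp add: algebra_simps del: of_real_divide of_real_mult)
    qed
    thus "of_real (6 * sqrt 3 / 4) * (\<Sum>r\<in>B N. zeta_pow h' k r * (of_real (4 / sqrt 3) * J r))
      - 2 * (\<Sum>r\<in>B N. zeta_pow h' k r * cross_term z r) = 2 * (\<Sum>r\<in>B N. zeta_pow h' k r * H r)"
      unfolding H sum_distrib_left sum_subtractf[symmetric] by (intro sum.cong refl) (simp only: right_diff_distrib)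
  qed
  finally have lim2: "(\<lambda>N. 2 * (\<Sum>r\<in>B N. zeta_pow h' k r * H r)) \<longlonglongrightarrow> of_real (6 * sqrt 3 / 4) * (- E) - 2 * 0" .
  have "of_real (6 * sqrt 3 / 4) * (- E) - 2 * 0 = of_real ((pi / of_int (3 * k))\<^sup>2) * R"
    using LIMSEQ_unique[OF lim2 lim1] .
  hence *: "of_real (6 * sqrt 3 / 4) * E = - (of_real ((pi / of_int (3 * k))\<^sup>2) * R)"
    by (simp only: mult_minus_right mult_zero_right diff_zero) (simp only: minus_equation_iff)
  have "E = of_real (4 / (6 * sqrt 3)) * (of_real (6 * sqrt 3 / 4) * E)"
    by (simp add: mult.assoc[symmetric])
  also have "\<dots> = - (2 * of_real pi ^ 2 / (27 * of_real (sqrt 3) * of_int k ^ 2)) * R"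
    unfolding * using k by (simp add: field_simps power2_eq_square)
  finally show ?thesis unfolding E_def R_def lat_classes_def zeta_pow_def qgauss_def .
qed

end
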